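(* Let $N\ge2$, let $\Omega\subset\mathbb{R}^N$ be a domain with compact $C^2$ boundary, $a\in\partial\Omega$, $q_c=2N-1$, and let $g:\mathbb{R}\to\mathbb{R}$ be continuous with $$\liminf_{r\to\infty}\frac{g(r)}{r^{q_c}}>0\quad\text{and}\quad\limsup_{r\to-\infty}\frac{g(r)}{|r|^{q_c}}<0.$$ Let $u\in C^1(\overline\Omega\setminus\{a\})$ be a solution of $-\operatorname{div}(|Du|^{N-2}Du)+g(u)=0$ in $\Omega$ which coincides on $\partial\Omega\setminus\{a\}$ with some $\phi\in C^1(\partial\Omega)$. Then $u$ extends to $\overline\Omega$ as a continuous function.
   Context: Solutions are understood in the weak sense. *)

theory Defs
  imports "HOL-Analysis.Analysis"
begin

definition C1_on :: "('a::euclidean_space \<Rightarrow> real) \<Rightarrow> 'a set \<Rightarrow> bool" where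
  "C1_on f S \<longleftrightarrow> (\<exists>f'. (\<forall>x\<in>S. (f has_derivative (\<lambda>h. f' x \<bullet> h)) (at x))
                         \<and> continuous_on S f')"

definition C2_on :: "('a::euclidean_space \<Rightarrow> real) \<Rightarrow> 'a set \<Rightarrow> bool" where
  "C2_on f S \<longleftrightarrow> (\<exists>f'. (\<forall>x\<in>S. (f has_derivative (\<lambda>h. f' x \<bullet> h)) (at x))
                         \<and> (\<forall>i\<in>Basis. C1_on (\<lambda>x. f' x \<bullet> i) S))"

definition compact_C2_boundary :: "('a::euclidean_space) set \<Rightarrow> bool" where
  "compact_C2_boundary \<Omega> \<longleftrightarrow> compact (frontier \<Omega>) \<and>
     (\<forall>p\<in>frontier \<Omega>. \<exists>r>0. \<exists>\<rho> D\<rho>.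
        (\<forall>x\<in>ball p r. (\<rho> has_derivative (\<lambda>h. D\<rho> x \<bullet> h)) (at x) \<and> D\<rho> x \<noteq> 0)
        \<and> C2_on \<rho> (ball p r)
        \<and> \<Omega> \<inter> ball p r = {x\<in>ball p r. \<rho> x < 0})"

definition test_fun :: "('a::euclidean_space) set \<Rightarrow> ('a \<Rightarrow> real) \<Rightarrow> ('a \<Rightarrow> 'a) \<Rightarrow> bool" where
  "test_fun \<Omega> \<zeta> D\<zeta> \<longleftrightarrow> (\<forall>x. (\<zeta> has_derivative (\<lambda>h. D\<zeta> x \<bullet> h)) (at x))
     \<and> continuous_on UNIV D\<zeta>
     \<and> (\<exists>K. compact K \<and> K \<subseteq> \<Omega> \<and> (\<forall>x. x \<notin> K \<longrightarrow> \<zeta> x = 0))"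

text \<open>Weak solution of  -div(|Du|^(N-2) Du) + g(u) = 0  in \<Omega>, where Du is the gradient
  of u in \<Omega>, N = CARD('n).\<close>
definition weak_solution ::
  "(real^'n) set \<Rightarrow> (real \<Rightarrow> real) \<Rightarrow> (real^'n \<Rightarrow> real) \<Rightarrow> (real^'n \<Rightarrow> real^'n) \<Rightarrow> bool" where
  "weak_solution \<Omega> g u Du \<longleftrightarrow>
     (\<forall>\<zeta> D\<zeta>. test_fun \<Omega> \<zeta> D\<zeta> \<longrightarrow>
        (LINT x:\<Omega>|lborel. norm (Du x) ^ (CARD('n) - 2) * (Du x \<bullet> D\<zeta> x) + g (u x) * \<zeta> x) = 0)"

end

theory Submission
  imports Defs
begin

text \<open>
  The proof is a comparison argument with explicit barriers. The inversion at \<open>a\<close>, followed by a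
  translation, maps the complement of a ball touching \<open>\<Omega>\<close> at \<open>a\<close> from outside to a half-space
  \<open>e \<bullet> z > 0\<close> and \<open>a\<close> to infinity. The \<open>N\<close>-Laplacian is conformally invariant, so the equation
  becomes \<open>- \<Delta>\<^sub>N v + W g(v) = 0\<close> with \<open>W z\<close> comparable to \<open>|z|\<close> to the power \<open>- 2 N\<close>; the
  exponent \<open>2 N - 1\<close> is the one for which this is invariant under the scaling \<open>\<lambda> v(z / \<lambda>)\<close>, so
  barriers are needed at unit scale only.

  A barrier of Keller-Osserman type gives \<open>v - M \<le> C (e \<bullet> z)\<close> for large \<open>M\<close>. If \<open>K\<close> is the least
  constant with \<open>v - M \<le> K (e \<bullet> z)\<close> and \<open>K > 0\<close>, the absorption in balls tangent to the boundary
  lowers \<open>K\<close> by an amount that does not depend on the size of the ball; hence \<open>K = 0\<close> and \<open>u\<close> is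
  bounded above near \<open>a\<close>. Then the excess of \<open>v\<close> over the boundary value at infinity is reduced by
  a fixed factor on every larger scale, so it vanishes. The same applies to \<open>- u\<close>.
\<close>

subsection \<open>Continuously differentiable maps\<close>

definition has_C1_derivative ::
    "('a::real_normed_vector \<Rightarrow> 'b::real_normed_vector) \<Rightarrow> ('a \<Rightarrow> 'a \<Rightarrow> 'b) \<Rightarrow> 'a set \<Rightarrow> bool" where
  "has_C1_derivative f f' S \<longleftrightarrow>
     (\<forall>x\<in>S. (f has_derivative f' x) (at x)) \<and> (\<forall>h. continuous_on S (\<lambda>x. f' x h))"

lemma has_C1_derivativeI:
  assumes "\<And>x. x \<in> S \<Longrightarrow> (f has_derivative f' x) (at x)" "\<And>h. continuous_on S (\<lambda>x. f' x h)"
  shows "has_C1_derivative f f' S"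
  using assms by (simp add: has_C1_derivative_def)

lemma has_C1_derivativeD:
  assumes "has_C1_derivative f f' S"
  shows "x \<in> S \<Longrightarrow> (f has_derivative f' x) (at x)" "continuous_on S (\<lambda>x. f' x h)"
  using assms by (auto simp: has_C1_derivative_def)

lemma has_C1_derivative_imp_continuous_on: "has_C1_derivative f f' S \<Longrightarrow> continuous_on S f"
  by (metis has_C1_derivativeD(1) continuous_at_imp_continuous_on has_derivative_continuous)

lemma has_C1_derivative_linear: "has_C1_derivative f f' S \<Longrightarrow> x \<in> S \<Longrightarrow> linear (f' x)"
  by (metis has_C1_derivativeD(1) has_derivative_linear)

lemma has_C1_derivative_subset: "has_C1_derivative f f' S \<Longrightarrow> T \<subseteq> S \<Longrightarrow> has_C1_derivative f f' T"
  unfolding has_C1_derivative_def using continuous_on_subset by blast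

lemma has_C1_derivative_cong:
  assumes "has_C1_derivative f f' S" "\<And>x h. x \<in> S \<Longrightarrow> f' x h = g' x h"
  shows "has_C1_derivative f g' S"
proof (rule has_C1_derivativeI)
  fix x assume "x \<in> S"
  moreover from this have "f' x = g' x" using assms(2) by blast
  ultimately show "(f has_derivative g' x) (at x)" using has_C1_derivativeD(1)[OF assms(1)] by metis
next
  show "continuous_on S (\<lambda>x. g' x h)" for h
    using has_C1_derivativeD(2)[OF assms(1), of h] assms(2) by (simp cong: continuous_on_cong)
qed

lemma has_C1_derivative_const_add:
  "has_C1_derivative f f' S \<Longrightarrow> has_C1_derivative (\<lambda>x. c + f x) f' S"
  unfolding has_C1_derivative_def using has_derivative_add[OF has_derivative_const] by fastforce

lemma has_C1_derivative_diff:
  assumes "has_C1_derivative f f' S" "has_C1_derivative g g' S"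
  shows "has_C1_derivative (\<lambda>x. f x - g x) (\<lambda>x h. f' x h - g' x h) S"
  using assms unfolding has_C1_derivative_def
  by (auto intro!: derivative_intros continuous_intros)

lemma has_C1_derivative_scaleR_right:
  "has_C1_derivative f f' S \<Longrightarrow> has_C1_derivative (\<lambda>x. c *\<^sub>R f x) (\<lambda>x h. c *\<^sub>R f' x h) S"
  unfolding has_C1_derivative_def
  by (auto intro!: has_derivative_scaleR_right continuous_intros)

lemma has_C1_derivative_scaleR:
  fixes f :: "'a::real_normed_vector \<Rightarrow> 'b::real_normed_vector" and c :: "'a \<Rightarrow> real"
  assumes "has_C1_derivative c c' S" "has_C1_derivative f f' S"
  shows "has_C1_derivative (\<lambda>x. c x *\<^sub>R f x) (\<lambda>x h. c x *\<^sub>R f' x h + c' x h *\<^sub>R f x) S"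
  using assms has_C1_derivative_imp_continuous_on[OF assms(1)] has_C1_derivative_imp_continuous_on[OF assms(2)]
  unfolding has_C1_derivative_def
  by (auto intro!: has_derivative_scaleR continuous_intros)

lemma has_C1_derivative_inner:
  fixes f g :: "'a::real_normed_vector \<Rightarrow> 'b::real_inner"
  assumes "has_C1_derivative f f' S" "has_C1_derivative g g' S"
  shows "has_C1_derivative (\<lambda>x. f x \<bullet> g x) (\<lambda>x h. f x \<bullet> g' x h + f' x h \<bullet> g x) S"
  using assms has_C1_derivative_imp_continuous_on[OF assms(1)] has_C1_derivative_imp_continuous_on[OF assms(2)]
  unfolding has_C1_derivative_def
  by (auto intro!: has_derivative_inner continuous_intros)

lemma has_C1_derivative_compose:
  fixes f :: "'a::real_normed_vector \<Rightarrow> 'b::euclidean_space"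
  assumes f_C1: "has_C1_derivative f f' S" and g_C1: "has_C1_derivative g g' T"
    and image_subset: "f ` S \<subseteq> T"
  shows "has_C1_derivative (\<lambda>x. g (f x)) (\<lambda>x h. g' (f x) (f' x h)) S"
proof (rule has_C1_derivativeI)
  fix x assume "x \<in> S"
  then show "((\<lambda>x. g (f x)) has_derivative (\<lambda>h. g' (f x) (f' x h))) (at x)"
    using has_derivative_compose[OF has_C1_derivativeD(1)[OF f_C1] has_C1_derivativeD(1)[OF g_C1]] image_subset
    by blast
next
  fix h
  have "g' (f x) (f' x h) = (\<Sum>i\<in>Basis. (f' x h \<bullet> i) *\<^sub>R g' (f x) i)" if "x \<in> S" for x
  proof -
    have "linear (g' (f x))" using has_C1_derivative_linear[OF g_C1] that image_subset by blast
    then have "(\<Sum>i\<in>Basis. (f' x h \<bullet> i) *\<^sub>R g' (f x) i) = g' (f x) (\<Sum>i\<in>Basis. (f' x h \<bullet> i) *\<^sub>R i)"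
      by (simp add: linear_sum linear_cmul)
    then show ?thesis by (simp add: euclidean_representation)
  qed
  moreover have "continuous_on S (\<lambda>x. \<Sum>i\<in>Basis. (f' x h \<bullet> i) *\<^sub>R g' (f x) i)"
    using continuous_on_compose2[OF has_C1_derivativeD(2)[OF g_C1]
        has_C1_derivative_imp_continuous_on[OF f_C1] image_subset]
    by (intro continuous_intros has_C1_derivativeD(2)[OF f_C1])
  ultimately show "continuous_on S (\<lambda>x. g' (f x) (f' x h))" by (simp cong: continuous_on_cong)
qed

lemma continuous_on_extend_zero:
  fixes f :: "'a::topological_space \<Rightarrow> 'b::real_normed_vector"
  assumes cont: "continuous_on S f" and "open S" "closed K" "K \<subseteq> S"
    and zero: "\<And>x. x \<in> S \<Longrightarrow> x \<notin> K \<Longrightarrow> f x = 0"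
  shows "continuous_on UNIV (\<lambda>x. if x \<in> S then f x else 0)"
proof -
  let ?f = "\<lambda>x. if x \<in> S then f x else 0"
  have "continuous_on S ?f" using cont by (simp cong: continuous_on_cong)
  moreover have "continuous_on (- K) ?f"
    by (rule continuous_on_eq[of _ "\<lambda>_. 0"]) (use zero in auto)
  ultimately have "continuous_on (S \<union> - K) ?f" using \<open>open S\<close> \<open>closed K\<close>
    by (intro continuous_on_open_Un) auto
  moreover have "S \<union> - K = UNIV" using \<open>K \<subseteq> S\<close> by auto
  ultimately show ?thesis by simp
qed

lemma has_C1_derivative_extend_zero:
  assumes f_C1: "has_C1_derivative f f' S" and "open S" "closed K" "K \<subseteq> S"
    and zero: "\<And>x. x \<in> S \<Longrightarrow> x \<notin> K \<Longrightarrow> f x = 0"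
  shows "has_C1_derivative (\<lambda>x. if x \<in> S then f x else 0) (\<lambda>x h. if x \<in> S then f' x h else 0) UNIV"
proof -
  let ?f = "\<lambda>x. if x \<in> S then f x else 0" and ?f' = "\<lambda>x h. if x \<in> S then f' x h else 0"
  have in_S: "(?f has_derivative ?f' x) (at x)" if "x \<in> S" for x
    using has_derivative_transform_within_open[OF has_C1_derivativeD(1)[OF f_C1 that] \<open>open S\<close> that,
        of ?f] that
    by simp
  have off_K: "(?f has_derivative (\<lambda>_. 0)) (at x)" if "x \<notin> K" for x
    by (rule has_derivative_transform_within_open[of "\<lambda>_. 0" _ _ _ "- K"])
       (use that zero \<open>closed K\<close> in auto)
  have f'_off_K: "f' x h = 0" if "x \<in> S" "x \<notin> K" for x h
    using has_derivative_unique[OF off_K in_S] that by (simp add: fun_eq_iff)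
  show ?thesis
  proof (rule has_C1_derivativeI)
    show "(?f has_derivative ?f' x) (at x)" for x
      using in_S[of x] off_K[of x] \<open>K \<subseteq> S\<close> by (cases "x \<in> S") auto
    show "continuous_on UNIV (\<lambda>x. ?f' x h)" for h
      by (rule continuous_on_extend_zero[OF has_C1_derivativeD(2)[OF f_C1] assms(2-4) f'_off_K])
  qed
qed

subsection \<open>Divergence\<close>

definition linear_trace :: "('a::euclidean_space \<Rightarrow> 'a) \<Rightarrow> real" where
  "linear_trace L = (\<Sum>b\<in>Basis. L b \<bullet> b)"

lemma linear_trace_add: "linear_trace (\<lambda>h. L h + M h) = linear_trace L + linear_trace M"
  by (simp add: linear_trace_def inner_add_left sum.distrib)

lemma linear_trace_diff: "linear_trace (\<lambda>h. L h - M h) = linear_trace L - linear_trace M"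
  by (simp add: linear_trace_def inner_diff_left sum_subtractf)

lemma linear_trace_scaleR: "linear_trace (\<lambda>h. c *\<^sub>R L h) = c * linear_trace L"
  by (simp add: linear_trace_def sum_distrib_left)

lemma linear_trace_ident: "linear_trace (\<lambda>h::'a. h) = real DIM('a::euclidean_space)"
  by (simp add: linear_trace_def)

lemma linear_trace_rank_one:
  assumes "linear f"
  shows "linear_trace (\<lambda>h. f h *\<^sub>R w) = f w"
proof -
  have "f w = f (\<Sum>b\<in>Basis. (w \<bullet> b) *\<^sub>R b)" by (simp add: euclidean_representation)
  also have "\<dots> = (\<Sum>b\<in>Basis. (w \<bullet> b) * f b)" by (simp add: assms linear_sum linear_cmul)
  finally show ?thesis by (simp add: linear_trace_def mult.commute)
qed

lemma integrable_compact_support: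
  fixes f :: "'a::euclidean_space \<Rightarrow> real"
  assumes "continuous_on UNIV f" "compact K" "\<And>x. x \<notin> K \<Longrightarrow> f x = 0"
  shows "integrable lborel f"
proof -
  have "integrable lborel (\<lambda>x. indicator K x *\<^sub>R f x)"
    by (rule borel_integrable_compact[OF assms(2) continuous_on_subset[OF assms(1) subset_UNIV]])
  moreover have "(\<lambda>x. indicator K x *\<^sub>R f x) = f"
    using assms(3) by (force simp: indicator_def)
  ultimately show ?thesis by simp
qed

lemma integral_translation:
  fixes f :: "'a::euclidean_space \<Rightarrow> real"
  assumes "integrable lborel f"
  shows "integral UNIV (\<lambda>x. f (x + a)) = integral UNIV f"
proof -
  have "integrable (distr lborel borel ((+) a)) f"
    "integral\<^sup>L (distr lborel borel ((+) a)) f = integral\<^sup>L lborel f"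
    using assms by (simp_all add: lborel_distr_plus)
  then have "integrable lborel (\<lambda>x. f (x + a))" "integral\<^sup>L lborel (\<lambda>x. f (x + a)) = integral\<^sup>L lborel f"
    using assms by (auto simp: integrable_distr_eq integral_distr add.commute)
  then show ?thesis using assms by (simp add: integral_lborel)
qed

lemma has_field_derivative_along_line:
  fixes f :: "'a::real_normed_vector \<Rightarrow> real"
  assumes "has_C1_derivative f f' UNIV"
  shows "((\<lambda>\<tau>. f (x + \<tau> *\<^sub>R b)) has_field_derivative f' (x + \<tau> *\<^sub>R b) b) (at \<tau> within T)"
proof -
  have "((\<lambda>\<tau>. f (x + \<tau> *\<^sub>R b)) has_derivative (\<lambda>h. f' (x + \<tau> *\<^sub>R b) (h *\<^sub>R b))) (at \<tau> within T)"
    by (rule has_derivative_compose[OF _ has_C1_derivativeD(1)[OF assms UNIV_I]])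
       (auto intro!: derivative_eq_intros)
  then show ?thesis
    by (simp add: has_field_derivative_def linear_cmul[OF has_C1_derivative_linear[OF assms UNIV_I]]
        mult.commute[of _ "f' (x + \<tau> *\<^sub>R b) b"])
qed

lemma has_C1_derivative_eq_0_off_support:
  fixes f :: "'a::real_normed_vector \<Rightarrow> 'b::real_normed_vector"
  assumes f_C1: "has_C1_derivative f f' UNIV" and "closed K" and "\<And>x. x \<notin> K \<Longrightarrow> f x = 0" and "x \<notin> K"
  shows "f' x h = 0"
proof -
  have "(f has_derivative (\<lambda>_. 0)) (at x)"
    by (rule has_derivative_transform_within_open[of "\<lambda>_. 0" _ _ _ "- K"]) (use assms in auto)
  then show ?thesis using has_derivative_unique[OF has_C1_derivativeD(1)[OF f_C1 UNIV_I]] by metis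
qed

lemma integral_eq_integral_UNIV:
  fixes f :: "'a::euclidean_space \<Rightarrow> real"
  assumes "\<And>x. x \<notin> S \<Longrightarrow> f x = 0"
  shows "integral S f = integral UNIV f"
  by (subst integral_restrict_UNIV[symmetric])
     (use assms in \<open>auto intro!: arg_cong[of _ _ "integral UNIV"]\<close>)

text \<open>The integral of \<open>f (x + \<tau> b)\<close> does not depend on \<open>\<tau>\<close>, so its derivative at \<open>\<tau> = 0\<close> vanishes.\<close>

lemma integral_directional_derivative_eq_0:
  fixes f :: "'a::euclidean_space \<Rightarrow> real"
  assumes f_C1: "has_C1_derivative f f' UNIV" and "compact K" and supp: "\<And>x. x \<notin> K \<Longrightarrow> f x = 0"
  shows "integral\<^sup>L lborel (\<lambda>x. f' x b) = 0" and "integrable lborel (\<lambda>x. f' x b)"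
proof -
  note cont_f = has_C1_derivative_imp_continuous_on[OF f_C1]
  note supp' = has_C1_derivative_eq_0_off_support[OF f_C1 compact_imp_closed[OF \<open>compact K\<close>] supp]
  show integrable: "integrable lborel (\<lambda>x. f' x b)"
    by (rule integrable_compact_support[OF has_C1_derivativeD(2)[OF f_C1] \<open>compact K\<close> supp'])
  have "compact ((\<lambda>(x, \<tau>). x - \<tau> *\<^sub>R b) ` (K \<times> {- 1..1}))"
    by (intro compact_continuous_image compact_Times \<open>compact K\<close> compact_Icc)
       (auto simp: case_prod_unfold intro!: continuous_intros)
  then obtain l u where image_subset_box: "(\<lambda>(x, \<tau>). x - \<tau> *\<^sub>R b) ` (K \<times> {- 1..1}) \<subseteq> cbox l u"
    using compact_imp_bounded bounded_subset_cbox_symmetric by metis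
  have outside: "x + \<tau> *\<^sub>R b \<notin> K" if "x \<notin> cbox l u" "\<tau> \<in> {- 1..1}" for x \<tau>
    using image_subset_box that by (force simp: image_subset_iff)
  have "((\<lambda>\<tau>. integral (cbox l u) (\<lambda>x. f (x + \<tau> *\<^sub>R b))) has_field_derivative
      integral (cbox l u) (\<lambda>x. f' (x + 0 *\<^sub>R b) b)) (at 0 within {- 1..1})"
  proof (rule leibniz_rule_field_derivative[OF has_field_derivative_along_line[OF f_C1]])
    show "(\<lambda>x. f (x + \<tau> *\<^sub>R b)) integrable_on cbox l u" for \<tau>
      by (intro integrable_continuous continuous_on_compose2[OF cont_f] continuous_intros) auto
    show "continuous_on ({- 1..1} \<times> cbox l u) (\<lambda>(\<tau>, x). f' (x + \<tau> *\<^sub>R b) b)"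
      unfolding case_prod_unfold
      by (intro continuous_on_compose2[OF has_C1_derivativeD(2)[OF f_C1]] continuous_intros) auto
  qed auto
  moreover have "integral (cbox l u) (\<lambda>x. f (x + \<tau> *\<^sub>R b)) = integral UNIV f" if "\<tau> \<in> {- 1..1}" for \<tau>
    using integral_eq_integral_UNIV[of "cbox l u" "\<lambda>x. f (x + \<tau> *\<^sub>R b)"] outside[OF _ that] supp
    by (simp add: integral_translation integrable_compact_support[OF cont_f \<open>compact K\<close> supp])
  then have "((\<lambda>\<tau>. integral (cbox l u) (\<lambda>x. f (x + \<tau> *\<^sub>R b))) has_field_derivative 0) (at 0 within {- 1..1})"
    by (intro has_field_derivative_transform_within[OF DERIV_const zero_less_one]) auto
  ultimately have "integral (cbox l u) (\<lambda>x. f' x b) = 0"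
    by (simp add: at_within_Icc_at DERIV_unique)
  moreover have "integral (cbox l u) (\<lambda>x. f' x b) = integral UNIV (\<lambda>x. f' x b)"
    using outside[of _ 0] supp' by (intro integral_eq_integral_UNIV) auto
  ultimately show "integral\<^sup>L lborel (\<lambda>x. f' x b) = 0" using integrable by (simp add: integral_lborel)
qed

theorem integral_divergence_eq_0:
  fixes F :: "'a::euclidean_space \<Rightarrow> 'a"
  assumes F_C1: "has_C1_derivative F F' UNIV" and "compact K" and supp: "\<And>x. x \<notin> K \<Longrightarrow> F x = 0"
  shows "integral\<^sup>L lborel (\<lambda>x. linear_trace (F' x)) = 0"
    and "integrable lborel (\<lambda>x. linear_trace (F' x))"
proof -
  have component: "has_C1_derivative (\<lambda>x. F x \<bullet> b) (\<lambda>x h. F' x h \<bullet> b) UNIV" for b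
    using F_C1 unfolding has_C1_derivative_def by (auto intro!: derivative_intros continuous_intros)
  note component_integral = integral_directional_derivative_eq_0[OF component \<open>compact K\<close>]
  show "integral\<^sup>L lborel (\<lambda>x. linear_trace (F' x)) = 0"
    unfolding linear_trace_def
    by (subst Bochner_Integration.integral_sum) (simp_all add: component_integral supp)
  show "integrable lborel (\<lambda>x. linear_trace (F' x))"
    unfolding linear_trace_def
    by (intro Bochner_Integration.integrable_sum component_integral(2)) (simp add: supp)
qed

lemma integral_pos_if_pos_on_open:
  fixes f :: "'a::euclidean_space \<Rightarrow> real"
  assumes "integrable lborel f" and nonneg: "\<And>x. 0 \<le> f x"
    and "open S" "S \<noteq> {}" and positive_on_S: "\<And>x. x \<in> S \<Longrightarrow> 0 < f x"
  shows "0 < integral\<^sup>L lborel f"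
proof (rule ccontr)
  assume "\<not> 0 < integral\<^sup>L lborel f"
  moreover have "0 \<le> integral\<^sup>L lborel f" using nonneg by simp
  ultimately have "AE x in lborel. f x = 0"
    using integral_nonneg_eq_0_iff_AE[OF assms(1)] nonneg by simp
  then have "AE x in lborel. x \<notin> S" using positive_on_S by (fastforce elim!: eventually_mono)
  then have "negligible S"
    using \<open>open S\<close> by (simp add: AE_iff_null negligible_iff_null_sets null_sets_completionI)
  then show False using \<open>open S\<close> \<open>S \<noteq> {}\<close> open_not_negligible by blast
qed

subsection \<open>The \<open>p\<close>-Laplacian and comparison\<close>

text \<open>The exponent \<open>m\<close> stands for \<open>p - 2\<close>.\<close>

definition has_p_laplacian ::
    "nat \<Rightarrow> ('a::euclidean_space \<Rightarrow> real) \<Rightarrow> ('a \<Rightarrow> real) \<Rightarrow> 'a set \<Rightarrow> bool" where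
  "has_p_laplacian m \<Psi> \<Delta> S \<longleftrightarrow>
     (\<exists>P F'. has_C1_derivative \<Psi> (\<lambda>x. (\<bullet>) (P x)) S
           \<and> has_C1_derivative (\<lambda>x. norm (P x) ^ m *\<^sub>R P x) F' S
           \<and> (\<forall>x\<in>S. \<Delta> x = linear_trace (F' x)))"

text \<open>\<open>v\<close> lies below every strict supersolution of the equation \<open>\<Delta>\<^sub>N \<Psi> = f\<close> that it does not exceed near the
  boundary of a subdomain.\<close>

definition comparison_subsolution ::
    "'a::euclidean_space set \<Rightarrow> ('a \<Rightarrow> real) \<Rightarrow> ('a \<Rightarrow> real) \<Rightarrow> bool" where
  "comparison_subsolution D v f \<longleftrightarrow>
     (\<forall>S \<Psi> \<Delta>. open S \<longrightarrow> S \<subseteq> D \<longrightarrow> has_p_laplacian (DIM('a) - 2) \<Psi> \<Delta> S \<longrightarrow>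
        (\<forall>\<epsilon>>0. compact {x \<in> S. \<Psi> x + \<epsilon> \<le> v x}) \<longrightarrow>
        (\<forall>x\<in>S. \<Psi> x < v x \<longrightarrow> \<Delta> x < f x) \<longrightarrow> (\<forall>x\<in>S. v x \<le> \<Psi> x))"

lemma comparison_subsolutionD:
  assumes "comparison_subsolution D v f" "open S" "S \<subseteq> D"
    "has_p_laplacian (DIM('a) - 2) \<Psi> \<Delta> S"
    "\<And>\<epsilon>. 0 < \<epsilon> \<Longrightarrow> compact {x \<in> S. \<Psi> x + \<epsilon> \<le> v x}"
    "\<And>x. x \<in> S \<Longrightarrow> \<Psi> x < v x \<Longrightarrow> \<Delta> x < f x" "x \<in> S"
  shows "v (x::'a::euclidean_space) \<le> \<Psi> x"
  using assms unfolding comparison_subsolution_def by blast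

lemma has_p_laplacian_subset: "has_p_laplacian m \<Psi> \<Delta> S \<Longrightarrow> T \<subseteq> S \<Longrightarrow> has_p_laplacian m \<Psi> \<Delta> T"
  unfolding has_p_laplacian_def by (meson has_C1_derivative_subset subsetD)

lemma has_p_laplacian_cong:
  "has_p_laplacian m \<Psi> \<Delta> S \<Longrightarrow> (\<And>x. x \<in> S \<Longrightarrow> \<Delta> x = \<Delta>' x) \<Longrightarrow> has_p_laplacian m \<Psi> \<Delta>' S"
  unfolding has_p_laplacian_def by metis

lemma has_p_laplacian_imp_continuous_on: "has_p_laplacian m \<Psi> \<Delta> S \<Longrightarrow> continuous_on S \<Psi>"
  unfolding has_p_laplacian_def using has_C1_derivative_imp_continuous_on by blast

lemma C1_gradient_continuous_on:
  fixes P :: "'a::euclidean_space \<Rightarrow> 'a"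
  assumes "has_C1_derivative \<Psi> (\<lambda>x. (\<bullet>) (P x)) S"
  shows "continuous_on S P"
  unfolding continuous_on_componentwise[of S P] using has_C1_derivativeD(2)[OF assms] by blast

lemma norm_power_scaleR_monotone:
  fixes p q :: "'a::real_inner"
  shows "0 \<le> (norm p ^ n *\<^sub>R p - norm q ^ n *\<^sub>R q) \<bullet> (p - q)"
proof -
  have "0 \<le> (norm p ^ Suc n - norm q ^ Suc n) * (norm p - norm q)"
  proof (cases "norm p \<le> norm q")
    case True
    then have "norm p ^ Suc n \<le> norm q ^ Suc n" by (intro power_mono) auto
    with True show ?thesis by (intro mult_nonpos_nonpos) auto
  next
    case False
    then have "norm q ^ Suc n \<le> norm p ^ Suc n" by (intro power_mono) auto
    with False show ?thesis by (intro mult_nonneg_nonneg) auto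
  qed
  also have "\<dots> = norm p ^ n * (norm p)\<^sup>2 + norm q ^ n * (norm q)\<^sup>2
      - (norm p ^ n + norm q ^ n) * (norm p * norm q)"
    by (simp add: algebra_simps power2_eq_square)
  also have "\<dots> \<le> norm p ^ n * (norm p)\<^sup>2 + norm q ^ n * (norm q)\<^sup>2 - (norm p ^ n + norm q ^ n) * (p \<bullet> q)"
    using norm_cauchy_schwarz[of p q] by (simp add: mult_left_mono)
  also have "\<dots> = (norm p ^ n *\<^sub>R p - norm q ^ n *\<^sub>R q) \<bullet> (p - q)"
    by (simp add: inner_diff_left inner_diff_right inner_commute power2_norm_eq_inner algebra_simps)
  finally show ?thesis .
qed

lemma pos_part_square_has_real_derivative:
  "((\<lambda>t. (max t 0)\<^sup>2) has_real_derivative 2 * max t 0) (at (t::real))"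
proof -
  have "((\<lambda>t. if t \<in> {0..} then t\<^sup>2 else 0) has_derivative
      (if t \<in> {0..} then (\<lambda>h. 2 * t * h) else (\<lambda>_. 0))) (at t within {0..} \<union> {..<0::real})"
    by (rule has_derivative_If_within_closures)
       (auto simp: closure_closed intro!: derivative_eq_intros)
  moreover have "{0..} \<union> {..<0::real} = UNIV" by auto
  moreover have "(\<lambda>t::real. if t \<in> {0..} then t\<^sup>2 else 0) = (\<lambda>t. (max t 0)\<^sup>2)" by (auto simp: max_def)
  moreover have "(if t \<in> {0..} then (\<lambda>h. 2 * t * h) else (\<lambda>_. 0)) = (*) (2 * max t 0)"
    by (auto simp: max_def fun_eq_iff)
  ultimately show ?thesis by (simp add: has_field_derivative_def)
qed

lemma has_C1_derivative_pos_part_square: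
  fixes w :: "'a::real_normed_vector \<Rightarrow> real"
  assumes "has_C1_derivative w w' S"
  shows "has_C1_derivative (\<lambda>x. (max (w x) 0)\<^sup>2) (\<lambda>x h. 2 * max (w x) 0 * w' x h) S"
proof -
  have "has_C1_derivative (\<lambda>t::real. (max t 0)\<^sup>2) (\<lambda>t. (*) (2 * max t 0)) UNIV"
    using pos_part_square_has_real_derivative
    by (auto simp: has_C1_derivative_def has_field_derivative_def intro!: continuous_intros)
  from has_C1_derivative_compose[OF assms this] show ?thesis by simp
qed

lemma test_fun_extend_zero:
  assumes \<zeta>_C1: "has_C1_derivative \<zeta> (\<lambda>x. (\<bullet>) (D x)) S" and S_open_subset: "open S" "S \<subseteq> \<Omega>"
    and K_compact_subset: "compact K" "K \<subseteq> S" and zero: "\<And>x. x \<in> S \<Longrightarrow> x \<notin> K \<Longrightarrow> \<zeta> x = 0"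
  shows "test_fun \<Omega> (\<lambda>x. if x \<in> S then \<zeta> x else 0) (\<lambda>x. if x \<in> S then D x else 0)"
proof -
  have extended: "has_C1_derivative (\<lambda>x. if x \<in> S then \<zeta> x else 0)
      (\<lambda>x. (\<bullet>) (if x \<in> S then D x else 0)) UNIV"
    by (rule has_C1_derivative_cong[OF
          has_C1_derivative_extend_zero[OF \<zeta>_C1 S_open_subset(1) _ K_compact_subset(2) zero]])
       (auto simp: compact_imp_closed[OF K_compact_subset(1)])
  show ?thesis
    unfolding test_fun_def
  proof (intro conjI allI exI[of _ K])
    show "x \<notin> K \<longrightarrow> (if x \<in> S then \<zeta> x else 0) = 0" for x using zero by simp
  qed (use C1_gradient_continuous_on[OF extended] has_C1_derivativeD(1)[OF extended]
      K_compact_subset S_open_subset(2) in auto)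
qed

lemma weak_solution_extend_zero:
  fixes \<Omega> :: "(real^'n) set"
  assumes solution: "weak_solution \<Omega> g u Du"
    and u_C1: "has_C1_derivative u (\<lambda>x. (\<bullet>) (Du x)) \<Omega>" and g_cont: "continuous_on UNIV g"
    and \<zeta>_C1: "has_C1_derivative \<zeta> (\<lambda>x. (\<bullet>) (D x)) S" and S_open_subset: "open S" "S \<subseteq> \<Omega>"
    and K_compact_subset: "compact K" "K \<subseteq> S" and zero: "\<And>x. x \<in> S \<Longrightarrow> x \<notin> K \<Longrightarrow> \<zeta> x = 0 \<and> D x = 0"
  defines "J \<equiv> \<lambda>x. if x \<in> S then norm (Du x) ^ (CARD('n) - 2) * (Du x \<bullet> D x) + g (u x) * \<zeta> x else 0"
  shows "integrable lborel J" and "integral\<^sup>L lborel J = 0"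
proof -
  note u_S = has_C1_derivative_subset[OF u_C1 S_open_subset(2)]
  have "continuous_on S (\<lambda>x. norm (Du x) ^ (CARD('n) - 2) * (Du x \<bullet> D x) + g (u x) * \<zeta> x)"
    by (intro continuous_intros C1_gradient_continuous_on[OF u_S] C1_gradient_continuous_on[OF \<zeta>_C1]
        has_C1_derivative_imp_continuous_on[OF \<zeta>_C1]
        continuous_on_compose2[OF g_cont has_C1_derivative_imp_continuous_on[OF u_S]]) simp
  then have "continuous_on UNIV J" unfolding J_def
    by (rule continuous_on_extend_zero[OF _ S_open_subset(1) compact_imp_closed[OF K_compact_subset(1)]
          K_compact_subset(2)]) (simp add: zero)
  then show "integrable lborel J"
    by (rule integrable_compact_support[OF _ K_compact_subset(1)]) (simp add: J_def zero)
  have "test_fun \<Omega> (\<lambda>x. if x \<in> S then \<zeta> x else 0) (\<lambda>x. if x \<in> S then D x else 0)"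
    using zero by (intro test_fun_extend_zero[OF \<zeta>_C1 S_open_subset K_compact_subset]) simp
  then have "(LINT x:\<Omega>|lborel. norm (Du x) ^ (CARD('n) - 2) * (Du x \<bullet> (if x \<in> S then D x else 0))
      + g (u x) * (if x \<in> S then \<zeta> x else 0)) = 0"
    using solution unfolding weak_solution_def by blast
  moreover have "(\<lambda>x. indicator \<Omega> x *\<^sub>R (norm (Du x) ^ (CARD('n) - 2) * (Du x \<bullet> (if x \<in> S then D x else 0))
      + g (u x) * (if x \<in> S then \<zeta> x else 0))) = J"
    using S_open_subset(2) by (auto simp: fun_eq_iff J_def indicator_def)
  ultimately show "integral\<^sup>L lborel J = 0" unfolding set_lebesgue_integral_def by simp
qed

lemma integration_by_parts_compact_support:
  fixes F :: "'a::euclidean_space \<Rightarrow> 'a"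
  assumes \<zeta>_C1: "has_C1_derivative \<zeta> (\<lambda>x. (\<bullet>) (D x)) S" and F_C1: "has_C1_derivative F F' S"
    and S_open: "open S" and K_compact_subset: "compact K" "K \<subseteq> S" and zero: "\<And>x. x \<in> S \<Longrightarrow> x \<notin> K \<Longrightarrow> \<zeta> x = 0"
  defines "J \<equiv> \<lambda>x. if x \<in> S then F x \<bullet> D x + linear_trace (F' x) * \<zeta> x else 0"
  shows "integrable lborel J" and "integral\<^sup>L lborel J = 0"
proof -
  let ?G' = "\<lambda>x h. if x \<in> S then \<zeta> x *\<^sub>R F' x h + (D x \<bullet> h) *\<^sub>R F x else 0"
  have product_C1: "has_C1_derivative (\<lambda>x. if x \<in> S then \<zeta> x *\<^sub>R F x else 0) ?G' UNIV"
    by (rule has_C1_derivative_extend_zero[OF has_C1_derivative_scaleR[OF \<zeta>_C1 F_C1] S_open _ K_compact_subset(2)])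
       (simp_all add: zero compact_imp_closed[OF K_compact_subset(1)])
  have "linear_trace (\<lambda>h. (D x \<bullet> h) *\<^sub>R F x) = F x \<bullet> D x" for x
    using linear_trace_rank_one[OF bounded_linear.linear[OF bounded_linear_inner_right]]
    by (simp add: inner_commute[of "F x"])
  then have "linear_trace (?G' x) = J x" for x
    by (simp add: J_def linear_trace_add linear_trace_scaleR linear_trace_def[of "\<lambda>_. 0"])
  then show "integrable lborel J" "integral\<^sup>L lborel J = 0"
    using integral_divergence_eq_0[OF product_C1 K_compact_subset(1)] by (simp_all add: zero)
qed

text \<open>Testing the equation for \<open>u\<close> and the identity for \<open>\<Psi>\<close> with the square of the positive part of
  \<open>u - \<Psi> - \<epsilon>\<close>, and subtracting.\<close>

lemma weak_solution_tested_with_excess: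
  fixes \<Omega> :: "(real^'n) set"
  assumes solution: "weak_solution \<Omega> g u Du"
    and u_C1: "has_C1_derivative u (\<lambda>x. (\<bullet>) (Du x)) \<Omega>" and g_cont: "continuous_on UNIV g"
    and S_open_subset: "open S" "S \<subseteq> \<Omega>" and \<Psi>_C1: "has_C1_derivative \<Psi> (\<lambda>x. (\<bullet>) (P x)) S"
    and flux_C1: "has_C1_derivative (\<lambda>x. norm (P x) ^ (CARD('n) - 2) *\<^sub>R P x) F' S"
    and boundary: "compact {x \<in> S. \<Psi> x + \<epsilon> \<le> u x}"
  obtains J where "integrable lborel J" "integral\<^sup>L lborel J = 0" "\<And>x. x \<notin> S \<Longrightarrow> J x = 0"
    "\<And>x. x \<in> S \<Longrightarrow> (g (u x) - linear_trace (F' x)) * (max (u x - \<Psi> x - \<epsilon>) 0)\<^sup>2 \<le> J x"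
proof -
  define n where "n = CARD('n) - 2"
  define K where "K = {x \<in> S. \<Psi> x + \<epsilon> \<le> u x}"
  define w where "w x = u x - \<Psi> x - \<epsilon>" for x
  define \<zeta> where "\<zeta> x = (max (w x) 0)\<^sup>2" for x
  define D where "D x = (2 * max (w x) 0) *\<^sub>R (Du x - P x)" for x
  define J where "J x = (if x \<in> S then norm (Du x) ^ n * (Du x \<bullet> D x) + g (u x) * \<zeta> x else 0)
      - (if x \<in> S then (norm (P x) ^ n *\<^sub>R P x) \<bullet> D x + linear_trace (F' x) * \<zeta> x else 0)" for x
  have "has_C1_derivative w (\<lambda>x. (\<bullet>) (Du x - P x)) S"
  proof (rule has_C1_derivativeI)
    show "(w has_derivative (\<bullet>) (Du x - P x)) (at x)" if "x \<in> S" for x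
      unfolding w_def using has_C1_derivativeD(1)[OF u_C1] has_C1_derivativeD(1)[OF \<Psi>_C1] that S_open_subset(2)
      by (auto intro!: derivative_eq_intros simp: inner_diff_left)
    show "continuous_on S (\<lambda>x. (Du x - P x) \<bullet> h)" for h
      by (intro continuous_intros C1_gradient_continuous_on[OF \<Psi>_C1]
          C1_gradient_continuous_on[OF has_C1_derivative_subset[OF u_C1 S_open_subset(2)]])
  qed
  from has_C1_derivative_pos_part_square[OF this]
  have \<zeta>_C1: "has_C1_derivative \<zeta> (\<lambda>x. (\<bullet>) (D x)) S"
    unfolding \<zeta>_def by (rule has_C1_derivative_cong) (simp add: D_def)
  have K_compact_subset: "compact K" "K \<subseteq> S" using boundary by (auto simp: K_def)
  have off_K: "\<zeta> x = 0 \<and> D x = 0" if "x \<in> S" "x \<notin> K" for x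
    using that by (auto simp: K_def w_def \<zeta>_def D_def)
  show thesis
  proof (rule that)
    show "integrable lborel J" "integral\<^sup>L lborel J = 0"
      unfolding J_def
      using weak_solution_extend_zero[OF solution u_C1 g_cont \<zeta>_C1 S_open_subset K_compact_subset off_K, folded n_def]
        integration_by_parts_compact_support[OF \<zeta>_C1 flux_C1[folded n_def] S_open_subset(1) K_compact_subset] off_K
      by simp_all
    fix x assume "x \<in> S"
    have "0 \<le> 2 * max (w x) 0 * ((norm (Du x) ^ n *\<^sub>R Du x - norm (P x) ^ n *\<^sub>R P x) \<bullet> (Du x - P x))"
      by (intro mult_nonneg_nonneg norm_power_scaleR_monotone) auto
    also have "\<dots> = J x - (g (u x) - linear_trace (F' x)) * \<zeta> x"
      using \<open>x \<in> S\<close> by (simp add: D_def J_def inner_diff_left algebra_simps)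
    finally show "(g (u x) - linear_trace (F' x)) * (max (u x - \<Psi> x - \<epsilon>) 0)\<^sup>2 \<le> J x"
      by (simp add: \<zeta>_def w_def)
  qed (simp add: J_def)
qed

theorem weak_solution_imp_comparison_subsolution:
  fixes \<Omega> :: "(real^'n) set"
  assumes solution: "weak_solution \<Omega> g u Du"
    and u_C1: "has_C1_derivative u (\<lambda>x. (\<bullet>) (Du x)) \<Omega>" and g_cont: "continuous_on UNIV g"
  shows "comparison_subsolution \<Omega> u (\<lambda>x. g (u x))"
  unfolding comparison_subsolution_def
proof (intro allI impI, rule ccontr)
  fix S \<Psi> \<Delta>
  assume S_open_subset: "open S" "S \<subseteq> \<Omega>" and laplacian: "has_p_laplacian (DIM(real^'n) - 2) \<Psi> \<Delta> S"
    and boundary: "\<forall>\<epsilon>>0. compact {x \<in> S. \<Psi> x + \<epsilon> \<le> u x}"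
    and strict: "\<forall>x\<in>S. \<Psi> x < u x \<longrightarrow> \<Delta> x < g (u x)" and "\<not> (\<forall>x\<in>S. u x \<le> \<Psi> x)"
  then obtain x0 where exceeds_at_x0: "x0 \<in> S" "\<Psi> x0 < u x0" by force
  define \<epsilon> where "\<epsilon> = (u x0 - \<Psi> x0) / 2"
  have "0 < \<epsilon>" using exceeds_at_x0 by (simp add: \<epsilon>_def)
  obtain P F' where \<Psi>_C1: "has_C1_derivative \<Psi> (\<lambda>x. (\<bullet>) (P x)) S"
    and flux_C1: "has_C1_derivative (\<lambda>x. norm (P x) ^ (CARD('n) - 2) *\<^sub>R P x) F' S"
    and \<Delta>_eq: "\<And>x. x \<in> S \<Longrightarrow> \<Delta> x = linear_trace (F' x)"
    using laplacian unfolding has_p_laplacian_def by auto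
  obtain J where integral_J: "integrable lborel J" "integral\<^sup>L lborel J = 0"
    and J_off_S: "\<And>x. x \<notin> S \<Longrightarrow> J x = 0"
    and J_ge: "\<And>x. x \<in> S \<Longrightarrow> (g (u x) - linear_trace (F' x)) * (max (u x - \<Psi> x - \<epsilon>) 0)\<^sup>2 \<le> J x"
    using weak_solution_tested_with_excess[OF solution u_C1 g_cont S_open_subset \<Psi>_C1 flux_C1] boundary \<open>0 < \<epsilon>\<close>
    by blast
  let ?w = "\<lambda>x. u x - \<Psi> x - \<epsilon>"
  have J_pos: "0 < J x" if "x \<in> S" "0 < ?w x" for x
  proof -
    have "\<Delta> x < g (u x)" using strict that \<open>0 < \<epsilon>\<close> by auto
    then have "0 < (g (u x) - \<Delta> x) * (max (?w x) 0)\<^sup>2" using that by simp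
    then show ?thesis using J_ge[OF that(1)] \<Delta>_eq[OF that(1)] by simp
  qed
  have "0 < integral\<^sup>L lborel J"
  proof (rule integral_pos_if_pos_on_open[OF integral_J(1)])
    show "0 \<le> J x" for x
    proof (cases "x \<in> S \<and> 0 < ?w x")
      case False
      then show ?thesis
        using J_ge[of x] J_off_S[of x] by (cases "x \<in> S") (auto simp: max_def split: if_splits)
    qed (use J_pos[of x] in simp)
    have "continuous_on S ?w"
      by (intro continuous_intros has_C1_derivative_imp_continuous_on[OF \<Psi>_C1]
          has_C1_derivative_imp_continuous_on[OF has_C1_derivative_subset[OF u_C1 S_open_subset(2)]])
    from continuous_open_preimage[OF this S_open_subset(1) open_greaterThan[of 0]]
    show "open {x \<in> S. 0 < ?w x}" by (rule back_subst[of "open"]) auto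
    show "{x \<in> S. 0 < ?w x} \<noteq> {}" using exceeds_at_x0 by (auto simp: \<epsilon>_def field_simps)
  qed (use J_pos in auto)
  then show False using integral_J(2) by simp
qed

lemma comparison_subsolution_mono:
  assumes "comparison_subsolution D v f" "D0 \<subseteq> D" "\<And>x. x \<in> D0 \<Longrightarrow> f0 x \<le> f x"
  shows "comparison_subsolution D0 v f0"
  unfolding comparison_subsolution_def
proof (intro allI impI ballI)
  fix S \<Psi> \<Delta> x
  assume S_admissible: "open S" "S \<subseteq> D0" "has_p_laplacian (DIM('a) - 2) \<Psi> \<Delta> S" and "x \<in> S"
    and boundary: "\<forall>\<epsilon>>0. compact {x \<in> S. \<Psi> x + \<epsilon> \<le> v x}"
    and strict: "\<forall>x\<in>S. \<Psi> x < v x \<longrightarrow> \<Delta> x < f0 x"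
  show "v x \<le> \<Psi> x"
  proof (rule comparison_subsolutionD[OF assms(1) S_admissible(1) _ S_admissible(3) _ _ \<open>x \<in> S\<close>])
    show "\<Delta> y < f y" if "y \<in> S" "\<Psi> y < v y" for y
      using strict assms(3)[of y] that S_admissible(2) by fastforce
  qed (use S_admissible assms(2) boundary in auto)
qed

lemma comparison_subsolution_transform:
  fixes D D' :: "'a::euclidean_space set"
  assumes subsolution: "comparison_subsolution D v f" and D_open: "open D"
    and homeomorphism: "homeomorphism D D' I J"
    and "0 < A" and w_pos: "\<And>x. x \<in> D \<Longrightarrow> 0 < w x"
    and pullback: "\<And>S \<Psi> \<Delta>. S \<subseteq> D' \<Longrightarrow> has_p_laplacian (DIM('a) - 2) \<Psi> \<Delta> S \<Longrightarrow>
      has_p_laplacian (DIM('a) - 2) (\<lambda>x. C + A * \<Psi> (I x)) (\<lambda>x. w x * \<Delta> (I x)) {x \<in> D. I x \<in> S}"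
  shows "comparison_subsolution D' (\<lambda>y. (v (J y) - C) / A) (\<lambda>y. f (J y) / w (J y))"
  unfolding comparison_subsolution_def
proof (intro allI impI ballI)
  fix S \<Psi> \<Delta> y
  assume S_open_subset: "open S" "S \<subseteq> D'" and laplacian: "has_p_laplacian (DIM('a) - 2) \<Psi> \<Delta> S" and "y \<in> S"
    and boundary: "\<forall>\<epsilon>>0. compact {y \<in> S. \<Psi> y + \<epsilon> \<le> (v (J y) - C) / A}"
    and strict: "\<forall>y\<in>S. \<Psi> y < (v (J y) - C) / A \<longrightarrow> \<Delta> y < f (J y) / w (J y)"
  note [simp] = homeomorphism_apply1[OF homeomorphism] homeomorphism_apply2[OF homeomorphism]
  have J_in_D: "J y \<in> D" if "y \<in> D'" for y using that homeomorphism_image2[OF homeomorphism] by blast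
  have "v (J y) \<le> C + A * \<Psi> (I (J y))"
  proof (rule comparison_subsolutionD[OF subsolution _ _ pullback[OF S_open_subset(2) laplacian]])
    show "open {x \<in> D. I x \<in> S}"
      using continuous_open_preimage[OF homeomorphism_cont1[OF homeomorphism] D_open S_open_subset(1)]
      by (simp add: vimage_def Int_def)
    show "compact {x \<in> {x \<in> D. I x \<in> S}. C + A * \<Psi> (I x) + \<epsilon> \<le> v x}" if "0 < \<epsilon>" for \<epsilon>
    proof -
      let ?K = "{y \<in> S. \<Psi> y + \<epsilon> / A \<le> (v (J y) - C) / A}"
      have "compact (J ` ?K)"
        using boundary \<open>0 < A\<close> \<open>0 < \<epsilon>\<close> S_open_subset(2)
        by (intro compact_continuous_image continuous_on_subset[OF homeomorphism_cont2[OF homeomorphism]]) auto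
      moreover have "p + \<epsilon> / A \<le> (q - C) / A \<longleftrightarrow> C + A * p + \<epsilon> \<le> q" for p q
        using \<open>0 < A\<close> by (simp add: pos_le_divide_eq distrib_right) (simp add: algebra_simps)
      then have "J ` ?K = {x \<in> {x \<in> D. I x \<in> S}. C + A * \<Psi> (I x) + \<epsilon> \<le> v x}"
        using S_open_subset(2) J_in_D by (force simp: image_iff)
      ultimately show ?thesis by simp
    qed
    show "w x * \<Delta> (I x) < f x" if "x \<in> {x \<in> D. I x \<in> S}" "C + A * \<Psi> (I x) < v x" for x
      using that strict w_pos[of x] \<open>0 < A\<close> by (auto simp: field_simps)
    show "J y \<in> {x \<in> D. I x \<in> S}" using \<open>y \<in> S\<close> S_open_subset(2) J_in_D by auto
  qed auto
  then show "(v (J y) - C) / A \<le> \<Psi> y"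
    using \<open>y \<in> S\<close> S_open_subset(2) \<open>0 < A\<close> by (auto simp: field_simps)
qed

subsection \<open>Invariance under affine maps\<close>

lemma has_p_laplacian_affine:
  assumes laplacian: "has_p_laplacian m \<Psi> \<Delta> S" and "0 < \<rho>" "0 < A"
  shows "has_p_laplacian m (\<lambda>x. C + A * \<Psi> ((1 / \<rho>) *\<^sub>R (x - c)))
    (\<lambda>x. A ^ (m + 1) / \<rho> ^ (m + 2) * \<Delta> ((1 / \<rho>) *\<^sub>R (x - c))) {x. (1 / \<rho>) *\<^sub>R (x - c) \<in> S}"
proof -
  define I where "I x = (1 / \<rho>) *\<^sub>R (x - c)" for x
  obtain P F' where \<Psi>_C1: "has_C1_derivative \<Psi> (\<lambda>x. (\<bullet>) (P x)) S"
    and flux_C1: "has_C1_derivative (\<lambda>x. norm (P x) ^ m *\<^sub>R P x) F' S"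
    and \<Delta>_eq: "\<And>x. x \<in> S \<Longrightarrow> \<Delta> x = linear_trace (F' x)"
    using laplacian unfolding has_p_laplacian_def by auto
  have I_C1: "has_C1_derivative I (\<lambda>x h. (1 / \<rho>) *\<^sub>R h) {x. I x \<in> S}"
    unfolding I_def by (intro has_C1_derivativeI derivative_eq_intros continuous_intros) auto
  have compose: "has_C1_derivative (\<lambda>x. f (I x)) (\<lambda>x h. f' (I x) ((1 / \<rho>) *\<^sub>R h)) {x. I x \<in> S}"
    if "has_C1_derivative f f' S" for f f'
    by (rule has_C1_derivative_compose[OF I_C1 that]) auto
  show ?thesis
    unfolding has_p_laplacian_def I_def[symmetric]
  proof (intro exI conjI ballI)
    let ?k = "(A / \<rho>) ^ (m + 1)"
    show "has_C1_derivative (\<lambda>x. C + A * \<Psi> (I x)) (\<lambda>x. (\<bullet>) ((A / \<rho>) *\<^sub>R P (I x))) {x. I x \<in> S}"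
      using has_C1_derivative_const_add[OF has_C1_derivative_scaleR_right[OF compose[OF \<Psi>_C1]], of C A]
      by (auto intro: has_C1_derivative_cong)
    have field: "norm ((A / \<rho>) *\<^sub>R P x) ^ m *\<^sub>R (A / \<rho>) *\<^sub>R P x = ?k *\<^sub>R (norm (P x) ^ m *\<^sub>R P x)" for x
      using assms(2,3) by (simp add: power_mult_distrib power_divide mult_ac)
    show "has_C1_derivative (\<lambda>x. norm ((A / \<rho>) *\<^sub>R P (I x)) ^ m *\<^sub>R (A / \<rho>) *\<^sub>R P (I x))
        (\<lambda>x h. ?k *\<^sub>R F' (I x) ((1 / \<rho>) *\<^sub>R h)) {x. I x \<in> S}"
      unfolding field by (rule has_C1_derivative_scaleR_right[OF compose[OF flux_C1]])
    fix x assume I_x_in_S: "x \<in> {x. I x \<in> S}"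
    have "F' (I x) ((1 / \<rho>) *\<^sub>R h) = (1 / \<rho>) *\<^sub>R F' (I x) h" for h
      using has_C1_derivative_linear[OF flux_C1] I_x_in_S by (simp add: linear_cmul)
    then show "A ^ (m + 1) / \<rho> ^ (m + 2) * \<Delta> (I x)
        = linear_trace (\<lambda>h. ?k *\<^sub>R F' (I x) ((1 / \<rho>) *\<^sub>R h))"
      using I_x_in_S \<Delta>_eq by (simp add: linear_trace_scaleR power_divide)
  qed
qed

lemma comparison_subsolution_affine:
  fixes D :: "'a::euclidean_space set"
  assumes subsolution: "comparison_subsolution D v f" and dim: "2 \<le> DIM('a)"
    and D_open: "open D" and "0 < \<rho>" "0 < A"
  shows "comparison_subsolution {y. c + \<rho> *\<^sub>R y \<in> D} (\<lambda>y. (v (c + \<rho> *\<^sub>R y) - C) / A)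
    (\<lambda>y. \<rho> ^ DIM('a) / A ^ (DIM('a) - 1) * f (c + \<rho> *\<^sub>R y))"
proof -
  obtain m where dim_eq: "DIM('a) = m + 2" using dim by (metis add.commute le_Suc_ex)
  have "comparison_subsolution {y. c + \<rho> *\<^sub>R y \<in> D} (\<lambda>y. (v (c + \<rho> *\<^sub>R y) - C) / A)
      (\<lambda>y. f (c + \<rho> *\<^sub>R y) / (A ^ (m + 1) / \<rho> ^ (m + 2)))"
  proof (rule comparison_subsolution_transform[OF subsolution D_open _ \<open>0 < A\<close>,
      where I="\<lambda>x. (1 / \<rho>) *\<^sub>R (x - c)"])
    show "homeomorphism D {y. c + \<rho> *\<^sub>R y \<in> D} (\<lambda>x. (1 / \<rho>) *\<^sub>R (x - c)) (\<lambda>y. c + \<rho> *\<^sub>R y)"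
      using \<open>0 < \<rho>\<close> by (intro homeomorphismI continuous_intros) auto
    fix S and \<Psi> \<Delta> :: "'a \<Rightarrow> real" assume "has_p_laplacian (DIM('a) - 2) \<Psi> \<Delta> S"
    from has_p_laplacian_affine[OF this \<open>0 < \<rho>\<close> \<open>0 < A\<close>]
    show "has_p_laplacian (DIM('a) - 2) (\<lambda>x. C + A * \<Psi> ((1 / \<rho>) *\<^sub>R (x - c)))
        (\<lambda>x. A ^ (m + 1) / \<rho> ^ (m + 2) * \<Delta> ((1 / \<rho>) *\<^sub>R (x - c))) {x \<in> D. (1 / \<rho>) *\<^sub>R (x - c) \<in> S}"
      using dim_eq by (auto intro: has_p_laplacian_subset)
  qed (use assms in auto)
  then show ?thesis by (simp add: dim_eq mult.commute)
qed

subsection \<open>Conformal invariance\<close>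

definition reflection :: "'a::real_inner \<Rightarrow> 'a \<Rightarrow> 'a" where
  "reflection v h = h - (2 * (v \<bullet> h) / (v \<bullet> v)) *\<^sub>R v"

definition inversion_factor :: "'a::real_inner \<Rightarrow> 'a \<Rightarrow> real" where
  "inversion_factor a x = 1 / ((x - a) \<bullet> (x - a))"

definition inversion :: "'a::real_inner \<Rightarrow> 'a \<Rightarrow> 'a \<Rightarrow> 'a" where
  "inversion a t x = t + inversion_factor a x *\<^sub>R (x - a)"

lemma inner_reflection: "reflection v g \<bullet> h = g \<bullet> reflection v h"
  by (simp add: reflection_def inner_diff_left inner_diff_right inner_commute)

lemma reflection_scaleR: "reflection v (r *\<^sub>R h) = r *\<^sub>R reflection v h"
  by (simp add: reflection_def scaleR_diff_right)

lemma norm_reflection [simp]: "norm (reflection v h) = norm h"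
proof (cases "v = 0")
  case False
  then have "reflection v h \<bullet> reflection v h = h \<bullet> h"
    by (simp add: reflection_def inner_diff_left inner_diff_right inner_commute field_simps)
  then show ?thesis by (simp add: norm_eq_sqrt_inner)
qed (simp add: reflection_def)

lemma inversion_factor_nonneg [simp]: "0 \<le> inversion_factor a x"
  by (simp add: inversion_factor_def)

lemma inversion_factor_pos: "x \<noteq> a \<Longrightarrow> 0 < inversion_factor a x"
  by (simp add: inversion_factor_def)

lemma inversion_inversion: "x \<noteq> a \<Longrightarrow> inversion t a (inversion a t x) = x"
  by (simp add: inversion_def inversion_factor_def)

lemma inversion_eq_iff: "inversion a t x = t \<longleftrightarrow> x = a"
  by (simp add: inversion_def inversion_factor_def)

lemma inversion_factor_inversion: "inversion_factor t (inversion a t x) = (x - a) \<bullet> (x - a)"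
  by (cases "x = a") (simp_all add: inversion_def inversion_factor_def)

lemma continuous_on_inversion: "a \<notin> S \<Longrightarrow> continuous_on S (inversion a t)"
  unfolding inversion_def inversion_factor_def by (intro continuous_intros) auto

lemma homeomorphism_inversion: "homeomorphism (- {a}) (- {t}) (inversion a t) (inversion t a)"
  by (intro homeomorphismI continuous_on_inversion)
     (auto simp: inversion_inversion eq_commute[of _ "inversion _ _ _"] inversion_eq_iff)

lemma has_C1_derivative_inversion_factor_power:
  "has_C1_derivative (\<lambda>x. inversion_factor a x ^ m)
    (\<lambda>x h. - 2 * real m * inversion_factor a x ^ Suc m * ((x - a) \<bullet> h)) (- {a})"
proof (rule has_C1_derivativeI)
  fix x assume "x \<in> - {a}"
  then have "(inversion_factor a has_derivative (\<lambda>h. - 2 * (inversion_factor a x)\<^sup>2 * ((x - a) \<bullet> h))) (at x)"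
    unfolding inversion_factor_def
    by (auto intro!: derivative_eq_intros simp: inner_commute power2_eq_square fun_eq_iff field_simps)
  from has_derivative_power[OF this, of m]
  show "((\<lambda>x. inversion_factor a x ^ m) has_derivative
      (\<lambda>h. - 2 * real m * inversion_factor a x ^ Suc m * ((x - a) \<bullet> h))) (at x)"
    by (rule has_derivative_eq_rhs) (cases m; simp add: fun_eq_iff power2_eq_square algebra_simps)
qed (auto simp: inversion_factor_def intro!: continuous_intros)

lemma has_C1_derivative_diff_const:
  fixes a :: "'a::real_normed_vector"
  shows "has_C1_derivative (\<lambda>x. x - a) (\<lambda>x h. h) S"
  by (intro has_C1_derivativeI derivative_eq_intros continuous_intros) auto

lemma has_C1_derivative_inversion:
  fixes a t :: "'a::real_inner"
  shows "has_C1_derivative (inversion a t) (\<lambda>x h. inversion_factor a x *\<^sub>R reflection (x - a) h) (- {a})"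
proof (rule has_C1_derivativeI)
  fix x assume x_neq_a: "x \<in> - {a}"
  show "(inversion a t has_derivative (\<lambda>h. inversion_factor a x *\<^sub>R reflection (x - a) h)) (at x)"
    unfolding inversion_def
    by (rule derivative_eq_intros refl
        has_C1_derivativeD(1)[OF has_C1_derivative_inversion_factor_power[of a 1, simplified] x_neq_a])+
       (auto simp: reflection_def inversion_factor_def fun_eq_iff algebra_simps power2_eq_square)
next
  fix h
  show "continuous_on (- {a}) (\<lambda>x. inversion_factor a x *\<^sub>R reflection (x - a) h)"
    unfolding inversion_factor_def reflection_def by (intro continuous_intros) auto
qed

text \<open>The power \<open>m = N - 1\<close> is the one for which the zeroth order terms cancel.\<close>

lemma divergence_reflected_field:
  fixes a :: "'a::euclidean_space"
  assumes A_C1: "has_C1_derivative A A' S" and "a \<notin> S" and dim_eq: "DIM('a) = Suc m"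
  obtains H' where "has_C1_derivative (\<lambda>x. inversion_factor a x ^ m *\<^sub>R reflection (x - a) (A x)) H' S"
    "\<And>x. x \<in> S \<Longrightarrow> linear_trace (H' x) = inversion_factor a x ^ m
      * (linear_trace (A' x) - 2 * inversion_factor a x * ((x - a) \<bullet> A' x (x - a)))"
proof -
  define j where "j = inversion_factor a"
  define \<phi>' where "\<phi>' n x h = - 2 * real n * j x ^ Suc n * ((x - a) \<bullet> h)" for n x h
  define \<psi> where "\<psi> x = 2 * (j x ^ Suc m * ((x - a) \<bullet> A x))" for x
  define \<psi>' where
    "\<psi>' x h = 2 * (j x ^ Suc m * ((x - a) \<bullet> A' x h + h \<bullet> A x) + \<phi>' (Suc m) x h * ((x - a) \<bullet> A x))" for x h
  define H' where "H' x h = (j x ^ m *\<^sub>R A' x h + \<phi>' m x h *\<^sub>R A x) - (\<psi> x *\<^sub>R h + \<psi>' x h *\<^sub>R (x - a))" for x h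
  have factor_power_C1: "has_C1_derivative (\<lambda>x. j x ^ n) (\<phi>' n) S" for n
    using has_C1_derivative_subset[OF has_C1_derivative_inversion_factor_power, of S a] \<open>a \<notin> S\<close>
    by (simp add: \<phi>'_def[abs_def] j_def)
  note diff_C1 = has_C1_derivative_diff_const[of a S]
  have \<psi>_C1: "has_C1_derivative \<psi> \<psi>' S"
    using has_C1_derivative_scaleR_right[OF
        has_C1_derivative_scaleR[OF factor_power_C1[of "Suc m"] has_C1_derivative_inner[OF diff_C1 A_C1]],
            of 2]
    by (simp add: \<psi>_def[abs_def] \<psi>'_def[abs_def])
  show thesis
  proof (rule that)
    have "has_C1_derivative (\<lambda>x. j x ^ m *\<^sub>R A x - \<psi> x *\<^sub>R (x - a)) H' S"
      unfolding H'_def[abs_def]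
      by (rule has_C1_derivative_diff[OF has_C1_derivative_scaleR[OF factor_power_C1 A_C1]
            has_C1_derivative_scaleR[OF \<psi>_C1 diff_C1]])
    moreover have "j x ^ m *\<^sub>R A x - \<psi> x *\<^sub>R (x - a) = inversion_factor a x ^ m *\<^sub>R reflection (x - a) (A x)" for x
      by (simp add: reflection_def \<psi>_def j_def inversion_factor_def scaleR_diff_right mult_ac)
    ultimately show "has_C1_derivative (\<lambda>x. inversion_factor a x ^ m *\<^sub>R reflection (x - a) (A x)) H' S"
      by simp
    fix x assume "x \<in> S"
    have "j x * ((x - a) \<bullet> (x - a)) = 1" using \<open>x \<in> S\<close> \<open>a \<notin> S\<close> by (auto simp: j_def inversion_factor_def)
    then have "\<phi>' (Suc m) x (x - a) = - 2 * real (Suc m) * j x ^ Suc m"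
      by (metis (no_types, opaque_lifting) \<phi>'_def mult.assoc mult.right_neutral power_Suc2)
    then have \<psi>'_diff: "\<psi>' x (x - a) = 2 * j x ^ Suc m * ((x - a) \<bullet> A' x (x - a) + (1 - 2 * real (Suc m)) * ((x - a) \<bullet> A x))"
      unfolding \<psi>'_def by (simp only:) (simp add: algebra_simps)
    have "linear_trace (H' x) = j x ^ m * linear_trace (A' x) + \<phi>' m x (A x) - (\<psi> x * real (Suc m) + \<psi>' x (x - a))"
      unfolding H'_def[abs_def]
      using has_C1_derivative_linear[OF factor_power_C1 \<open>x \<in> S\<close>] has_C1_derivative_linear[OF \<psi>_C1 \<open>x \<in> S\<close>] dim_eq
      by (simp only: linear_trace_diff linear_trace_add linear_trace_scaleR linear_trace_rank_one linear_trace_ident)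
    also have "\<dots> = j x ^ m * (linear_trace (A' x) - 2 * j x * ((x - a) \<bullet> A' x (x - a)))"
      unfolding \<psi>'_diff by (simp add: \<phi>'_def \<psi>_def algebra_simps)
    finally show "linear_trace (H' x) = inversion_factor a x ^ m
        * (linear_trace (A' x) - 2 * inversion_factor a x * ((x - a) \<bullet> A' x (x - a)))"
      by (simp add: j_def)
  qed
qed

lemma reflection_self: "reflection v v = - v"
  by (cases "v = 0") (simp_all add: reflection_def scaleR_2)

lemma linear_trace_reflection:
  fixes v :: "'a::euclidean_space"
  assumes "linear L"
  shows "linear_trace (\<lambda>h. L (reflection v h)) = linear_trace L - 2 * (v \<bullet> L v) / (v \<bullet> v)"
proof -
  have "linear (\<lambda>h. 2 * (v \<bullet> h) / (v \<bullet> v))"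
    by (intro linearI) (simp_all add: inner_add_right add_divide_distrib)
  then have "linear_trace (\<lambda>h. (2 * (v \<bullet> h) / (v \<bullet> v)) *\<^sub>R L v) = 2 * (v \<bullet> L v) / (v \<bullet> v)"
    by (rule linear_trace_rank_one)
  then show ?thesis
    by (simp add: reflection_def linear_diff[OF assms] linear_cmul[OF assms] linear_trace_diff)
qed

lemma divergence_inversion:
  fixes a :: "'a::euclidean_space"
  assumes F_C1: "has_C1_derivative F F' T" and S_image: "a \<notin> S" "inversion a t ` S \<subseteq> T"
    and dim_eq: "DIM('a) = Suc m"
  obtains H' where
    "has_C1_derivative (\<lambda>x. inversion_factor a x ^ m *\<^sub>R reflection (x - a) (F (inversion a t x))) H' S"
    "\<And>x. x \<in> S \<Longrightarrow>
      linear_trace (H' x) = inversion_factor a x ^ Suc m * linear_trace (F' (inversion a t x))"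
proof -
  define A' where "A' x h = F' (inversion a t x) (inversion_factor a x *\<^sub>R reflection (x - a) h)" for x h
  have "has_C1_derivative (inversion a t) (\<lambda>x h. inversion_factor a x *\<^sub>R reflection (x - a) h) S"
    by (rule has_C1_derivative_subset[OF has_C1_derivative_inversion]) (use S_image(1) in auto)
  then have "has_C1_derivative (\<lambda>x. F (inversion a t x)) A' S"
    unfolding A'_def by (rule has_C1_derivative_compose[OF _ F_C1 S_image(2)])
  from divergence_reflected_field[OF this S_image(1) dim_eq] obtain H' where
    reflected_C1: "has_C1_derivative (\<lambda>x. inversion_factor a x ^ m *\<^sub>R reflection (x - a) (F (inversion a t x))) H' S"
    and trace_H': "\<And>x. x \<in> S \<Longrightarrow> linear_trace (H' x) = inversion_factor a x ^ m
      * (linear_trace (A' x) - 2 * inversion_factor a x * ((x - a) \<bullet> A' x (x - a)))"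
    by blast
  show thesis
  proof (rule that[OF reflected_C1])
    fix x assume "x \<in> S"
    define w L where "w = x - a" and "L = F' (inversion a t x)"
    define k where "k = inversion_factor a x"
    have k_eq: "1 / (w \<bullet> w) = k" by (simp add: k_def inversion_factor_def w_def)
    have linear_L: "linear L"
      using has_C1_derivative_linear[OF F_C1] \<open>x \<in> S\<close> S_image(2) by (auto simp: L_def)
    have A'_eq: "A' x h = k *\<^sub>R L (reflection w h)" for h
      using linear_cmul[OF linear_L] by (simp add: A'_def L_def w_def k_def)
    have "linear_trace (A' x) = k * (linear_trace L - 2 * (w \<bullet> L w) * (1 / (w \<bullet> w)))"
      unfolding A'_eq[abs_def] by (simp add: linear_trace_scaleR linear_trace_reflection[OF linear_L])
    moreover have "w \<bullet> A' x w = - (k * (w \<bullet> L w))"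
      by (simp add: A'_eq reflection_self linear_neg[OF linear_L])
    ultimately have "linear_trace (A' x) - 2 * k * (w \<bullet> A' x w) = k * linear_trace L"
      unfolding k_eq by (simp add: algebra_simps)
    then show "linear_trace (H' x) = inversion_factor a x ^ Suc m * linear_trace (F' (inversion a t x))"
      unfolding trace_H'[OF \<open>x \<in> S\<close>] w_def k_def L_def by simp
  qed
qed

theorem has_p_laplacian_inversion:
  fixes a t :: "'a::euclidean_space"
  assumes dim: "2 \<le> DIM('a)" and laplacian: "has_p_laplacian (DIM('a) - 2) \<Psi> \<Delta> S"
    and T_image: "a \<notin> T" "inversion a t ` T \<subseteq> S"
  shows "has_p_laplacian (DIM('a) - 2) (\<lambda>x. \<Psi> (inversion a t x))
    (\<lambda>x. inversion_factor a x ^ DIM('a) * \<Delta> (inversion a t x)) T"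
proof -
  obtain m where dim_eq: "DIM('a) = Suc m" "1 \<le> m" using dim by (cases "DIM('a)") auto
  obtain P F' where \<Psi>_C1: "has_C1_derivative \<Psi> (\<lambda>x. (\<bullet>) (P x)) S"
    and flux_C1: "has_C1_derivative (\<lambda>x. norm (P x) ^ (m - 1) *\<^sub>R P x) F' S"
    and \<Delta>_eq: "\<And>x. x \<in> S \<Longrightarrow> \<Delta> x = linear_trace (F' x)"
    using laplacian dim_eq unfolding has_p_laplacian_def by auto
  obtain H' where reflected_C1: "has_C1_derivative (\<lambda>x. inversion_factor a x ^ m *\<^sub>R
      reflection (x - a) (norm (P (inversion a t x)) ^ (m - 1) *\<^sub>R P (inversion a t x))) H' T"
    and trace_reflected: "\<And>x. x \<in> T \<Longrightarrow>
      linear_trace (H' x) = inversion_factor a x ^ Suc m * linear_trace (F' (inversion a t x))"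
    using divergence_inversion[OF flux_C1 T_image dim_eq(1)] by blast
  define Q where "Q x = inversion_factor a x *\<^sub>R reflection (x - a) (P (inversion a t x))" for x
  have field: "norm (Q x) ^ (m - 1) *\<^sub>R Q x = inversion_factor a x ^ m *\<^sub>R
      reflection (x - a) (norm (P (inversion a t x)) ^ (m - 1) *\<^sub>R P (inversion a t x))" for x
  proof -
    have "norm (Q x) = inversion_factor a x * norm (P (inversion a t x))" by (simp add: Q_def)
    moreover have "inversion_factor a x ^ m = inversion_factor a x ^ (m - 1) * inversion_factor a x"
      using dim_eq(2) by (simp add: power_eq_if)
    ultimately show ?thesis
      by (simp add: Q_def power_mult_distrib reflection_scaleR mult_ac)
  qed
  have "has_C1_derivative (\<lambda>x. \<Psi> (inversion a t x)) (\<lambda>x. (\<bullet>) (Q x)) T"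
    using has_C1_derivative_compose[OF has_C1_derivative_subset[OF has_C1_derivative_inversion] \<Psi>_C1 T_image(2)] T_image(1)
    by (auto simp: Q_def inner_reflection intro: has_C1_derivative_cong)
  moreover have "DIM('a) - 2 = m - 1" using dim_eq by simp
  ultimately show ?thesis
    unfolding has_p_laplacian_def using reflected_C1 trace_reflected \<Delta>_eq T_image(2) dim_eq(1) field
    by (intro exI[of _ Q] exI[of _ H']) (auto simp: image_subset_iff)
qed

theorem comparison_subsolution_inversion:
  fixes a t :: "'a::euclidean_space"
  assumes dim: "2 \<le> DIM('a)" and subsolution: "comparison_subsolution D v f" and D_open: "open D" "a \<notin> D"
  shows "comparison_subsolution (inversion a t ` D) (\<lambda>z. v (inversion t a z))
    (\<lambda>z. inversion_factor t z ^ DIM('a) * f (inversion t a z))"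
proof -
  have "comparison_subsolution (inversion a t ` D) (\<lambda>z. (v (inversion t a z) - 0) / 1)
      (\<lambda>z. f (inversion t a z) / inversion_factor a (inversion t a z) ^ DIM('a))"
  proof (rule comparison_subsolution_transform[OF subsolution D_open(1)])
    show "homeomorphism D (inversion a t ` D) (inversion a t) (inversion t a)"
      using D_open(2) by (intro homeomorphism_of_subsets[OF homeomorphism_inversion]) auto
    show "0 < inversion_factor a x ^ DIM('a)" if "x \<in> D" for x
      using that D_open(2) by (intro zero_less_power inversion_factor_pos) auto
    fix S and \<Psi> \<Delta> :: "'a \<Rightarrow> real" assume "has_p_laplacian (DIM('a) - 2) \<Psi> \<Delta> S"
    then show "has_p_laplacian (DIM('a) - 2) (\<lambda>x. 0 + 1 * \<Psi> (inversion a t x))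
        (\<lambda>x. inversion_factor a x ^ DIM('a) * \<Delta> (inversion a t x)) {x \<in> D. inversion a t x \<in> S}"
      using has_p_laplacian_inversion[OF dim, of \<Psi> \<Delta> S a "{x \<in> D. inversion a t x \<in> S}" t] D_open(2) by auto
  qed simp
  then show ?thesis
    by (simp add: inversion_factor_inversion) (simp add: inversion_factor_def power_one_over mult.commute)
qed

subsection \<open>Barriers\<close>

lemma has_p_laplacian_nonzero_gradient:
  assumes \<Psi>_C1: "has_C1_derivative \<Psi> (\<lambda>x. (\<bullet>) (P x)) S" and P_C1: "has_C1_derivative P P' S"
    and P_nonzero: "\<And>x. x \<in> S \<Longrightarrow> P x \<noteq> 0"
  shows "has_p_laplacian m \<Psi>
    (\<lambda>x. norm (P x) ^ m * (linear_trace (P' x) + real m * (P x \<bullet> P' x (P x)) / (norm (P x))\<^sup>2)) S"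
proof -
  let ?\<phi>' = "\<lambda>x h. real m * norm (P x) ^ m * (P x \<bullet> P' x h) / (norm (P x))\<^sup>2"
  have norm_power_C1: "has_C1_derivative (\<lambda>x. norm (P x) ^ m) ?\<phi>' S"
  proof (rule has_C1_derivativeI)
    fix x assume x_in_S: "x \<in> S"
    have "((\<lambda>x. norm (P x) ^ m) has_derivative (\<lambda>h. real m * (P' x h \<bullet> sgn (P x)) * norm (P x) ^ (m - 1))) (at x)"
      by (intro has_derivative_power
          has_derivative_compose[OF has_C1_derivativeD(1)[OF P_C1 x_in_S] has_derivative_norm[OF P_nonzero[OF x_in_S]]])
    then show "((\<lambda>x. norm (P x) ^ m) has_derivative ?\<phi>' x) (at x)"
      by (rule has_derivative_eq_rhs)
         (use P_nonzero[OF x_in_S] in \<open>cases m; simp add: fun_eq_iff sgn_div_norm inner_commute power2_eq_square divide_inverse\<close>)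
  next
    show "continuous_on S (\<lambda>x. ?\<phi>' x h)" for h
      using P_nonzero
      by (intro continuous_intros has_C1_derivativeD(2)[OF P_C1] has_C1_derivative_imp_continuous_on[OF P_C1]) auto
  qed
  note flux_C1 = has_C1_derivative_scaleR[OF norm_power_C1 P_C1]
  have "linear_trace (\<lambda>h. norm (P x) ^ m *\<^sub>R P' x h + ?\<phi>' x h *\<^sub>R P x)
      = norm (P x) ^ m * (linear_trace (P' x) + real m * (P x \<bullet> P' x (P x)) / (norm (P x))\<^sup>2)" if "x \<in> S" for x
    using linear_trace_rank_one[OF has_C1_derivative_linear[OF norm_power_C1 that], of "P x"]
    by (simp add: linear_trace_add linear_trace_scaleR algebra_simps)
  then show ?thesis unfolding has_p_laplacian_def using \<Psi>_C1 flux_C1 by (intro exI conjI) auto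
qed

lemma has_C1_derivative_radial:
  fixes S :: "'a::euclidean_space set"
  assumes "\<And>s. s \<in> I \<Longrightarrow> (X has_real_derivative \<xi> s) (at s)" and "continuous_on I \<xi>"
    and square_in_I: "\<And>z. z \<in> S \<Longrightarrow> z \<bullet> z \<in> I"
  shows "has_C1_derivative (\<lambda>z. X (z \<bullet> z)) (\<lambda>z h. 2 * \<xi> (z \<bullet> z) * (z \<bullet> h)) S"
proof -
  have identity_C1: "has_C1_derivative (\<lambda>z. z) (\<lambda>z h. h) S"
    using has_C1_derivative_diff_const[of 0] by simp
  have "has_C1_derivative X (\<lambda>s. (*) (\<xi> s)) I"
    using assms(1,2) by (simp add: has_C1_derivative_def has_field_derivative_def continuous_on_mult_right)
  then have "has_C1_derivative (\<lambda>z. X (z \<bullet> z)) (\<lambda>z h. \<xi> (z \<bullet> z) * (z \<bullet> h + h \<bullet> z)) S"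
    using square_in_I
    by (intro has_C1_derivative_compose[OF has_C1_derivative_inner[OF identity_C1 identity_C1]]) auto
  then show ?thesis by (rule has_C1_derivative_cong) (simp add: inner_commute)
qed

lemma has_p_laplacian_plane_plus_radial:
  fixes e :: "'a::euclidean_space" and K :: real
  assumes X_deriv: "\<And>s. s \<in> I \<Longrightarrow> (X has_real_derivative \<xi> s) (at s)"
    and \<xi>_deriv: "\<And>s. s \<in> I \<Longrightarrow> (\<xi> has_real_derivative \<xi>' s) (at s)" and \<xi>'_cont: "continuous_on I \<xi>'"
    and square_in_I: "\<And>z. z \<in> S \<Longrightarrow> z \<bullet> z \<in> I"
  defines "P \<equiv> \<lambda>z. K *\<^sub>R e + (2 * \<xi> (z \<bullet> z)) *\<^sub>R z"
  assumes P_nonzero: "\<And>z. z \<in> S \<Longrightarrow> P z \<noteq> 0"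
  shows "has_p_laplacian m (\<lambda>z. K * (e \<bullet> z) + X (z \<bullet> z))
    (\<lambda>z. norm (P z) ^ m * (2 * real (m + DIM('a)) * \<xi> (z \<bullet> z) + 4 * (z \<bullet> z) * \<xi>' (z \<bullet> z)
      + 4 * real m * \<xi>' (z \<bullet> z) * (z \<bullet> P z)\<^sup>2 / (norm (P z))\<^sup>2)) S"
proof -
  define P' :: "'a \<Rightarrow> 'a \<Rightarrow> 'a"
    where "P' z h = 2 *\<^sub>R (\<xi> (z \<bullet> z) *\<^sub>R h + (2 * \<xi>' (z \<bullet> z) * (z \<bullet> h)) *\<^sub>R z)" for z h
  have "continuous_on I \<xi>" by (intro continuous_at_imp_continuous_on ballI DERIV_isCont[OF \<xi>_deriv])
  note X_radial = has_C1_derivative_radial[OF X_deriv this square_in_I]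
  note \<xi>_radial = has_C1_derivative_radial[OF \<xi>_deriv \<xi>'_cont square_in_I]
  have identity_C1: "has_C1_derivative (\<lambda>z. z) (\<lambda>z h. h) S" using has_C1_derivative_diff_const[of 0] by simp
  have "has_C1_derivative P P' S"
    using has_C1_derivative_const_add[OF
        has_C1_derivative_scaleR_right[OF has_C1_derivative_scaleR[OF \<xi>_radial identity_C1]], of "K *\<^sub>R e" 2]
    by (simp add: P_def P'_def[abs_def])
  moreover have "has_C1_derivative (\<lambda>z. K * (e \<bullet> z) + X (z \<bullet> z)) (\<lambda>z. (\<bullet>) (P z)) S"
  proof (rule has_C1_derivativeI)
    show "((\<lambda>z. K * (e \<bullet> z) + X (z \<bullet> z)) has_derivative (\<bullet>) (P z)) (at z)" if "z \<in> S" for z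
      using has_C1_derivativeD(1)[OF X_radial that]
      by (auto intro!: derivative_eq_intros simp: P_def fun_eq_iff inner_add_left)
    show "continuous_on S (\<lambda>z. P z \<bullet> h)" for h
      unfolding P_def by (intro continuous_intros has_C1_derivative_imp_continuous_on[OF \<xi>_radial])
  qed
  ultimately have "has_p_laplacian m (\<lambda>z. K * (e \<bullet> z) + X (z \<bullet> z))
      (\<lambda>z. norm (P z) ^ m * (linear_trace (P' z) + real m * (P z \<bullet> P' z (P z)) / (norm (P z))\<^sup>2)) S"
    using P_nonzero by (intro has_p_laplacian_nonzero_gradient)
  moreover have "linear_trace (P' z) = 2 * real DIM('a) * \<xi> (z \<bullet> z) + 4 * (z \<bullet> z) * \<xi>' (z \<bullet> z)" for z
  proof -
    have "linear_trace (\<lambda>h. (2 * \<xi>' (z \<bullet> z) * (z \<bullet> h)) *\<^sub>R z) = 2 * \<xi>' (z \<bullet> z) * (z \<bullet> z)"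
      by (rule linear_trace_rank_one) (auto intro!: linearI simp: inner_add_right algebra_simps)
    then show ?thesis
      by (simp add: P'_def[abs_def] linear_trace_scaleR linear_trace_add linear_trace_ident)
  qed
  moreover have "real m * (P z \<bullet> P' z (P z)) / (norm (P z))\<^sup>2
      = 2 * real m * \<xi> (z \<bullet> z) + 4 * real m * \<xi>' (z \<bullet> z) * (z \<bullet> P z)\<^sup>2 / (norm (P z))\<^sup>2"
    if "z \<in> S" for z
  proof -
    have "P z \<bullet> P' z (P z) = 2 * \<xi> (z \<bullet> z) * (norm (P z))\<^sup>2 + 4 * \<xi>' (z \<bullet> z) * (z \<bullet> P z)\<^sup>2"
      by (simp add: P'_def inner_add_right inner_commute dot_square_norm power2_eq_square)
    then show ?thesis using P_nonzero[OF that] by (simp add: add_divide_distrib distrib_left)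
  qed
  ultimately show ?thesis
    by (elim has_p_laplacian_cong) (simp add: algebra_simps)
qed

lemma has_p_laplacian_radial:
  fixes S :: "'a::euclidean_space set"
  assumes dim_eq: "DIM('a) = m + 2"
    and X_deriv: "\<And>s. s \<in> I \<Longrightarrow> (X has_real_derivative \<xi> s) (at s)"
    and \<xi>_deriv: "\<And>s. s \<in> I \<Longrightarrow> (\<xi> has_real_derivative \<xi>' s) (at s)" and \<xi>'_cont: "continuous_on I \<xi>'"
    and square_in_I: "\<And>z. z \<in> S \<Longrightarrow> z \<bullet> z \<in> I" "0 \<notin> S" and \<xi>_pos: "\<And>s. s \<in> I \<Longrightarrow> 0 < \<xi> s"
  shows "has_p_laplacian m (\<lambda>z. X (z \<bullet> z))
    (\<lambda>z. 4 * real (m + 1) * (2 * \<xi> (z \<bullet> z) * norm z) ^ m * (\<xi> (z \<bullet> z) + (z \<bullet> z) * \<xi>' (z \<bullet> z))) S"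
proof -
  let ?P = "\<lambda>z. 0 *\<^sub>R 0 + (2 * \<xi> (z \<bullet> z)) *\<^sub>R z"
  have "has_p_laplacian m (\<lambda>z. 0 * (0 \<bullet> z) + X (z \<bullet> z))
    (\<lambda>z. norm (?P z) ^ m * (2 * real (m + DIM('a)) * \<xi> (z \<bullet> z) + 4 * (z \<bullet> z) * \<xi>' (z \<bullet> z)
      + 4 * real m * \<xi>' (z \<bullet> z) * (z \<bullet> ?P z)\<^sup>2 / (norm (?P z))\<^sup>2)) S"
    using square_in_I \<xi>_pos
    by (intro has_p_laplacian_plane_plus_radial[OF X_deriv \<xi>_deriv \<xi>'_cont]) fastforce+
  then have "has_p_laplacian m (\<lambda>z. X (z \<bullet> z))
    (\<lambda>z. norm (?P z) ^ m * (2 * real (m + DIM('a)) * \<xi> (z \<bullet> z) + 4 * (z \<bullet> z) * \<xi>' (z \<bullet> z)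
      + 4 * real m * \<xi>' (z \<bullet> z) * (z \<bullet> ?P z)\<^sup>2 / (norm (?P z))\<^sup>2)) S"
    by simp
  then show ?thesis
  proof (rule has_p_laplacian_cong)
    fix z assume "z \<in> S"
    then have "0 < \<xi> (z \<bullet> z)" "0 < z \<bullet> z" using square_in_I \<xi>_pos by auto
    then have "(z \<bullet> ?P z)\<^sup>2 / (norm (?P z))\<^sup>2 = z \<bullet> z"
      by (simp add: power_mult_distrib power2_norm_eq_inner) (simp add: power2_eq_square)
    then have normal: "4 * real m * \<xi>' (z \<bullet> z) * (z \<bullet> ?P z)\<^sup>2 / (norm (?P z))\<^sup>2 = 4 * real m * \<xi>' (z \<bullet> z) * (z \<bullet> z)"
      by (metis times_divide_eq_right)
    have norm_P: "norm (?P z) = 2 * \<xi> (z \<bullet> z) * norm z" using \<open>0 < \<xi> (z \<bullet> z)\<close> by simp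
    show "norm (?P z) ^ m * (2 * real (m + DIM('a)) * \<xi> (z \<bullet> z) + 4 * (z \<bullet> z) * \<xi>' (z \<bullet> z)
        + 4 * real m * \<xi>' (z \<bullet> z) * (z \<bullet> ?P z)\<^sup>2 / (norm (?P z))\<^sup>2)
      = 4 * real (m + 1) * (2 * \<xi> (z \<bullet> z) * norm z) ^ m * (\<xi> (z \<bullet> z) + (z \<bullet> z) * \<xi>' (z \<bullet> z))"
      unfolding normal unfolding norm_P dim_eq by (simp add: algebra_simps)
  qed
qed

lemma continuous_on_compact_bounded_above:
  fixes v :: "'a::topological_space \<Rightarrow> real"
  assumes "compact K" "continuous_on K v"
  obtains V where "\<And>x. x \<in> K \<Longrightarrow> v x \<le> V"
proof -
  have "bdd_above (v ` K)"
    by (intro bounded_imp_bdd_above compact_imp_bounded compact_continuous_image assms)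
  then show thesis using that by (auto simp: bdd_above_def)
qed

lemma comparison_subsolution_maximum_principle:
  fixes D G B :: "'a::euclidean_space set"
  assumes subsolution: "comparison_subsolution D v f" and D_open: "open D" and v_cont: "continuous_on D v"
    and G_open_subset: "open G" "G \<subseteq> B" and superlevel: "compact {z \<in> D \<inter> B. 0 \<le> v z}"
    and laplacian: "has_p_laplacian (DIM('a) - 2) \<Psi> \<Delta> (D \<inter> G)" and \<Psi>_cont: "continuous_on (D \<inter> B) \<Psi>"
    and nonneg: "\<And>z. z \<in> D \<inter> G \<Longrightarrow> 0 \<le> \<Psi> z" and boundary: "\<And>z. z \<in> D \<inter> B \<Longrightarrow> z \<notin> G \<Longrightarrow> v z \<le> \<Psi> z"
    and strict: "\<And>z. z \<in> D \<inter> G \<Longrightarrow> \<Psi> z < v z \<Longrightarrow> \<Delta> z < f z" and z_in_G: "z \<in> D \<inter> G"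
  shows "v z \<le> \<Psi> z"
proof (rule comparison_subsolutionD[OF subsolution _ _ laplacian _ strict z_in_G])
  fix \<epsilon> :: real assume "0 < \<epsilon>"
  let ?C = "{z \<in> D \<inter> B. 0 \<le> v z}"
  have "closed {z \<in> ?C. \<Psi> z + \<epsilon> \<le> v z}"
    by (intro continuous_on_closed_Collect_le continuous_intros compact_imp_closed[OF superlevel]
        continuous_on_subset[OF \<Psi>_cont] continuous_on_subset[OF v_cont]) auto
  from compact_Int_closed[OF superlevel this] have "compact {z \<in> ?C. \<Psi> z + \<epsilon> \<le> v z}"
    by (simp add: Int_absorb1 Collect_mono)
  moreover have "{z \<in> ?C. \<Psi> z + \<epsilon> \<le> v z} = {z \<in> D \<inter> G. \<Psi> z + \<epsilon> \<le> v z}"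
    using nonneg boundary G_open_subset(2) \<open>0 < \<epsilon>\<close> by force
  ultimately show "compact {z \<in> D \<inter> G. \<Psi> z + \<epsilon> \<le> v z}" by simp
qed (use D_open G_open_subset(1) in auto)

subsection \<open>Linear growth above an exterior ball\<close>

text \<open>A Keller-Osserman barrier: it vanishes on the inner sphere of the annulus \<open>1 < |z| < 3\<close>, is
  infinite on the outer one, and is superharmonic near the inner one.\<close>

definition annulus_profile :: "real \<Rightarrow> real" where
  "annulus_profile s = (s - 1) / (s * (9 - s))"

definition annulus_slope :: "real \<Rightarrow> real" where
  "annulus_slope s = (8 / (9 - s)\<^sup>2 + 1 / s\<^sup>2) / 9"

definition annulus_curvature :: "real \<Rightarrow> real" where
  "annulus_curvature s = (16 / (9 - s) ^ 3 - 2 / s ^ 3) / 9"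

lemma annulus_profile_partial_fractions:
  "0 < s \<Longrightarrow> s < 9 \<Longrightarrow> annulus_profile s = (8 / (9 - s) - 1 / s) / 9"
  by (simp add: annulus_profile_def field_simps)

lemma annulus_profile_has_real_derivative:
  assumes "0 < s" "s < 9"
  shows "(annulus_profile has_real_derivative annulus_slope s) (at s)"
proof -
  have "((\<lambda>s. (8 / (9 - s) - 1 / s) / 9) has_real_derivative annulus_slope s) (at s)"
    using assms by (auto intro!: derivative_eq_intros simp: power2_eq_square annulus_slope_def)
  then show ?thesis
    by (rule has_field_derivative_transform_within_open[where S="{0<..<9}"])
       (use assms annulus_profile_partial_fractions in auto)
qed

lemma annulus_slope_has_real_derivative:
  assumes "0 < s" "s < 9"
  shows "(annulus_slope has_real_derivative annulus_curvature s) (at s)"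
proof -
  have recip_square: "((\<lambda>s. 1 / s\<^sup>2) has_real_derivative - 2 / s ^ 3) (at s)" if "s \<noteq> 0" for s :: real
    using that by (auto intro!: derivative_eq_intros simp: power2_eq_square power3_eq_cube)
  have "((\<lambda>s. 1 / (9 - s)\<^sup>2) has_real_derivative - 2 / (9 - s) ^ 3 * (0 - 1)) (at s)"
    by (rule DERIV_chain2[OF recip_square DERIV_diff[OF DERIV_const DERIV_ident]]) (use assms in simp)
  from DERIV_cdivide[OF DERIV_add[OF DERIV_cmult[OF this, of 8] recip_square], of 9]
  show ?thesis using assms by (simp add: annulus_slope_def[abs_def] annulus_curvature_def)
qed

lemma annulus_slope_pos: "s \<noteq> 0 \<Longrightarrow> 0 < annulus_slope s"
  by (simp add: annulus_slope_def add_nonneg_pos)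

lemma annulus_slope_plus_curvature:
  assumes "0 < s" "s < 9"
  shows "annulus_slope s + s * annulus_curvature s = (8 * (9 + s) / (9 - s) ^ 3 - 1 / s\<^sup>2) / 9"
proof -
  define d where "d = 9 - s"
  have "8 / d\<^sup>2 = 8 * d / d ^ 3" "s * (2 / s ^ 3) = 2 / s\<^sup>2"
    using assms by (simp_all add: d_def[symmetric] power2_eq_square power3_eq_cube)
  moreover have "8 * d = 8 * (9 + s) - 16 * s" by (simp add: d_def)
  ultimately have "8 / d\<^sup>2 + 1 / s\<^sup>2 + s * (16 / d ^ 3 - 2 / s ^ 3) = 8 * (9 + s) / d ^ 3 - 1 / s\<^sup>2"
    by (simp add: diff_divide_distrib add_divide_distrib right_diff_distrib)
  then show ?thesis
    unfolding annulus_slope_def annulus_curvature_def d_def[symmetric]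
    by (metis add_divide_distrib times_divide_eq_right)
qed

lemma annulus_slope_plus_curvature_nonpos:
  assumes "0 < s" "s \<le> 3 / 2"
  shows "annulus_slope s + s * annulus_curvature s \<le> 0"
proof -
  have "8 * (9 + s) * s\<^sup>2 \<le> 8 * (9 + 3 / 2) * (3 / 2)\<^sup>2"
    using assms by (intro mult_mono power_mono) auto
  also have "\<dots> \<le> (15 / 2) ^ 3" by (simp add: power2_eq_square power3_eq_cube)
  also have "\<dots> \<le> (9 - s) ^ 3" using assms by (intro power_mono) auto
  finally have "8 * (9 + s) / (9 - s) ^ 3 \<le> 1 / s\<^sup>2" using assms by (simp add: divide_simps)
  then show ?thesis using assms by (simp add: annulus_slope_plus_curvature)
qed

lemma annulus_slope_plus_curvature_le:
  assumes "0 < s" "s < 9"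
  shows "annulus_slope s + s * annulus_curvature s \<le> 16 / (9 - s) ^ 3"
proof -
  have "annulus_slope s + s * annulus_curvature s \<le> 8 * (9 + s) / (9 - s) ^ 3 / 9"
    unfolding annulus_slope_plus_curvature[OF assms] by (intro divide_right_mono) auto
  also have "\<dots> \<le> 8 * 18 / (9 - s) ^ 3 / 9" using assms by (intro divide_right_mono) auto
  finally show ?thesis by simp
qed

lemma annulus_slope_le:
  assumes "3 / 2 \<le> s" "s < 9"
  shows "annulus_slope s \<le> 4 / (9 - s)\<^sup>2"
proof -
  have "1 / s\<^sup>2 \<le> 1 / (3 / 2)\<^sup>2" using assms by (intro divide_left_mono power_mono) auto
  also have "\<dots> = 25 * (1 / (15 / 2)\<^sup>2)" by (simp add: power2_eq_square)
  also have "\<dots> \<le> 25 * (1 / (9 - s)\<^sup>2)"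
    using assms by (intro mult_left_mono divide_left_mono power_mono) auto
  finally have "annulus_slope s \<le> (8 / (9 - s)\<^sup>2 + 25 * (1 / (9 - s)\<^sup>2)) / 9"
    unfolding annulus_slope_def by (intro divide_right_mono add_left_mono) auto
  also have "\<dots> = 33 / 9 * (1 / (9 - s)\<^sup>2)" by (simp add: field_simps)
  also have "\<dots> \<le> 4 * (1 / (9 - s)\<^sup>2)" by (intro mult_right_mono) auto
  finally show ?thesis by simp
qed

lemma annulus_profile_laplacian_le:
  assumes s_range: "1 < s" "s < 9"
  shows "4 * real (m + 1) * (2 * annulus_slope s * sqrt s) ^ m * (annulus_slope s + s * annulus_curvature s)
    \<le> 64 * real (m + 1) * 24 ^ m * (3 * annulus_profile s) ^ (2 * m + 3)" (is "?L \<le> ?R")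
proof (cases "s \<le> 3 / 2")
  case True
  then have "?L \<le> 0"
    using s_range annulus_slope_pos[of s] annulus_slope_plus_curvature_nonpos[of s]
    by (intro mult_nonneg_nonpos) auto
  also have "0 \<le> ?R" using s_range by (simp add: annulus_profile_def)
  finally show ?thesis .
next
  case False
  define d where "d = 1 / (9 - s)"
  have d_bounds: "0 < d" "d \<le> 3 * annulus_profile s"
    using s_range False by (simp_all add: d_def annulus_profile_def divide_simps)
  have slope: "0 < annulus_slope s" "annulus_slope s \<le> 4 * d\<^sup>2"
    using annulus_slope_pos[of s] annulus_slope_le[of s] False s_range
    by (simp_all add: d_def power_one_over)
  moreover have "sqrt s \<le> 3" using s_range by (intro real_le_lsqrt) auto
  ultimately have "2 * annulus_slope s * sqrt s \<le> 2 * (4 * d\<^sup>2) * 3" using s_range by (intro mult_mono) auto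
  then have "(2 * annulus_slope s * sqrt s) ^ m \<le> (24 * d\<^sup>2) ^ m"
    using slope s_range by (intro power_mono) auto
  moreover have "annulus_slope s + s * annulus_curvature s \<le> 16 * d ^ 3"
    using annulus_slope_plus_curvature_le[of s] s_range by (simp add: d_def power_one_over)
  then have "?L \<le> 4 * real (m + 1) * (2 * annulus_slope s * sqrt s) ^ m * (16 * d ^ 3)"
    using slope s_range by (intro mult_left_mono) auto
  ultimately have "?L \<le> 4 * real (m + 1) * (24 * d\<^sup>2) ^ m * (16 * d ^ 3)"
    using d_bounds by (elim order_trans) (intro mult_right_mono mult_left_mono; simp)
  also have "\<dots> = 64 * real (m + 1) * 24 ^ m * d ^ (2 * m + 3)"
    by (simp add: power_mult_distrib power_add power_mult)
  also have "\<dots> \<le> ?R" using d_bounds by (intro mult_left_mono power_mono) auto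
  finally show ?thesis .
qed

lemma annulus_profile_pos: "1 < s \<Longrightarrow> s < 9 \<Longrightarrow> 0 < annulus_profile s"
  by (simp add: annulus_profile_def)

lemma annulus_profile_square_le:
  assumes "0 \<le> q" "q \<le> 1"
  shows "annulus_profile ((1 + q)\<^sup>2) \<le> q"
proof -
  have "(1 + q)\<^sup>2 - 1 = q * (2 + q)" by (simp add: power2_eq_square algebra_simps)
  then have "annulus_profile ((1 + q)\<^sup>2) = q * (2 + q) / ((1 + q)\<^sup>2 * (9 - (1 + q)\<^sup>2))"
    by (simp only: annulus_profile_def)
  also have "\<dots> \<le> q * 3 / (1 * (9 - 2\<^sup>2))"
  proof (intro frac_le mult_mono mult_left_mono)
    show "1 \<le> (1 + q)\<^sup>2" using assms by (intro one_le_power) simp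
    show "9 - 2\<^sup>2 \<le> 9 - (1 + q)\<^sup>2" using assms by (intro diff_left_mono power_mono) auto
  qed (use assms in auto)
  also have "\<dots> \<le> q" using assms by simp
  finally show ?thesis .
qed

lemma annulus_range:
  assumes "1 < norm z" "norm z < 3"
  shows "1 < z \<bullet> z" "z \<bullet> z < 9"
  using assms power_strict_mono[of 1 "norm z" 2] power_strict_mono[of "norm z" 3 2]
  by (simp_all flip: power2_norm_eq_inner)

lemma annulus_barrier:
  assumes dim: "2 \<le> DIM('a)"
  obtains c \<Delta> where "0 < c"
    "has_p_laplacian (DIM('a) - 2) (\<lambda>z::'a::euclidean_space. annulus_profile (z \<bullet> z)) \<Delta> {z. 1 < norm z \<and> norm z < 3}"
    "\<And>z. 1 < norm z \<Longrightarrow> norm z < 3 \<Longrightarrow> \<Delta> z \<le> c * annulus_profile (z \<bullet> z) ^ (2 * DIM('a) - 1)"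
proof -
  obtain m where dim_eq: "DIM('a) = m + 2" using dim by (metis add.commute le_Suc_ex)
  define \<Delta> :: "'a \<Rightarrow> real" where
    "\<Delta> z = 4 * real (m + 1) * (2 * annulus_slope (z \<bullet> z) * norm z) ^ m
      * (annulus_slope (z \<bullet> z) + (z \<bullet> z) * annulus_curvature (z \<bullet> z))" for z
  show thesis
  proof (rule that)
    show "0 < 64 * real (m + 1) * 24 ^ m * 3 ^ (2 * m + 3)" by simp
    have "has_p_laplacian m (\<lambda>z::'a. annulus_profile (z \<bullet> z)) \<Delta> {z. 1 < norm z \<and> norm z < 3}"
      unfolding \<Delta>_def[abs_def]
    proof (rule has_p_laplacian_radial[OF dim_eq, where I="{1<..<9}"])
      show "continuous_on {1<..<9} annulus_curvature"
        unfolding annulus_curvature_def by (intro continuous_intros) auto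
    qed (auto simp: annulus_range annulus_slope_pos annulus_profile_has_real_derivative
        annulus_slope_has_real_derivative)
    then show "has_p_laplacian (DIM('a) - 2) (\<lambda>z::'a. annulus_profile (z \<bullet> z)) \<Delta> {z. 1 < norm z \<and> norm z < 3}"
      using dim_eq by simp
    fix z :: 'a assume z_range: "1 < norm z" "norm z < 3"
    have exponent: "2 * DIM('a) - 1 = 2 * m + 3" using dim_eq by simp
    show "\<Delta> z \<le> 64 * real (m + 1) * 24 ^ m * 3 ^ (2 * m + 3) * annulus_profile (z \<bullet> z) ^ (2 * DIM('a) - 1)"
      using annulus_profile_laplacian_le[OF annulus_range[OF z_range], of m]
      unfolding exponent power_mult_distrib[of 3]
      by (simp only: \<Delta>_def norm_eq_sqrt_inner mult.assoc)
  qed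
qed

lemma annulus_profile_unbounded:
  assumes "s < 9"
  obtains s' where "s < s'" "1 \<le> s'" "s' < 9" "V \<le> annulus_profile s'"
proof
  define M where "M = max V 1"
  define d where "d = min ((9 - s) / 2) (1 / (3 * M))"
  have M_bounds: "V \<le> M" "1 \<le> M" by (auto simp: M_def)
  have d_bounds: "0 < d" "d \<le> (9 - s) / 2" "d \<le> 1 / (3 * M)"
    unfolding d_def using assms M_bounds by (simp, intro min.cobounded1, intro min.cobounded2)
  have "1 / (3 * M) \<le> 1 / 3" using M_bounds by (intro frac_le) auto
  then have "d \<le> 1 / 3" using d_bounds(3) by linarith
  show "s < 9 - d" "1 \<le> 9 - d" "9 - d < 9" using d_bounds(1,2) \<open>d \<le> 1 / 3\<close> assms by auto
  have "M \<le> 1 / (3 * d)" using d_bounds(1,3) M_bounds by (simp add: field_simps)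
  also have "\<dots> \<le> (8 - d) / (9 - d) / d"
    unfolding divide_divide_eq_left[symmetric] using d_bounds(1) \<open>d \<le> 1 / 3\<close>
    by (intro divide_right_mono) (auto simp: field_simps)
  also have "\<dots> = annulus_profile (9 - d)" by (simp add: annulus_profile_def)
  finally show "V \<le> annulus_profile (9 - d)" using M_bounds by simp
qed

lemma annulus_comparison:
  fixes D :: "'a::euclidean_space set" and \<Delta> :: "'a \<Rightarrow> real"
  assumes "0 < c"
    and laplacian: "has_p_laplacian (DIM('a) - 2) (\<lambda>z. annulus_profile (z \<bullet> z)) \<Delta> {z. 1 < norm z \<and> norm z < 3}"
    and \<Delta>_le: "\<And>z. 1 < norm z \<Longrightarrow> norm z < 3 \<Longrightarrow> \<Delta> z \<le> c * annulus_profile (z \<bullet> z) ^ (2 * DIM('a) - 1)"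
    and subsolution: "comparison_subsolution D v f" "open D" and v_cont: "continuous_on D v"
    and outside: "\<And>z. z \<in> D \<Longrightarrow> 1 < norm z" and superlevel: "compact {z \<in> D. norm z \<le> 3 \<and> 0 \<le> v z}"
    and absorption: "\<And>z. z \<in> D \<Longrightarrow> norm z < 3 \<Longrightarrow> 0 < v z \<Longrightarrow> c * v z ^ (2 * DIM('a) - 1) \<le> f z"
    and z_range: "z \<in> D" "norm z < 3"
  shows "v z \<le> annulus_profile (z \<bullet> z)"
proof -
  obtain V where v_le_V: "\<And>x. x \<in> {z \<in> D. norm z \<le> 3 \<and> 0 \<le> v z} \<Longrightarrow> v x \<le> V"
    using continuous_on_compact_bounded_above[OF superlevel continuous_on_subset[OF v_cont]] by blast
  have exponent: "0 < 2 * DIM('a) - 1" using DIM_positive[where 'a='a] by linarith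
  obtain s where s_bounds: "z \<bullet> z < s" "1 \<le> s" "s < 9" "V \<le> annulus_profile s"
    using annulus_profile_unbounded[OF annulus_range(2)[OF outside[OF z_range(1)] z_range(2)]] by blast
  have profile_pos: "0 < annulus_profile (y \<bullet> y)" if "1 < norm y" "norm y < 3" for y :: 'a
    by (rule annulus_profile_pos[OF annulus_range[OF that]])
  have less_3: "norm y < 3" if "y \<bullet> y \<le> s" for y :: 'a
    using that s_bounds(3) power2_less_imp_less[of "norm y" 3] by (simp add: power2_norm_eq_inner)
  show ?thesis
  proof (rule comparison_subsolution_maximum_principle[OF subsolution v_cont,
      where G="{y. y \<bullet> y < s}" and B="{y. y \<bullet> y \<le> s}"])
    show "open {y::'a. y \<bullet> y < s}" by (intro open_Collect_less continuous_intros)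
    have "closed {y::'a. y \<bullet> y \<le> s}" by (intro closed_Collect_le continuous_intros)
    from compact_Int_closed[OF superlevel this]
    show "compact {y \<in> D \<inter> {y. y \<bullet> y \<le> s}. 0 \<le> v y}"
      by (rule back_subst) (use less_3 in force)
    show "has_p_laplacian (DIM('a) - 2) (\<lambda>y. annulus_profile (y \<bullet> y)) \<Delta> (D \<inter> {y. y \<bullet> y < s})"
      by (rule has_p_laplacian_subset[OF laplacian]) (use outside less_3 in auto)
    show "continuous_on (D \<inter> {y. y \<bullet> y \<le> s}) (\<lambda>y. annulus_profile (y \<bullet> y))"
      by (rule continuous_on_subset[OF has_p_laplacian_imp_continuous_on[OF laplacian]])
         (use outside less_3 in auto)
    fix y assume y_inside: "y \<in> D \<inter> {y. y \<bullet> y < s}"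
    then have norm_y: "1 < norm y" "norm y < 3" using outside less_3 by auto
    show "0 \<le> annulus_profile (y \<bullet> y)" using profile_pos[OF norm_y] by simp
    assume exceeds: "annulus_profile (y \<bullet> y) < v y"
    have "\<Delta> y \<le> c * annulus_profile (y \<bullet> y) ^ (2 * DIM('a) - 1)" by (rule \<Delta>_le[OF norm_y])
    also have "\<dots> < c * v y ^ (2 * DIM('a) - 1)"
      using \<open>0 < c\<close> profile_pos[OF norm_y] exceeds exponent
      by (intro mult_strict_left_mono power_strict_mono) auto
    also have "\<dots> \<le> f y" using absorption[of y] y_inside norm_y profile_pos[OF norm_y] exceeds by simp
    finally show "\<Delta> y < f y" .
  next
    fix y assume "y \<in> D \<inter> {y. y \<bullet> y \<le> s}" "y \<notin> {y. y \<bullet> y < s}"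
    then have "y \<in> D" "y \<bullet> y = s" "0 \<le> annulus_profile s"
      using s_bounds(2,3) by (auto simp: annulus_profile_def)
    then show "v y \<le> annulus_profile (y \<bullet> y)"
      using v_le_V[of y] less_3[of y] s_bounds(4) by (cases "0 \<le> v y") auto
  qed (use z_range s_bounds in auto)
qed

subsection \<open>Absorption in a ball touching the boundary\<close>

lemma exp_diff_bounds:
  fixes x y :: real
  assumes "x \<le> y"
  shows "exp (- x) - exp (- y) \<le> (y - x) * exp (- x)" and "(y - x) * exp (- y) \<le> exp (- x) - exp (- y)"
proof -
  have "exp (- x) * (1 + (x - y)) \<le> exp (- x) * exp (x - y)"
    by (intro mult_left_mono exp_ge_add_one_self) auto
  also have "\<dots> = exp (- y)" by (simp flip: exp_add)
  finally show "exp (- x) - exp (- y) \<le> (y - x) * exp (- x)" by (simp add: algebra_simps)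
  have "exp (- y) * (1 + (y - x)) \<le> exp (- y) * exp (y - x)"
    by (intro mult_left_mono exp_ge_add_one_self) auto
  also have "\<dots> = exp (- x)" by (simp flip: exp_add)
  finally show "(y - x) * exp (- y) \<le> exp (- x) - exp (- y)" by (simp add: algebra_simps)
qed

definition hopf_exponent :: "nat \<Rightarrow> real" where
  "hopf_exponent N = 4 * real (N - 1)"

definition hopf_function :: "nat \<Rightarrow> real \<Rightarrow> real" where
  "hopf_function N s = exp (- (hopf_exponent N * s)) - exp (- hopf_exponent N)"

lemma hopf_function_bounds:
  assumes "0 \<le> s" "s \<le> 1"
  shows "0 \<le> hopf_function N s" and "hopf_function N s \<le> hopf_exponent N * (1 - s)"
    and "hopf_exponent N * exp (- hopf_exponent N) * (1 - s) \<le> hopf_function N s"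
proof -
  let ?\<beta> = "hopf_exponent N"
  have exponent_nonneg: "0 \<le> ?\<beta>" by (simp add: hopf_exponent_def)
  then have exponent_mult_le: "?\<beta> * s \<le> ?\<beta>" using assms by (simp add: mult_left_le)
  show "0 \<le> hopf_function N s" using exponent_mult_le by (simp add: hopf_function_def)
  show "?\<beta> * exp (- ?\<beta>) * (1 - s) \<le> hopf_function N s"
    using exp_diff_bounds(2)[OF exponent_mult_le] by (simp add: hopf_function_def algebra_simps)
  have "hopf_function N s \<le> (?\<beta> - ?\<beta> * s) * exp (- (?\<beta> * s))"
    using exp_diff_bounds(1)[OF exponent_mult_le] by (simp add: hopf_function_def)
  also have "\<dots> \<le> (?\<beta> - ?\<beta> * s) * 1"
    using exponent_mult_le exponent_nonneg assms by (intro mult_left_mono) auto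
  finally show "hopf_function N s \<le> ?\<beta> * (1 - s)" by (simp add: algebra_simps)
qed

lemma hopf_axis_bound:
  assumes "0 < \<delta>" "0 \<le> q" "q \<le> 1"
  shows "K * q - \<delta> * hopf_function N ((1 - q)\<^sup>2) \<le> (K - \<delta> * (hopf_exponent N * exp (- hopf_exponent N))) * q"
proof -
  let ?k = "hopf_exponent N * exp (- hopf_exponent N)"
  have "q * q \<le> q" using assms by (simp add: mult_left_le)
  then have "q \<le> 1 - (1 - q)\<^sup>2" by (simp add: power2_eq_square algebra_simps)
  then have "?k * q \<le> ?k * (1 - (1 - q)\<^sup>2)"
    by (intro mult_left_mono) (auto simp: hopf_exponent_def)
  also have "\<dots> \<le> hopf_function N ((1 - q)\<^sup>2)"
    using assms by (intro hopf_function_bounds power_le_one) auto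
  finally have "\<delta> * (?k * q) \<le> \<delta> * hopf_function N ((1 - q)\<^sup>2)"
    using assms(1) by (intro mult_left_mono) auto
  then show ?thesis by (simp add: left_diff_distrib mult.assoc)
qed

lemma hopf_barrier_lower_bound:
  fixes e :: "'a::euclidean_space"
  assumes "norm e = 1" "norm y \<le> 1" "0 \<le> \<delta>" "\<delta> * hopf_exponent N \<le> K / 4"
  shows "K / 2 * (1 + e \<bullet> y) \<le> K * (1 + e \<bullet> y) - \<delta> * hopf_function N (y \<bullet> y)"
proof -
  have y_bounds: "0 \<le> y \<bullet> y" "y \<bullet> y \<le> 1" "- norm y \<le> e \<bullet> y"
    using assms(1,2) power_le_one[of "norm y" 2] norm_cauchy_schwarz[of "- e" y]
    by (simp_all flip: power2_norm_eq_inner)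
  have "0 \<le> \<delta> * hopf_exponent N" using assms(3) by (simp add: hopf_exponent_def)
  then have "0 \<le> K" using assms(4) by linarith
  have "\<delta> * hopf_function N (y \<bullet> y) \<le> \<delta> * (hopf_exponent N * (1 - y \<bullet> y))"
    using hopf_function_bounds(2)[OF y_bounds(1,2)] assms(3) by (intro mult_left_mono) auto
  also have "\<dots> \<le> K / 4 * (1 - y \<bullet> y)"
    using mult_right_mono[OF assms(4), of "1 - y \<bullet> y"] y_bounds(2) by (simp add: mult.assoc)
  also have "\<dots> = K / 4 * ((1 + norm y) * (1 - norm y))"
    by (simp add: power2_norm_eq_inner[symmetric] power2_eq_square algebra_simps)
  also have "\<dots> \<le> K / 4 * (2 * (1 + e \<bullet> y))"
    using y_bounds(3) assms(2) \<open>0 \<le> K\<close> by (intro mult_left_mono mult_mono) auto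
  also have "\<dots> = K / 2 * (1 + e \<bullet> y)" by (simp add: field_simps)
  finally have "\<delta> * hopf_function N (y \<bullet> y) \<le> K / 2 * (1 + e \<bullet> y)" .
  moreover have "K * (1 + e \<bullet> y) = K / 2 * (1 + e \<bullet> y) + K / 2 * (1 + e \<bullet> y)" by simp
  ultimately show ?thesis by linarith
qed

definition hopf_slope :: "nat \<Rightarrow> real \<Rightarrow> real" where
  "hopf_slope N s = hopf_exponent N * exp (- (hopf_exponent N * s))"

lemma hopf_exponent_pos: "2 \<le> N \<Longrightarrow> 0 < hopf_exponent N"
  by (simp add: hopf_exponent_def)

lemma hopf_slope_bounds:
  assumes "2 \<le> N"
  shows "0 < hopf_slope N s" and "0 \<le> s \<Longrightarrow> hopf_slope N s \<le> hopf_exponent N"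
  using hopf_exponent_pos[OF assms] by (simp_all add: hopf_slope_def)

lemma hopf_derivatives:
  shows "(hopf_function N has_real_derivative - hopf_slope N s) (at s)"
    and "(hopf_slope N has_real_derivative - hopf_exponent N * hopf_slope N s) (at s)"
  unfolding hopf_function_def hopf_slope_def by (auto intro!: derivative_eq_intros)

definition hopf_gradient :: "'a::euclidean_space \<Rightarrow> real \<Rightarrow> real \<Rightarrow> 'a \<Rightarrow> 'a" where
  "hopf_gradient e K \<delta> z = K *\<^sub>R e + (2 * (\<delta> * hopf_slope DIM('a) (z \<bullet> z))) *\<^sub>R z"

lemma hopf_gradient_bounds:
  fixes e z :: "'a::euclidean_space"
  assumes dim: "2 \<le> DIM('a)" and norm_e: "norm e = 1" and "0 < \<delta>"
    and \<delta>_le: "\<delta> * hopf_exponent DIM('a) \<le> K / 4"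
    and norm_z: "norm z \<le> 1"
  shows "K / 2 \<le> norm (hopf_gradient e K \<delta> z)" and "norm (hopf_gradient e K \<delta> z) \<le> 2 * K"
proof -
  have "0 < \<delta> * hopf_exponent DIM('a)" using \<open>0 < \<delta>\<close> hopf_exponent_pos[OF dim] by simp
  then have "0 < K" using \<delta>_le by linarith
  let ?w = "(2 * (\<delta> * hopf_slope DIM('a) (z \<bullet> z))) *\<^sub>R z"
  have "norm ?w = 2 * (\<delta> * hopf_slope DIM('a) (z \<bullet> z)) * norm z"
    using \<open>0 < \<delta>\<close> hopf_slope_bounds(1)[OF dim, of "z \<bullet> z"] by simp
  also have "\<dots> \<le> 2 * (\<delta> * hopf_exponent DIM('a)) * 1"
    using \<open>0 < \<delta>\<close> norm_z hopf_slope_bounds[OF dim, of "z \<bullet> z"] hopf_exponent_pos[OF dim]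
    by (intro mult_mono) auto
  finally have "norm ?w \<le> K / 2" using \<delta>_le by simp
  moreover have "norm (K *\<^sub>R e) = K" using norm_e \<open>0 < K\<close> by simp
  ultimately show "K / 2 \<le> norm (hopf_gradient e K \<delta> z)" "norm (hopf_gradient e K \<delta> z) \<le> 2 * K"
    using norm_triangle_ineq[of "K *\<^sub>R e" ?w] norm_diff_ineq[of "K *\<^sub>R e" ?w] \<open>0 < K\<close>
    unfolding hopf_gradient_def by linarith+
qed

lemma hopf_barrier_laplacian:
  fixes e :: "'a::euclidean_space"
  assumes dim: "2 \<le> DIM('a)" and norm_e: "norm e = 1" and "0 < K" "0 < \<delta>"
    and \<delta>_le: "\<delta> * hopf_exponent DIM('a) \<le> K / 4"
  obtains \<Delta> where
    "has_p_laplacian (DIM('a) - 2) (\<lambda>y. K * (1 + e \<bullet> y) - \<delta> * hopf_function DIM('a) (y \<bullet> y)) \<Delta> (cball 0 1)"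
    "\<And>y. \<Delta> y \<le> norm (hopf_gradient e K \<delta> y) ^ (DIM('a) - 2)
      * (\<delta> * hopf_slope DIM('a) (y \<bullet> y) * hopf_exponent DIM('a) * (1 - 4 * (y \<bullet> y)))"
proof -
  obtain m where dim_eq: "DIM('a) = m + 2" using dim by (metis add.commute le_Suc_ex)
  define \<beta> where "\<beta> = hopf_exponent DIM('a)"
  define \<xi> where "\<xi> s = \<delta> * hopf_slope DIM('a) s" for s
  define P where "P = hopf_gradient e K \<delta>"
  define \<Delta> where "\<Delta> z = norm (P z) ^ m * (2 * real (m + DIM('a)) * \<xi> (z \<bullet> z) + 4 * (z \<bullet> z) * (- \<beta> * \<xi> (z \<bullet> z))
      + 4 * real m * (- \<beta> * \<xi> (z \<bullet> z)) * (z \<bullet> P z)\<^sup>2 / (norm (P z))\<^sup>2)" for z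
  have \<beta>_pos_eq: "0 < \<beta>" "\<beta> = 2 * real (m + DIM('a))" by (simp_all add: \<beta>_def hopf_exponent_def dim_eq)
  have P_eq: "P z = K *\<^sub>R e + (2 * \<xi> (z \<bullet> z)) *\<^sub>R z" for z by (simp add: P_def hopf_gradient_def \<xi>_def)
  show thesis
  proof (rule that)
    have "has_p_laplacian m (\<lambda>z. K * (e \<bullet> z) + (K - \<delta> * hopf_function DIM('a) (z \<bullet> z))) \<Delta> (cball 0 1)"
      unfolding \<Delta>_def[abs_def] P_eq
    proof (rule has_p_laplacian_plane_plus_radial[where I=UNIV])
      show "((\<lambda>s. K - \<delta> * hopf_function DIM('a) s) has_real_derivative \<xi> s) (at s)"
        "(\<xi> has_real_derivative - \<beta> * \<xi> s) (at s)" for s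
        unfolding \<xi>_def \<beta>_def by (auto intro!: derivative_eq_intros hopf_derivatives)
      show "continuous_on UNIV (\<lambda>s. - \<beta> * \<xi> s)" unfolding \<xi>_def hopf_slope_def by (intro continuous_intros)
      show "K *\<^sub>R e + (2 * \<xi> (z \<bullet> z)) *\<^sub>R z \<noteq> 0" if "z \<in> cball 0 1" for z
        using hopf_gradient_bounds(1)[OF dim norm_e \<open>0 < \<delta>\<close> \<delta>_le, of z] that \<open>0 < K\<close>
        unfolding P_def[symmetric] P_eq by auto
    qed simp
    then show "has_p_laplacian (DIM('a) - 2) (\<lambda>y. K * (1 + e \<bullet> y) - \<delta> * hopf_function DIM('a) (y \<bullet> y)) \<Delta> (cball 0 1)"
      by (simp add: dim_eq algebra_simps)
    fix z :: 'a
    have "0 < \<xi> (z \<bullet> z)" using \<open>0 < \<delta>\<close> hopf_slope_bounds(1)[OF dim] by (simp add: \<xi>_def)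
    then have "4 * real m * (- \<beta> * \<xi> (z \<bullet> z)) * (z \<bullet> P z)\<^sup>2 / (norm (P z))\<^sup>2 \<le> 0"
      using \<beta>_pos_eq(1) by (intro divide_nonpos_nonneg mult_nonpos_nonneg mult_nonneg_nonpos) auto
    then have "\<Delta> z \<le> norm (P z) ^ m * (\<xi> (z \<bullet> z) * \<beta> * (1 - 4 * (z \<bullet> z)))"
      unfolding \<Delta>_def \<beta>_pos_eq(2)[symmetric] by (intro mult_left_mono) (auto simp: algebra_simps)
    then show "\<Delta> z \<le> norm (hopf_gradient e K \<delta> z) ^ (DIM('a) - 2)
        * (\<delta> * hopf_slope DIM('a) (z \<bullet> z) * hopf_exponent DIM('a) * (1 - 4 * (z \<bullet> z)))"
      by (simp add: P_def \<xi>_def \<beta>_def dim_eq)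
  qed
qed

lemma hopf_barrier:
  fixes e :: "'a::euclidean_space"
  assumes dim: "2 \<le> DIM('a)" and norm_e: "norm e = 1" and "0 < K" "0 < \<delta>"
    and \<delta>_le: "\<delta> * hopf_exponent DIM('a) \<le> K / 4"
  obtains \<Delta> where
    "has_p_laplacian (DIM('a) - 2) (\<lambda>y. K * (1 + e \<bullet> y) - \<delta> * hopf_function DIM('a) (y \<bullet> y)) \<Delta> (cball 0 1)"
    "\<And>y. norm y \<le> 1 \<Longrightarrow> 1 / 2 \<le> norm y \<Longrightarrow> \<Delta> y \<le> 0"
    "\<And>y. norm y \<le> 1 \<Longrightarrow> \<Delta> y \<le> (2 * K) ^ (DIM('a) - 2) * (\<delta> * (hopf_exponent DIM('a))\<^sup>2)"
proof -
  let ?\<beta> = "hopf_exponent DIM('a)" and ?n = "DIM('a) - 2"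
  obtain \<Delta> where laplacian: "has_p_laplacian ?n (\<lambda>y. K * (1 + e \<bullet> y) - \<delta> * hopf_function DIM('a) (y \<bullet> y)) \<Delta> (cball 0 1)"
    and \<Delta>_le: "\<And>y. \<Delta> y \<le> norm (hopf_gradient e K \<delta> y) ^ ?n * (\<delta> * hopf_slope DIM('a) (y \<bullet> y) * ?\<beta> * (1 - 4 * (y \<bullet> y)))"
    using hopf_barrier_laplacian[OF assms] by blast
  note exponent_pos = hopf_exponent_pos[OF dim]
  show thesis
  proof (rule that[OF laplacian])
    fix y :: 'a assume norm_y: "norm y \<le> 1"
    note slope = hopf_slope_bounds[OF dim, of "y \<bullet> y"]
    show "\<Delta> y \<le> 0" if "1 / 2 \<le> norm y"
    proof -
      have "1 / 4 \<le> y \<bullet> y" using power_mono[OF that, of 2] by (simp add: power2_norm_eq_inner power_divide)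
      then have "norm (hopf_gradient e K \<delta> y) ^ ?n * (\<delta> * hopf_slope DIM('a) (y \<bullet> y) * ?\<beta> * (1 - 4 * (y \<bullet> y))) \<le> 0"
        using slope(1) exponent_pos \<open>0 < \<delta>\<close> by (intro mult_nonneg_nonpos) auto
      then show ?thesis using \<Delta>_le[of y] by linarith
    qed
    have "\<delta> * hopf_slope DIM('a) (y \<bullet> y) * ?\<beta> * (1 - 4 * (y \<bullet> y)) \<le> \<delta> * hopf_slope DIM('a) (y \<bullet> y) * ?\<beta> * 1"
      using slope(1) exponent_pos \<open>0 < \<delta>\<close> by (intro mult_left_mono) auto
    also have "\<dots> \<le> \<delta> * ?\<beta>\<^sup>2" using slope(2) exponent_pos \<open>0 < \<delta>\<close> by (simp add: power2_eq_square)
    finally have "norm (hopf_gradient e K \<delta> y) ^ ?n * (\<delta> * hopf_slope DIM('a) (y \<bullet> y) * ?\<beta> * (1 - 4 * (y \<bullet> y)))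
        \<le> norm (hopf_gradient e K \<delta> y) ^ ?n * (\<delta> * ?\<beta>\<^sup>2)"
      by (intro mult_left_mono) auto
    also have "\<dots> \<le> (2 * K) ^ ?n * (\<delta> * ?\<beta>\<^sup>2)"
      using hopf_gradient_bounds(2)[OF dim norm_e \<open>0 < \<delta>\<close> \<delta>_le norm_y] \<open>0 < \<delta>\<close>
      by (intro mult_right_mono power_mono) auto
    finally show "\<Delta> y \<le> (2 * K) ^ ?n * (\<delta> * ?\<beta>\<^sup>2)" using \<Delta>_le[of y] by linarith
  qed
qed

lemma hopf_barrier_absorbed:
  fixes e :: "'a::euclidean_space"
  assumes dim: "2 \<le> DIM('a)" and norm_e: "norm e = 1" and positive: "0 < c" "0 < K" "0 < \<delta>"
    and \<delta>_le: "\<delta> * hopf_exponent DIM('a) \<le> K / 4"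
      "(2 * K) ^ (DIM('a) - 2) * (\<delta> * (hopf_exponent DIM('a))\<^sup>2) \<le> c * (K / 4) ^ (2 * DIM('a) - 1)"
  obtains \<Delta> where
    "has_p_laplacian (DIM('a) - 2) (\<lambda>y. K * (1 + e \<bullet> y) - \<delta> * hopf_function DIM('a) (y \<bullet> y)) \<Delta> (cball 0 1)"
    "\<And>y w. norm y \<le> 1 \<Longrightarrow> - 1 < e \<bullet> y \<Longrightarrow> K / 2 * (1 + e \<bullet> y) < w \<Longrightarrow> \<Delta> y < c * w ^ (2 * DIM('a) - 1)"
proof -
  obtain \<Delta> where laplacian: "has_p_laplacian (DIM('a) - 2)
      (\<lambda>y. K * (1 + e \<bullet> y) - \<delta> * hopf_function DIM('a) (y \<bullet> y)) \<Delta> (cball 0 1)"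
    and \<Delta>_outer: "\<And>y. norm y \<le> 1 \<Longrightarrow> 1 / 2 \<le> norm y \<Longrightarrow> \<Delta> y \<le> 0"
    and \<Delta>_inner: "\<And>y. norm y \<le> 1 \<Longrightarrow> \<Delta> y \<le> (2 * K) ^ (DIM('a) - 2) * (\<delta> * (hopf_exponent DIM('a))\<^sup>2)"
    using hopf_barrier[OF dim norm_e positive(2,3) \<delta>_le(1)] by blast
  have "\<Delta> y < c * w ^ (2 * DIM('a) - 1)"
    if y_range: "norm y \<le> 1" "- 1 < e \<bullet> y" and w_greater: "K / 2 * (1 + e \<bullet> y) < w" for y w
  proof (cases "1 / 2 \<le> norm y")
    case True
    have "0 < K / 2 * (1 + e \<bullet> y)" using y_range(2) positive(2) by (intro mult_pos_pos) auto
    then have "0 < c * w ^ (2 * DIM('a) - 1)" using positive(1) w_greater by simp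
    then show ?thesis using \<Delta>_outer[OF y_range(1) True] by linarith
  next
    case False
    then have "1 / 2 \<le> 1 + e \<bullet> y" using norm_cauchy_schwarz[of "- e" y] norm_e by simp
    then have "K / 2 * (1 / 2) \<le> K / 2 * (1 + e \<bullet> y)" using positive(2) by (intro mult_left_mono) auto
    then have "K / 4 < w" using w_greater by simp
    then have "c * (K / 4) ^ (2 * DIM('a) - 1) < c * w ^ (2 * DIM('a) - 1)"
      using positive dim by (intro mult_strict_left_mono power_strict_mono) auto
    then show ?thesis using \<Delta>_inner[OF y_range(1)] \<delta>_le(2) by linarith
  qed
  then show thesis using that[OF laplacian] by blast
qed

lemma hopf_comparison:
  fixes D :: "'a::euclidean_space set"
  assumes dim: "2 \<le> DIM('a)" and norm_e: "norm e = 1" and positive: "0 < c" "0 < K" "0 < \<delta>"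
    and \<delta>_le: "\<delta> * hopf_exponent DIM('a) \<le> K / 4"
      "(2 * K) ^ (DIM('a) - 2) * (\<delta> * (hopf_exponent DIM('a))\<^sup>2) \<le> c * (K / 4) ^ (2 * DIM('a) - 1)"
    and subsolution: "comparison_subsolution D v f" "open D" and v_cont: "continuous_on D v"
    and half_space: "\<And>y. y \<in> D \<Longrightarrow> - 1 < e \<bullet> y" and superlevel: "compact {y \<in> D. norm y \<le> 1 \<and> 0 \<le> v y}"
    and linear: "\<And>y. y \<in> D \<Longrightarrow> v y \<le> K * (1 + e \<bullet> y)"
    and absorption: "\<And>y. y \<in> D \<Longrightarrow> norm y < 1 \<Longrightarrow> 0 < v y \<Longrightarrow> c * v y ^ (2 * DIM('a) - 1) \<le> f y"
    and z_inside: "z \<in> D" "norm z < 1"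
  shows "v z \<le> K * (1 + e \<bullet> z) - \<delta> * hopf_function DIM('a) (z \<bullet> z)"
proof -
  define \<Psi> where "\<Psi> y = K * (1 + e \<bullet> y) - \<delta> * hopf_function DIM('a) (y \<bullet> y)" for y
  obtain \<Delta> where laplacian: "has_p_laplacian (DIM('a) - 2) \<Psi> \<Delta> (cball 0 1)"
    and \<Delta>_less: "\<And>y w. norm y \<le> 1 \<Longrightarrow> - 1 < e \<bullet> y \<Longrightarrow> K / 2 * (1 + e \<bullet> y) < w \<Longrightarrow>
      \<Delta> y < c * w ^ (2 * DIM('a) - 1)"
    using hopf_barrier_absorbed[OF dim norm_e positive \<delta>_le] by (auto simp: \<Psi>_def[abs_def])
  have \<Psi>_ge: "K / 2 * (1 + e \<bullet> y) \<le> \<Psi> y" if "norm y \<le> 1" for y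
    unfolding \<Psi>_def using hopf_barrier_lower_bound[OF norm_e that] positive \<delta>_le(1) by simp
  have "v z \<le> \<Psi> z"
  proof (rule comparison_subsolution_maximum_principle[OF subsolution v_cont,
      where G="ball 0 1" and B="cball 0 1"])
    show "compact {y \<in> D \<inter> cball 0 1. 0 \<le> v y}" by (rule back_subst[of compact, OF superlevel]) auto
    show "has_p_laplacian (DIM('a) - 2) \<Psi> \<Delta> (D \<inter> ball 0 1)"
      by (rule has_p_laplacian_subset[OF laplacian]) auto
    show "continuous_on (D \<inter> cball 0 1) \<Psi>"
      by (rule continuous_on_subset[OF has_p_laplacian_imp_continuous_on[OF laplacian]]) auto
    fix y assume y_inside: "y \<in> D \<inter> ball 0 1"
    then have "0 < K / 2 * (1 + e \<bullet> y)" using half_space[of y] positive(2) by (intro mult_pos_pos) auto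
    then have \<Psi>_pos: "0 < \<Psi> y" using \<Psi>_ge[of y] y_inside by simp
    then show "0 \<le> \<Psi> y" by simp
    assume exceeds: "\<Psi> y < v y"
    then have "\<Delta> y < c * v y ^ (2 * DIM('a) - 1)"
      using \<Delta>_less[of y "v y"] half_space[of y] \<Psi>_ge[of y] y_inside by simp
    also have "\<dots> \<le> f y" using absorption[of y] y_inside \<Psi>_pos exceeds by simp
    finally show "\<Delta> y < f y" .
  next
    fix y assume y_on_sphere: "y \<in> D \<inter> cball 0 1" "y \<notin> ball 0 1"
    then have "y \<bullet> y = 1" by (simp flip: power2_norm_eq_inner)
    then show "v y \<le> \<Psi> y" using linear[of y] y_on_sphere by (simp add: \<Psi>_def hopf_function_def)
  qed (use z_inside in auto)
  then show ?thesis by (simp add: \<Psi>_def)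
qed

subsection \<open>Gain far away from the boundary values\<close>

lemma norm_diff_inversion:
  assumes "x \<noteq> b" "y \<noteq> b"
  shows "norm (inversion b t x - inversion b t y) = norm (x - y) / (norm (x - b) * norm (y - b))"
proof -
  define p q where "p = x - b" and "q = y - b"
  have "p \<bullet> p \<noteq> 0" "q \<bullet> q \<noteq> 0" using assms by (simp_all add: p_def q_def)
  then have "((1 / (p \<bullet> p)) *\<^sub>R p - (1 / (q \<bullet> q)) *\<^sub>R q) \<bullet> ((1 / (p \<bullet> p)) *\<^sub>R p - (1 / (q \<bullet> q)) *\<^sub>R q)
      = (p - q) \<bullet> (p - q) / ((p \<bullet> p) * (q \<bullet> q))"
    by (simp add: inner_diff_left inner_diff_right inner_commute field_simps)
  then have "(norm (inversion b t x - inversion b t y))\<^sup>2 = (norm (x - y) / (norm (x - b) * norm (y - b)))\<^sup>2"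
    by (simp add: inversion_def inversion_factor_def p_def q_def power_divide power_mult_distrib power2_norm_eq_inner)
  then show ?thesis by (rule power2_eq_imp_eq) simp_all
qed

lemma neg_reciprocal_square_barrier:
  assumes dim: "2 \<le> DIM('a::euclidean_space)"
  obtains \<Delta> where "has_p_laplacian (DIM('a) - 2) (\<lambda>z::'a. - 1 / (z \<bullet> z)) \<Delta> (- {0})"
    "\<And>z. z \<noteq> 0 \<Longrightarrow> norm z \<le> 1 \<Longrightarrow> \<Delta> z \<le> - 1"
proof -
  obtain m where dim_eq: "DIM('a) = m + 2" using dim by (metis add.commute le_Suc_ex)
  define \<Delta> :: "'a \<Rightarrow> real" where
    "\<Delta> z = 4 * real (m + 1) * (2 * (1 / (z \<bullet> z)\<^sup>2) * norm z) ^ m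
      * (1 / (z \<bullet> z)\<^sup>2 + (z \<bullet> z) * (- 2 / (z \<bullet> z) ^ 3))" for z
  show thesis
  proof (rule that)
    have "has_p_laplacian m (\<lambda>z::'a. - 1 / (z \<bullet> z)) \<Delta> (- {0})"
      unfolding \<Delta>_def[abs_def]
    proof (rule has_p_laplacian_radial[OF dim_eq, where I="{0<..}"])
      show "((\<lambda>s. - 1 / s) has_real_derivative 1 / s\<^sup>2) (at s)" if "s \<in> {0<..}" for s :: real
        using that by (auto intro!: derivative_eq_intros simp: power2_eq_square)
      show "((\<lambda>s. 1 / s\<^sup>2) has_real_derivative - 2 / s ^ 3) (at s)" if "s \<in> {0<..}" for s :: real
        using that by (auto intro!: derivative_eq_intros simp: power2_eq_square power3_eq_cube)
      show "continuous_on {0<..} (\<lambda>s::real. - 2 / s ^ 3)" by (intro continuous_intros) auto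
    qed auto
    then show "has_p_laplacian (DIM('a) - 2) (\<lambda>z::'a. - 1 / (z \<bullet> z)) \<Delta> (- {0})" using dim_eq by simp
    fix z :: 'a assume z_range: "z \<noteq> 0" "norm z \<le> 1"
    define n where "n = norm z"
    have n_range: "0 < n" "n \<le> 1" "z \<bullet> z = n\<^sup>2" using z_range by (simp_all add: n_def power2_norm_eq_inner)
    have "1 / (z \<bullet> z)\<^sup>2 + (z \<bullet> z) * (- 2 / (z \<bullet> z) ^ 3) = - (1 / n ^ 4)"
      using n_range(1) unfolding n_range(3) by (simp add: field_simps eval_nat_numeral)
    moreover have "2 * (1 / (z \<bullet> z)\<^sup>2) * norm z = 2 / n ^ 3"
      using n_range(1) unfolding n_range(3) n_def[symmetric] by (simp add: field_simps eval_nat_numeral)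
    ultimately have "\<Delta> z = - (4 * real (m + 1) * ((2 / n ^ 3) ^ m * (1 / n ^ 4)))" by (simp add: \<Delta>_def)
    moreover have "1 * (1 * 1) \<le> 4 * real (m + 1) * ((2 / n ^ 3) ^ m * (1 / n ^ 4))"
    proof (intro mult_mono)
      have "n ^ 3 \<le> 1" using n_range by (intro power_le_one) auto
      then have "1 \<le> 2 / n ^ 3" using n_range(1) by (simp add: pos_le_divide_eq)
      then show "1 \<le> (2 / n ^ 3) ^ m" by (rule one_le_power)
      have "n ^ 4 \<le> 1" using n_range by (intro power_le_one) auto
      then show "1 \<le> 1 / n ^ 4" using n_range(1) by (simp add: pos_le_divide_eq)
    qed (use n_range in auto)
    ultimately show "\<Delta> z \<le> - 1" by simp
  qed
qed

lemma has_p_laplacian_transform_open: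
  assumes "has_p_laplacian m \<Psi> \<Delta> S" "open S" "\<And>x. x \<in> S \<Longrightarrow> \<Psi> x = \<Phi> x"
  shows "has_p_laplacian m \<Phi> \<Delta> S"
proof -
  have "has_C1_derivative \<Phi> \<Psi>' S" if "has_C1_derivative \<Psi> \<Psi>' S" for \<Psi>'
    using that assms(2,3) unfolding has_C1_derivative_def
    by (blast intro: has_derivative_transform_within_open)
  then show ?thesis using assms(1) unfolding has_p_laplacian_def by blast
qed

text \<open>The Moebius image of a radial barrier, with poles at \<open>a\<close> and \<open>b\<close>.\<close>

lemma distance_ratio_barrier:
  fixes a b :: "'a::euclidean_space"
  assumes dim: "2 \<le> DIM('a)" and "a \<noteq> b" "0 < A"
  obtains \<Delta> where "has_p_laplacian (DIM('a) - 2) (\<lambda>z. C - A * (norm (z - b) / norm (z - a))\<^sup>2) \<Delta> (- {a, b})"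
    "\<And>z. z \<noteq> a \<Longrightarrow> z \<noteq> b \<Longrightarrow> norm (z - a) \<le> norm (a - b) * norm (z - b) \<Longrightarrow>
      \<Delta> z \<le> - ((A / (norm (a - b))\<^sup>2) ^ (DIM('a) - 1) / norm (z - b) ^ (2 * DIM('a)))"
proof -
  obtain m where dim_eq: "DIM('a) = m + 2" using dim by (metis add.commute le_Suc_ex)
  define I where "I = inversion b (0::'a)"
  define k where "k = A / (norm (a - b))\<^sup>2"
  have k_pos: "0 < k" using assms by (simp add: k_def)
  obtain \<Delta>0 where laplacian_reciprocal: "has_p_laplacian (DIM('a) - 2) (\<lambda>z::'a. - 1 / (z \<bullet> z)) \<Delta>0 (- {0})"
    and \<Delta>0_le: "\<And>z. z \<noteq> 0 \<Longrightarrow> norm z \<le> 1 \<Longrightarrow> \<Delta>0 z \<le> - 1"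
    using neg_reciprocal_square_barrier[OF dim] by blast
  have norm_image_diff: "norm (I z - I a) = norm (z - a) / (norm (z - b) * norm (a - b))" if "z \<noteq> b" for z
    unfolding I_def by (rule norm_diff_inversion[OF that \<open>a \<noteq> b\<close>])
  have images_neq: "I z \<noteq> I a" if "z \<noteq> a" "z \<noteq> b" for z
    using norm_image_diff[OF that(2)] that \<open>a \<noteq> b\<close> by auto
  have "has_p_laplacian (DIM('a) - 2) (\<lambda>z. C + k * (- 1 / (((1 / 1) *\<^sub>R (I z - I a)) \<bullet> ((1 / 1) *\<^sub>R (I z - I a)))))
      (\<lambda>z. inversion_factor b z ^ DIM('a) * (k ^ (DIM('a) - 2 + 1) / 1 ^ (DIM('a) - 2 + 2) * \<Delta>0 ((1 / 1) *\<^sub>R (I z - I a)))) (- {a, b})"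
    unfolding I_def
    by (rule has_p_laplacian_inversion[OF dim has_p_laplacian_affine[OF laplacian_reciprocal zero_less_one k_pos]])
       (use images_neq in \<open>auto simp: I_def\<close>)
  then have laplacian_image: "has_p_laplacian (DIM('a) - 2) (\<lambda>z. C - k / ((I z - I a) \<bullet> (I z - I a)))
      (\<lambda>z. inversion_factor b z ^ DIM('a) * (k ^ (DIM('a) - 1) * \<Delta>0 (I z - I a))) (- {a, b})"
    using dim_eq by simp
  show thesis
  proof (rule that)
    show "has_p_laplacian (DIM('a) - 2) (\<lambda>z. C - A * (norm (z - b) / norm (z - a))\<^sup>2)
      (\<lambda>z. inversion_factor b z ^ DIM('a) * (k ^ (DIM('a) - 1) * \<Delta>0 (I z - I a))) (- {a, b})"
    proof (rule has_p_laplacian_transform_open[OF laplacian_image])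
      fix z assume "z \<in> - {a, b}"
      then show "C - k / ((I z - I a) \<bullet> (I z - I a)) = C - A * (norm (z - b) / norm (z - a))\<^sup>2"
        using norm_image_diff[of z] \<open>a \<noteq> b\<close>
        by (simp add: k_def power2_norm_eq_inner[symmetric] power_divide power_mult_distrib)
    qed auto
    fix z assume z_range: "z \<noteq> a" "z \<noteq> b" "norm (z - a) \<le> norm (a - b) * norm (z - b)"
    then have "norm (I z - I a) \<le> 1"
      using norm_image_diff[OF z_range(2)] \<open>a \<noteq> b\<close> by (simp add: divide_le_eq mult.commute)
    then have "inversion_factor b z ^ DIM('a) * (k ^ (DIM('a) - 1) * \<Delta>0 (I z - I a))
        \<le> inversion_factor b z ^ DIM('a) * (k ^ (DIM('a) - 1) * (- 1))"
      using \<Delta>0_le[of "I z - I a"] images_neq[OF z_range(1,2)] k_pos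
      by (intro mult_left_mono) auto
    moreover have "inversion_factor b z ^ DIM('a) = 1 / norm (z - b) ^ (2 * DIM('a))"
      by (simp add: inversion_factor_def power_one_over power_mult power2_norm_eq_inner)
    ultimately show "inversion_factor b z ^ DIM('a) * (k ^ (DIM('a) - 1) * \<Delta>0 (I z - I a))
        \<le> - ((A / (norm (a - b))\<^sup>2) ^ (DIM('a) - 1) / norm (z - b) ^ (2 * DIM('a)))"
      unfolding k_def[symmetric] by simp
  qed
qed

definition gain_constant :: "nat \<Rightarrow> real" where
  "gain_constant N = (1 / 400 / 34600) ^ (N - 1) / 600 ^ (2 * N)"

text \<open>The ball \<open>influence_region\<close> avoids the unit ball and contains the points of height \<open>0\<close> at
  distance \<open>160\<close> in direction \<open>h\<close>; inside it, \<open>gain_barrier\<close> is less than its boundary value \<open>1\<close>.\<close>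

locale gain_geometry =
  fixes e h :: "'a::euclidean_space"
  assumes dim: "2 \<le> DIM('a)" and norm_e: "norm e = 1" and norm_h: "norm h = 1" and orthogonal: "e \<bullet> h = 0"
begin

definition pole :: 'a where
  "pole = 110 *\<^sub>R h - 10 *\<^sub>R e"

definition inversion_centre :: 'a where
  "inversion_centre = - 160 *\<^sub>R e"

definition influence_region :: "'a set" where
  "influence_region = {z. (norm (z - pole))\<^sup>2 \<le> 9 / 20 * (norm (z - inversion_centre))\<^sup>2}"

definition gain_barrier :: "'a \<Rightarrow> real" where
  "gain_barrier z = 181 / 180 - 1 / 400 * (norm (z - inversion_centre) / norm (z - pole))\<^sup>2"

lemma inner_simps: "e \<bullet> e = 1" "h \<bullet> h = 1" "h \<bullet> e = 0" "e \<bullet> h = 0"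
  using norm_e norm_h orthogonal by (simp_all add: norm_eq_1 inner_commute)

lemma norm_pole_square: "(norm pole)\<^sup>2 = 12200"
  by (simp add: pole_def power2_norm_eq_inner inner_diff_left inner_diff_right inner_simps)

lemma norm_inversion_centre: "norm inversion_centre = 160"
  using norm_e by (simp add: inversion_centre_def)

lemma norm_pole_diff_centre_square: "(norm (pole - inversion_centre))\<^sup>2 = 34600"
  by (simp add: pole_def inversion_centre_def power2_norm_eq_inner inner_diff_left inner_diff_right
      inner_add_left inner_add_right inner_simps)

lemma pole_neq_centre: "pole \<noteq> inversion_centre"
  using norm_pole_diff_centre_square by auto

lemma norm_diff_centre_le: "norm (z - inversion_centre) \<le> norm (z - pole) + 190"
proof -
  have "norm (pole - inversion_centre) \<le> 190"
    by (rule power2_le_imp_le) (simp_all add: norm_pole_diff_centre_square)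
  then show ?thesis using norm_triangle_ineq[of "z - pole" "pole - inversion_centre"] by simp
qed

lemma half_space_distances:
  assumes "0 < e \<bullet> z"
  shows "10 < norm (z - pole)" and "norm (z - inversion_centre) \<le> 20 * norm (z - pole)"
    and "z \<noteq> pole" and "z \<noteq> inversion_centre"
proof -
  have "e \<bullet> (z - pole) = e \<bullet> z + 10" by (simp add: pole_def inner_diff_right inner_simps)
  then show pole_distance: "10 < norm (z - pole)"
    using assms norm_cauchy_schwarz[of e "z - pole"] norm_e by simp
  then show "norm (z - inversion_centre) \<le> 20 * norm (z - pole)" using norm_diff_centre_le[of z] by linarith
  show "z \<noteq> pole" using pole_distance by auto
  show "z \<noteq> inversion_centre" using assms by (auto simp: inversion_centre_def inner_simps)
qed

lemma influence_region_distances: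
  assumes "z \<in> influence_region"
  shows "norm (z - inversion_centre) \<le> 600" and "1 < norm z" and "norm z \<le> 760"
    and "norm (z - pole) \<le> norm (pole - inversion_centre) * norm (z - inversion_centre)"
proof -
  have "(norm (z - pole))\<^sup>2 \<le> (671 / 1000)\<^sup>2 * (norm (z - inversion_centre))\<^sup>2"
    using assms unfolding influence_region_def mem_Collect_eq
    by (rule order_trans) (intro mult_right_mono; simp add: power_divide)
  then have "(norm (z - pole))\<^sup>2 \<le> (671 / 1000 * norm (z - inversion_centre))\<^sup>2"
    by (simp only: power_mult_distrib)
  then have ratio: "norm (z - pole) \<le> 671 / 1000 * norm (z - inversion_centre)"
    by (rule power2_le_imp_le) simp
  then show near_centre: "norm (z - inversion_centre) \<le> 600" using norm_diff_centre_le[of z] by linarith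
  show "norm z \<le> 760"
    using near_centre norm_triangle_ineq[of "z - inversion_centre" inversion_centre] norm_inversion_centre
    by simp
  have "1 \<le> norm (pole - inversion_centre)"
    by (rule power2_le_imp_le) (simp_all add: norm_pole_diff_centre_square)
  then have "1 * norm (z - inversion_centre) \<le> norm (pole - inversion_centre) * norm (z - inversion_centre)"
    by (rule mult_right_mono) simp
  then show "norm (z - pole) \<le> norm (pole - inversion_centre) * norm (z - inversion_centre)"
    using ratio norm_ge_zero[of "z - inversion_centre"] by linarith
  show "1 < norm z"
  proof (rule ccontr)
    assume "\<not> 1 < norm z"
    moreover have "110 \<le> norm pole" by (rule power2_le_imp_le) (simp_all add: norm_pole_square)
    ultimately have "norm (z - inversion_centre) \<le> 161" "109 \<le> norm (z - pole)"
      using norm_triangle_ineq4[of z inversion_centre] norm_triangle_ineq2[of pole z] norm_inversion_centre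
      by (simp_all add: norm_minus_commute)
    then show False using ratio by linarith
  qed
qed

lemma distance_ratio_on_sphere:
  assumes "norm z = 160" "norm z \<le> h \<bullet> z + e \<bullet> z" "0 \<le> h \<bullet> z" "0 < e \<bullet> z"
  shows "(norm (z - pole))\<^sup>2 \<le> 41 / 100 * (norm (z - inversion_centre))\<^sup>2"
proof -
  have "z \<bullet> z = 160\<^sup>2" using assms(1) by (metis power2_norm_eq_inner)
  then have "(norm (z - pole))\<^sup>2 = 37800 - 220 * (h \<bullet> z) + 20 * (e \<bullet> z)"
    "(norm (z - inversion_centre))\<^sup>2 = 51200 + 320 * (e \<bullet> z)"
    by (simp_all add: pole_def inversion_centre_def power2_norm_eq_inner inner_diff_left inner_diff_right
        inner_add_left inner_add_right inner_commute inner_simps)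
  then show ?thesis using assms by simp
qed

lemma gain_barrier_nonneg:
  assumes "0 < e \<bullet> z"
  shows "0 \<le> gain_barrier z"
proof -
  have "norm (z - inversion_centre) / norm (z - pole) \<le> 20"
    using half_space_distances[OF assms] by (simp add: divide_le_eq)
  then have "(norm (z - inversion_centre) / norm (z - pole))\<^sup>2 \<le> 20\<^sup>2" by (intro power_mono) auto
  then show ?thesis by (simp add: gain_barrier_def)
qed

lemma gain_barrier_laplacian:
  obtains \<Delta> where "has_p_laplacian (DIM('a) - 2) gain_barrier \<Delta> (- {pole, inversion_centre})"
    "\<And>z. z \<in> influence_region \<Longrightarrow> 0 < e \<bullet> z \<Longrightarrow> \<Delta> z \<le> - gain_constant DIM('a)"
proof -
  let ?b = inversion_centre
  obtain \<Delta> where laplacian: "has_p_laplacian (DIM('a) - 2) gain_barrier \<Delta> (- {pole, ?b})"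
    and \<Delta>_le: "\<And>z. z \<noteq> pole \<Longrightarrow> z \<noteq> ?b \<Longrightarrow> norm (z - pole) \<le> norm (pole - ?b) * norm (z - ?b) \<Longrightarrow>
      \<Delta> z \<le> - ((1 / 400 / (norm (pole - ?b))\<^sup>2) ^ (DIM('a) - 1) / norm (z - ?b) ^ (2 * DIM('a)))"
    using distance_ratio_barrier[OF dim pole_neq_centre, of "1 / 400" "181 / 180"]
    by (auto simp: gain_barrier_def[abs_def])
  have "\<Delta> z \<le> - gain_constant DIM('a)" if z_region: "z \<in> influence_region" "0 < e \<bullet> z" for z
  proof -
    note distances = influence_region_distances[OF z_region(1)] half_space_distances[OF z_region(2)]
    have "gain_constant DIM('a) \<le> (1 / 400 / 34600) ^ (DIM('a) - 1) / norm (z - ?b) ^ (2 * DIM('a))"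
      unfolding gain_constant_def using distances
      by (intro divide_left_mono power_mono mult_pos_pos) auto
    then show ?thesis using \<Delta>_le[of z] distances by (simp add: norm_pole_diff_centre_square)
  qed
  then show thesis using that[OF laplacian] by blast
qed

lemma gain_comparison:
  assumes subsolution: "comparison_subsolution D v f" "open D" and v_cont: "continuous_on D v"
    and half_space: "\<And>z. z \<in> D \<Longrightarrow> 0 < e \<bullet> z"
    and superlevel: "\<And>T. compact {z \<in> D. 1 \<le> norm z \<and> norm z \<le> T \<and> 0 \<le> v z}"
    and bound: "\<And>z. z \<in> D \<Longrightarrow> 1 \<le> norm z \<Longrightarrow> v z \<le> 1"
    and f_greater: "\<And>z. z \<in> D \<Longrightarrow> 1 \<le> norm z \<Longrightarrow> 0 < v z \<Longrightarrow> - gain_constant DIM('a) < f z"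
    and y_inside: "y \<in> D" "(norm (y - pole))\<^sup>2 < 9 / 20 * (norm (y - inversion_centre))\<^sup>2"
  shows "v y \<le> gain_barrier y"
proof -
  let ?b = inversion_centre
  obtain \<Delta> where laplacian: "has_p_laplacian (DIM('a) - 2) gain_barrier \<Delta> (- {pole, ?b})"
    and \<Delta>_le: "\<And>z. z \<in> influence_region \<Longrightarrow> 0 < e \<bullet> z \<Longrightarrow> \<Delta> z \<le> - gain_constant DIM('a)"
    using gain_barrier_laplacian by blast
  define G where "G = {z. (norm (z - pole))\<^sup>2 < 9 / 20 * (norm (z - ?b))\<^sup>2}"
  have "G \<subseteq> influence_region" by (auto simp: G_def influence_region_def)
  have poles_notin_D: "pole \<notin> D" "?b \<notin> D" using half_space half_space_distances(3,4) by blast+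
  show ?thesis
  proof (rule comparison_subsolution_maximum_principle[OF subsolution v_cont _ \<open>G \<subseteq> influence_region\<close>])
    show "open G" unfolding G_def by (intro open_Collect_less continuous_intros)
    show "y \<in> D \<inter> G" using y_inside by (simp add: G_def)
    have "closed influence_region"
      unfolding influence_region_def by (intro closed_Collect_le continuous_intros)
    from compact_Int_closed[OF superlevel[of 760] this]
    show "compact {z \<in> D \<inter> influence_region. 0 \<le> v z}"
      by (rule back_subst[of compact]) (use influence_region_distances in force)
    show "has_p_laplacian (DIM('a) - 2) gain_barrier \<Delta> (D \<inter> G)"
      by (rule has_p_laplacian_subset[OF laplacian]) (use poles_notin_D in auto)
    show "continuous_on (D \<inter> influence_region) gain_barrier"
      by (rule continuous_on_subset[OF has_p_laplacian_imp_continuous_on[OF laplacian]])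
         (use poles_notin_D in auto)
    fix z assume "z \<in> D \<inter> G"
    then have "z \<in> D" "z \<in> influence_region" using \<open>G \<subseteq> influence_region\<close> by auto
    show "0 \<le> gain_barrier z" by (rule gain_barrier_nonneg[OF half_space[OF \<open>z \<in> D\<close>]])
    moreover assume "gain_barrier z < v z"
    ultimately have "- gain_constant DIM('a) < f z"
      using influence_region_distances(2)[OF \<open>z \<in> influence_region\<close>] \<open>z \<in> D\<close> by (intro f_greater) auto
    then show "\<Delta> z < f z" using \<Delta>_le[OF \<open>z \<in> influence_region\<close> half_space[OF \<open>z \<in> D\<close>]] by linarith
  next
    fix z assume z_on_boundary: "z \<in> D \<inter> influence_region" "z \<notin> G"
    then have ratio: "(norm (z - pole))\<^sup>2 = 9 / 20 * (norm (z - ?b))\<^sup>2"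
      by (auto simp: G_def influence_region_def)
    have "z \<noteq> ?b" using z_on_boundary(1) poles_notin_D by auto
    then have "gain_barrier z = 1" by (simp add: gain_barrier_def power_divide ratio)
    then show "v z \<le> gain_barrier z" using bound[of z] influence_region_distances(2)[of z] z_on_boundary by simp
  qed
qed

end

lemma exists_horizontal_direction:
  fixes e y :: "'a::euclidean_space"
  assumes dim: "2 \<le> DIM('a)" and norm_e: "norm e = 1" and "0 \<le> e \<bullet> y"
  obtains f where "norm f = 1" "e \<bullet> f = 0" "0 \<le> f \<bullet> y" "norm y \<le> f \<bullet> y + e \<bullet> y"
proof (cases "y = (e \<bullet> y) *\<^sub>R e")
  case True
  obtain f0 where f0_orthogonal: "f0 \<noteq> 0" "e \<bullet> f0 = 0"
    using orthogonal_to_vector_exists[OF dim, of e] by (auto simp: orthogonal_def)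
  have "f0 \<bullet> y = 0" using True f0_orthogonal(2) by (metis inner_commute inner_scaleR_right mult_zero_right)
  moreover have "norm y = e \<bullet> y" using True assms by (metis abs_of_nonneg mult.right_neutral norm_scaleR)
  ultimately show thesis using f0_orthogonal by (intro that[of "(1 / norm f0) *\<^sub>R f0"]) auto
next
  case False
  define h where "h = y - (e \<bullet> y) *\<^sub>R e"
  have "e \<bullet> e = 1" using norm_e by (simp add: norm_eq_1)
  then have h_orthogonal: "h \<noteq> 0" "e \<bullet> h = 0" using False by (simp_all add: h_def inner_diff_right)
  have "y = h + (e \<bullet> y) *\<^sub>R e" by (simp add: h_def)
  then have "h \<bullet> y = (norm h)\<^sup>2"
    using h_orthogonal(2)
    by (metis add.right_neutral inner_add_right inner_commute inner_scaleR_right mult_zero_right power2_norm_eq_inner)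
  moreover have "norm y \<le> norm h + e \<bullet> y"
    using norm_triangle_ineq[of h "(e \<bullet> y) *\<^sub>R e"] norm_e \<open>0 \<le> e \<bullet> y\<close> by (simp add: h_def)
  ultimately show thesis
    using h_orthogonal by (intro that[of "(1 / norm h) *\<^sub>R h"]) (auto simp: power2_eq_square)
qed

lemma half_space_gain:
  fixes D :: "'a::euclidean_space set"
  assumes dim: "2 \<le> DIM('a)" and norm_e: "norm e = 1"
    and subsolution: "comparison_subsolution D v f" "open D" and v_cont: "continuous_on D v"
    and half_space: "\<And>z. z \<in> D \<Longrightarrow> 0 < e \<bullet> z"
    and superlevel: "\<And>T. compact {z \<in> D. 1 \<le> norm z \<and> norm z \<le> T \<and> 0 \<le> v z}"
    and bound: "\<And>z. z \<in> D \<Longrightarrow> 1 \<le> norm z \<Longrightarrow> v z \<le> 1"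
    and f_greater: "\<And>z. z \<in> D \<Longrightarrow> 1 \<le> norm z \<Longrightarrow> 0 < v z \<Longrightarrow> - gain_constant DIM('a) < f z"
    and y_on_sphere: "y \<in> D" "norm y = 160"
  shows "v y \<le> 1 - 1 / 2000"
proof -
  obtain h where h_direction: "norm h = 1" "e \<bullet> h = 0" "0 \<le> h \<bullet> y" "norm y \<le> h \<bullet> y + e \<bullet> y"
    using exists_horizontal_direction[OF dim norm_e] half_space[OF y_on_sphere(1)] by (metis less_imp_le)
  interpret gain_geometry e h by unfold_locales (use dim norm_e h_direction in auto)
  note y_distances = half_space_distances[OF half_space[OF y_on_sphere(1)]]
  have distance_ratio: "(norm (y - pole))\<^sup>2 \<le> 41 / 100 * (norm (y - inversion_centre))\<^sup>2"
    using distance_ratio_on_sphere[of y] h_direction half_space[OF y_on_sphere(1)] y_on_sphere(2) by simp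
  moreover have "0 < (norm (y - inversion_centre))\<^sup>2" using y_distances by simp
  ultimately have "(norm (y - pole))\<^sup>2 < 9 / 20 * (norm (y - inversion_centre))\<^sup>2" by linarith
  then have "v y \<le> gain_barrier y"
    by (intro gain_comparison[OF subsolution v_cont half_space superlevel bound f_greater y_on_sphere(1)])
  also have "100 / 41 \<le> (norm (y - inversion_centre) / norm (y - pole))\<^sup>2"
    using distance_ratio y_distances by (simp add: power_divide pos_le_divide_eq)
  then have "gain_barrier y \<le> 1 - 1 / 2000" by (simp add: gain_barrier_def)
  finally show ?thesis .
qed

subsection \<open>Subsolutions in a half-space\<close>

lemma norm_affine_le:
  assumes "0 < \<rho>" "norm y \<le> r"
  shows "norm (c + \<rho> *\<^sub>R y) \<le> norm c + \<rho> * r"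
  by (rule norm_triangle_le) (use assms in simp)

lemma outer_tangent_ball:
  fixes e :: "'a::real_inner"
  assumes norm_e: "norm e = 1" and "z \<noteq> 0"
  obtains x where "e \<bullet> x = - norm z" "norm x \<le> 2 * norm z" "z = x + norm z *\<^sub>R ((1 + e \<bullet> z / norm z) *\<^sub>R e)"
proof
  define x where "x = z - (norm z + e \<bullet> z) *\<^sub>R e"
  have e_inner_e: "e \<bullet> e = 1" using norm_e by (simp add: norm_eq_1)
  show "e \<bullet> x = - norm z" by (simp add: x_def inner_diff_right e_inner_e)
  show "z = x + norm z *\<^sub>R ((1 + e \<bullet> z / norm z) *\<^sub>R e)" using \<open>z \<noteq> 0\<close> by (simp add: x_def algebra_simps)
  have "x \<bullet> x = 2 * (norm z)\<^sup>2 - (e \<bullet> z)\<^sup>2"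
    by (simp add: x_def inner_diff_left inner_diff_right inner_commute e_inner_e
        power2_norm_eq_inner) (simp add: power2_eq_square algebra_simps flip: power2_norm_eq_inner)
  then have "(norm x)\<^sup>2 \<le> 4 * (norm z)\<^sup>2"
    using zero_le_power2[of "e \<bullet> z"] zero_le_power2[of "norm z"] unfolding power2_norm_eq_inner[of x]
    by linarith
  then have "(norm x)\<^sup>2 \<le> (2 * norm z)\<^sup>2" by (simp add: power_mult_distrib)
  then show "norm x \<le> 2 * norm z" by (rule power2_le_imp_le) simp
qed

lemma inner_tangent_ball:
  fixes e :: "'a::real_inner"
  assumes norm_e: "norm e = 1" and height_pos: "0 < e \<bullet> z"
  obtains x where "e \<bullet> x = norm z" "norm x \<le> 2 * norm z" "z = x + norm z *\<^sub>R ((e \<bullet> z / norm z - 1) *\<^sub>R e)"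
proof
  define x where "x = z + (norm z - e \<bullet> z) *\<^sub>R e"
  show "e \<bullet> x = norm z" using norm_e by (simp add: x_def inner_add_right norm_eq_1)
  show "z = x + norm z *\<^sub>R ((e \<bullet> z / norm z - 1) *\<^sub>R e)"
    using height_pos by (auto simp: x_def algebra_simps)
  show "norm x \<le> 2 * norm z"
    using norm_triangle_ineq[of z "(norm z - e \<bullet> z) *\<^sub>R e"] norm_cauchy_schwarz[of e z] norm_e height_pos
    by (simp add: x_def)
qed

locale half_space_subsolution =
  fixes D :: "'a::euclidean_space set" and v f :: "'a \<Rightarrow> real" and e :: 'a
  assumes dim: "2 \<le> DIM('a)" and norm_e: "norm e = 1" and half_space: "\<And>z. z \<in> D \<Longrightarrow> 0 < e \<bullet> z"
    and open_D: "open D" and continuous_v: "continuous_on D v"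
    and subsolution: "comparison_subsolution D v f"
begin

lemma height_bounds: "z \<in> D \<Longrightarrow> 0 < e \<bullet> z \<and> e \<bullet> z \<le> norm z"
  using half_space norm_cauchy_schwarz[of e z] norm_e by simp

lemma scaled_subsolution:
  assumes "0 < \<rho>" "0 < A"
  shows "comparison_subsolution {y. c + \<rho> *\<^sub>R y \<in> D} (\<lambda>y. v (c + \<rho> *\<^sub>R y) / A)
      (\<lambda>y. \<rho> ^ DIM('a) / A ^ (DIM('a) - 1) * f (c + \<rho> *\<^sub>R y))"
    and "open {y. c + \<rho> *\<^sub>R y \<in> D}"
    and "continuous_on {y. c + \<rho> *\<^sub>R y \<in> D} (\<lambda>y. v (c + \<rho> *\<^sub>R y) / A)"
proof -
  show "comparison_subsolution {y. c + \<rho> *\<^sub>R y \<in> D} (\<lambda>y. v (c + \<rho> *\<^sub>R y) / A)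
      (\<lambda>y. \<rho> ^ DIM('a) / A ^ (DIM('a) - 1) * f (c + \<rho> *\<^sub>R y))"
    using comparison_subsolution_affine[OF subsolution dim open_D assms, of c 0] by simp
  show "open {y. c + \<rho> *\<^sub>R y \<in> D}"
    using continuous_open_vimage[OF open_D, of "\<lambda>y. c + \<rho> *\<^sub>R y"]
    by (auto simp: vimage_def intro!: continuous_intros)
  show "continuous_on {y. c + \<rho> *\<^sub>R y \<in> D} (\<lambda>y. v (c + \<rho> *\<^sub>R y) / A)"
    by (intro continuous_intros continuous_on_compose2[OF continuous_v]) (use assms in auto)
qed

lemma scaled_superlevel:
  assumes "0 < \<rho>" "0 < A" and "compact {z \<in> D. P z \<and> 0 \<le> v z}"
  shows "compact {y. c + \<rho> *\<^sub>R y \<in> D \<and> P (c + \<rho> *\<^sub>R y) \<and> 0 \<le> v (c + \<rho> *\<^sub>R y) / A}"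
proof -
  have "compact ((\<lambda>z. (1 / \<rho>) *\<^sub>R (z - c)) ` {z \<in> D. P z \<and> 0 \<le> v z})"
    by (intro compact_continuous_image assms continuous_intros)
  moreover have "(\<lambda>z. (1 / \<rho>) *\<^sub>R (z - c)) ` {z \<in> D. P z \<and> 0 \<le> v z}
      = {y. c + \<rho> *\<^sub>R y \<in> D \<and> P (c + \<rho> *\<^sub>R y) \<and> 0 \<le> v (c + \<rho> *\<^sub>R y) / A}" (is "?g ` _ = _")
  proof (intro equalityI subsetI)
    fix y assume "y \<in> {y. c + \<rho> *\<^sub>R y \<in> D \<and> P (c + \<rho> *\<^sub>R y) \<and> 0 \<le> v (c + \<rho> *\<^sub>R y) / A}"
    then show "y \<in> ?g ` {z \<in> D. P z \<and> 0 \<le> v z}"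
      using assms(1,2) by (intro image_eqI[of _ _ "c + \<rho> *\<^sub>R y"]) (auto simp: zero_le_divide_iff)
  qed (use assms(1,2) in auto)
  ultimately show ?thesis by simp
qed

end

subsection \<open>Absorption forces non-positivity\<close>

locale absorbed_half_space_subsolution = half_space_subsolution D v f e
  for D :: "'a::euclidean_space set" and v f e +
  fixes \<kappa> :: real
  assumes \<kappa>_pos: "0 < \<kappa>" and superlevel: "\<And>T. compact {z \<in> D. norm z \<le> T \<and> 0 \<le> v z}"
    and absorption: "\<And>z. z \<in> D \<Longrightarrow> 0 < v z \<Longrightarrow> \<kappa> * v z ^ (2 * DIM('a) - 1) / norm z ^ (2 * DIM('a)) \<le> f z"
begin

text \<open>The exponents \<open>2 N - 1\<close> and \<open>2 N\<close> make the scaled absorption independent of \<open>\<rho>\<close>.\<close>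

lemma scaled_absorption:
  assumes "0 < \<rho>" "0 < B" and z_positive: "z \<in> D" "norm z \<le> l * \<rho>" "0 < v z / (\<rho> * B)"
  shows "\<kappa> * B ^ DIM('a) / l ^ (2 * DIM('a)) * (v z / (\<rho> * B)) ^ (2 * DIM('a) - 1)
    \<le> \<rho> ^ DIM('a) / (\<rho> * B) ^ (DIM('a) - 1) * f z"
proof -
  obtain m where dim_eq: "DIM('a) = Suc m" using dim by (cases "DIM('a)") auto
  define w where "w = v z / (\<rho> * B)"
  have v_eq: "v z = \<rho> * B * w" "0 < w" using assms by (simp_all add: w_def)
  have "0 < norm z" using height_bounds[OF z_positive(1)] by linarith
  then have "0 < l" using z_positive(2) \<open>0 < \<rho>\<close> by (metis less_le_trans zero_less_mult_pos2)
  have "\<kappa> * B ^ DIM('a) / l ^ (2 * DIM('a)) * w ^ (2 * DIM('a) - 1)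
      = \<rho> ^ DIM('a) / (\<rho> * B) ^ (DIM('a) - 1) * (\<kappa> * v z ^ (2 * DIM('a) - 1) / (l * \<rho>) ^ (2 * DIM('a)))"
    using assms(1,2) \<open>0 < l\<close>
    by (simp add: dim_eq v_eq power_mult_distrib field_simps flip: power_add mult_2)
  also have "\<dots> \<le> \<rho> ^ DIM('a) / (\<rho> * B) ^ (DIM('a) - 1) * (\<kappa> * v z ^ (2 * DIM('a) - 1) / norm z ^ (2 * DIM('a)))"
    using assms(1,2) \<kappa>_pos v_eq \<open>0 < norm z\<close> \<open>0 < l\<close> z_positive(2)
    by (intro mult_left_mono divide_left_mono power_mono mult_pos_pos mult_nonneg_nonneg) auto
  also have "\<dots> \<le> \<rho> ^ DIM('a) / (\<rho> * B) ^ (DIM('a) - 1) * f z"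
    using absorption[OF z_positive(1)] v_eq assms(1,2) by (intro mult_left_mono) auto
  finally show ?thesis by (simp add: w_def)
qed

lemma scaled_superlevel_cball:
  assumes "0 < \<rho>" "0 < A"
  shows "compact {y \<in> {y. c + \<rho> *\<^sub>R y \<in> D}. norm y \<le> r \<and> 0 \<le> v (c + \<rho> *\<^sub>R y) / A}"
proof -
  have "compact (cball 0 r \<inter> {y. c + \<rho> *\<^sub>R y \<in> D \<and> norm (c + \<rho> *\<^sub>R y) \<le> norm c + \<rho> * r \<and> 0 \<le> v (c + \<rho> *\<^sub>R y) / A})"
    by (intro compact_Int compact_cball scaled_superlevel assms superlevel)
  then show ?thesis using norm_affine_le[OF \<open>0 < \<rho>\<close>, of _ r c] by (elim back_subst[of compact]) auto
qed

lemma linear_bound_at: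
  fixes \<Delta> :: "'a \<Rightarrow> real"
  assumes barrier: "0 < c"
      "has_p_laplacian (DIM('a) - 2) (\<lambda>y. annulus_profile (y \<bullet> y)) \<Delta> {y. 1 < norm y \<and> norm y < 3}"
      "\<And>y. 1 < norm y \<Longrightarrow> norm y < 3 \<Longrightarrow> \<Delta> y \<le> c * annulus_profile (y \<bullet> y) ^ (2 * DIM('a) - 1)"
    and B_bounds: "0 < B" "c \<le> \<kappa> * B ^ DIM('a) / 5 ^ (2 * DIM('a))" and z_in_D: "z \<in> D"
  shows "v z \<le> B * (e \<bullet> z)"
proof -
  define \<rho> where "\<rho> = norm z"
  define q where "q = e \<bullet> z / \<rho>"
  have "0 < \<rho>" using height_bounds[OF z_in_D] unfolding \<rho>_def by linarith
  then have \<rho>_pos: "0 < \<rho>" "0 < \<rho> * B" and "z \<noteq> 0" using B_bounds(1) by (simp_all add: \<rho>_def)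
  have q_range: "0 < q" "q \<le> 1" using height_bounds[OF z_in_D] \<rho>_pos by (simp_all add: q_def \<rho>_def)
  obtain x where height_x: "e \<bullet> x = - \<rho>" and norm_x: "norm x \<le> 2 * \<rho>"
    and z_eq: "z = x + \<rho> *\<^sub>R ((1 + q) *\<^sub>R e)"
    using outer_tangent_ball[OF norm_e \<open>z \<noteq> 0\<close>, folded \<rho>_def, folded q_def] by blast
  have near: "norm (x + \<rho> *\<^sub>R y) \<le> 5 * \<rho>" if "norm y < 3" for y
    using norm_affine_le[OF \<rho>_pos(1), of y 3 x] norm_x that by simp
  have "v (x + \<rho> *\<^sub>R ((1 + q) *\<^sub>R e)) / (\<rho> * B) \<le> annulus_profile (((1 + q) *\<^sub>R e) \<bullet> ((1 + q) *\<^sub>R e))"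
  proof (rule annulus_comparison[OF barrier scaled_subsolution[OF \<rho>_pos]])
    show "compact {y \<in> {y. x + \<rho> *\<^sub>R y \<in> D}. norm y \<le> 3 \<and> 0 \<le> v (x + \<rho> *\<^sub>R y) / (\<rho> * B)}"
      by (rule scaled_superlevel_cball[OF \<rho>_pos])
    fix y assume y_in_domain: "y \<in> {y. x + \<rho> *\<^sub>R y \<in> D}"
    then have "\<rho> * 1 < \<rho> * (e \<bullet> y)"
      using half_space[of "x + \<rho> *\<^sub>R y"] by (simp add: inner_add_right height_x)
    then have "1 < e \<bullet> y" using \<rho>_pos(1) by (simp only: mult_less_cancel_left_pos)
    then show "1 < norm y" using norm_cauchy_schwarz[of e y] norm_e by simp
    let ?w = "v (x + \<rho> *\<^sub>R y) / (\<rho> * B)"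
    assume "norm y < 3" and w_pos: "0 < ?w"
    have "c * ?w ^ (2 * DIM('a) - 1) \<le> \<kappa> * B ^ DIM('a) / 5 ^ (2 * DIM('a)) * ?w ^ (2 * DIM('a) - 1)"
      using B_bounds(2) w_pos by (intro mult_right_mono) auto
    also have "\<dots> \<le> \<rho> ^ DIM('a) / (\<rho> * B) ^ (DIM('a) - 1) * f (x + \<rho> *\<^sub>R y)"
      by (rule scaled_absorption[OF \<rho>_pos(1) B_bounds(1) _ near[OF \<open>norm y < 3\<close>] w_pos])
         (use y_in_domain in simp)
    finally show "c * ?w ^ (2 * DIM('a) - 1) \<le> \<rho> ^ DIM('a) / (\<rho> * B) ^ (DIM('a) - 1) * f (x + \<rho> *\<^sub>R y)" .
  qed (use z_in_D z_eq q_range norm_e in auto)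
  also have "((1 + q) *\<^sub>R e) \<bullet> ((1 + q) *\<^sub>R e) = (1 + q)\<^sup>2"
    using norm_e by (simp add: norm_eq_1 power2_eq_square)
  also have "annulus_profile ((1 + q)\<^sup>2) \<le> q" using q_range by (intro annulus_profile_square_le) auto
  finally have "v z / (\<rho> * B) \<le> q" unfolding z_eq[symmetric] .
  then have "v z \<le> q * (\<rho> * B)" by (simp only: pos_divide_le_eq[OF \<rho>_pos(2)])
  also have "\<dots> = B * (e \<bullet> z)" using \<rho>_pos(1) by (simp add: q_def)
  finally show ?thesis .
qed

lemma linear_bound: "\<exists>C>0. \<forall>z\<in>D. v z \<le> C * (e \<bullet> z)"
proof -
  obtain c \<Delta> where barrier: "0 < c"
    "has_p_laplacian (DIM('a) - 2) (\<lambda>y::'a. annulus_profile (y \<bullet> y)) \<Delta> {y. 1 < norm y \<and> norm y < 3}"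
    "\<And>y. 1 < norm y \<Longrightarrow> norm y < 3 \<Longrightarrow> \<Delta> y \<le> c * annulus_profile (y \<bullet> y) ^ (2 * DIM('a) - 1)"
    using annulus_barrier[OF dim] by blast
  define B where "B = max 1 (c * 5 ^ (2 * DIM('a)) / \<kappa>)"
  have B_bounds: "1 \<le> B" "c * 5 ^ (2 * DIM('a)) / \<kappa> \<le> B" by (simp_all add: B_def)
  then have "c * 5 ^ (2 * DIM('a)) / \<kappa> \<le> B ^ DIM('a)"
    using self_le_power[OF B_bounds(1), of "DIM('a)"] by simp
  then have "c \<le> \<kappa> * B ^ DIM('a) / 5 ^ (2 * DIM('a))"
    using \<kappa>_pos by (simp add: pos_divide_le_eq pos_le_divide_eq mult.commute[of \<kappa>])
  then show ?thesis using linear_bound_at[OF barrier] B_bounds(1) by (intro exI[of _ B]) auto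
qed

text \<open>Scaling invariance makes the improvement of the slope independent of the size of the ball.\<close>

lemma slope_improvement_at:
  assumes positive: "0 < K" "0 < \<delta>" and \<delta>_le: "\<delta> * hopf_exponent DIM('a) \<le> K / 4"
      "(2 * K) ^ (DIM('a) - 2) * (\<delta> * (hopf_exponent DIM('a))\<^sup>2) \<le> \<kappa> / 3 ^ (2 * DIM('a)) * (K / 4) ^ (2 * DIM('a) - 1)"
    and linear: "\<And>z. z \<in> D \<Longrightarrow> v z \<le> K * (e \<bullet> z)" and z_in_D: "z \<in> D"
  shows "v z \<le> (K - \<delta> * (hopf_exponent DIM('a) * exp (- hopf_exponent DIM('a)))) * (e \<bullet> z)"
proof -
  define \<rho> where "\<rho> = norm z"
  define q where "q = e \<bullet> z / \<rho>"
  have \<rho>_pos: "0 < \<rho>" using height_bounds[OF z_in_D] unfolding \<rho>_def by linarith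
  have q_range: "0 < q" "q \<le> 1" using height_bounds[OF z_in_D] \<rho>_pos by (simp_all add: q_def \<rho>_def)
  obtain x where height_x: "e \<bullet> x = \<rho>" and norm_x: "norm x \<le> 2 * \<rho>"
    and z_eq: "z = x + \<rho> *\<^sub>R ((q - 1) *\<^sub>R e)"
    using inner_tangent_ball[OF norm_e half_space[OF z_in_D], folded \<rho>_def, folded q_def] by blast
  have near: "norm (x + \<rho> *\<^sub>R y) \<le> 3 * \<rho>" if "norm y < 1" for y
    using norm_affine_le[OF \<rho>_pos, of y 1 x] norm_x that by simp
  let ?s = "((q - 1) *\<^sub>R e) \<bullet> ((q - 1) *\<^sub>R e)"
  have "v (x + \<rho> *\<^sub>R ((q - 1) *\<^sub>R e)) / \<rho> \<le> K * (1 + e \<bullet> ((q - 1) *\<^sub>R e)) - \<delta> * hopf_function DIM('a) ?s"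
  proof (rule hopf_comparison[OF dim norm_e _ positive \<delta>_le scaled_subsolution[OF \<rho>_pos \<rho>_pos]])
    show "0 < \<kappa> / 3 ^ (2 * DIM('a))" using \<kappa>_pos by simp
    show "compact {y \<in> {y. x + \<rho> *\<^sub>R y \<in> D}. norm y \<le> 1 \<and> 0 \<le> v (x + \<rho> *\<^sub>R y) / \<rho>}"
      by (rule scaled_superlevel_cball[OF \<rho>_pos \<rho>_pos])
    fix y assume y_in_domain: "y \<in> {y. x + \<rho> *\<^sub>R y \<in> D}"
    have height_y: "e \<bullet> (x + \<rho> *\<^sub>R y) = \<rho> * (1 + e \<bullet> y)"
      by (simp add: inner_add_right height_x algebra_simps)
    then have "0 < 1 + e \<bullet> y"
      using half_space[of "x + \<rho> *\<^sub>R y"] y_in_domain \<rho>_pos by (simp add: zero_less_mult_iff)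
    then show "- 1 < e \<bullet> y" by simp
    show "v (x + \<rho> *\<^sub>R y) / \<rho> \<le> K * (1 + e \<bullet> y)"
      using linear[of "x + \<rho> *\<^sub>R y"] y_in_domain \<rho>_pos unfolding height_y by (simp add: field_simps)
    assume "norm y < 1" and w_pos: "0 < v (x + \<rho> *\<^sub>R y) / \<rho>"
    have "\<kappa> * 1 ^ DIM('a) / 3 ^ (2 * DIM('a)) * (v (x + \<rho> *\<^sub>R y) / (\<rho> * 1)) ^ (2 * DIM('a) - 1)
        \<le> \<rho> ^ DIM('a) / (\<rho> * 1) ^ (DIM('a) - 1) * f (x + \<rho> *\<^sub>R y)"
      by (rule scaled_absorption[OF \<rho>_pos zero_less_one _ near[OF \<open>norm y < 1\<close>]])
         (use y_in_domain w_pos in simp_all)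
    then show "\<kappa> / 3 ^ (2 * DIM('a)) * (v (x + \<rho> *\<^sub>R y) / \<rho>) ^ (2 * DIM('a) - 1)
        \<le> \<rho> ^ DIM('a) / \<rho> ^ (DIM('a) - 1) * f (x + \<rho> *\<^sub>R y)"
      by (simp only: power_one mult_1_right)
  qed (use z_in_D z_eq q_range norm_e in auto)
  also have "e \<bullet> ((q - 1) *\<^sub>R e) = q - 1" using norm_e by (simp add: norm_eq_1)
  also have "?s = (1 - q)\<^sup>2" using norm_e by (simp add: norm_eq_1 power2_eq_square algebra_simps)
  also have "K * (1 + (q - 1)) - \<delta> * hopf_function DIM('a) ((1 - q)\<^sup>2)
      \<le> (K - \<delta> * (hopf_exponent DIM('a) * exp (- hopf_exponent DIM('a)))) * q"
    using hopf_axis_bound[OF positive(2), of q] q_range by simp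
  finally have "v z / \<rho> \<le> (K - \<delta> * (hopf_exponent DIM('a) * exp (- hopf_exponent DIM('a)))) * q"
    unfolding z_eq[symmetric] .
  then have "v z / \<rho> \<le> (K - \<delta> * (hopf_exponent DIM('a) * exp (- hopf_exponent DIM('a)))) * (e \<bullet> z) / \<rho>"
    by (simp only: q_def times_divide_eq_right)
  then show ?thesis using \<rho>_pos by (simp only: divide_le_cancel)
qed

lemma slope_improvement:
  assumes "0 < K" and linear: "\<And>z. z \<in> D \<Longrightarrow> v z \<le> K * (e \<bullet> z)"
  shows "\<exists>K'<K. 0 \<le> K' \<and> (\<forall>z\<in>D. v z \<le> K' * (e \<bullet> z))"
proof -
  define \<beta> where "\<beta> = hopf_exponent DIM('a)"
  define \<gamma> where "\<gamma> = \<kappa> / 3 ^ (2 * DIM('a)) * (K / 4) ^ (2 * DIM('a) - 1)"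
  define \<delta> where "\<delta> = min (K / (4 * \<beta>)) (\<gamma> / ((2 * K) ^ (DIM('a) - 2) * \<beta>\<^sup>2))"
  define \<theta> where "\<theta> = \<delta> * (\<beta> * exp (- \<beta>))"
  have positive: "0 < \<beta>" "0 < \<gamma>" using dim \<kappa>_pos \<open>0 < K\<close> by (simp_all add: \<beta>_def \<gamma>_def hopf_exponent_def)
  then have "0 < \<delta>" using \<open>0 < K\<close> by (simp add: \<delta>_def)
  have "\<delta> \<le> K / (4 * \<beta>)" "\<delta> \<le> \<gamma> / ((2 * K) ^ (DIM('a) - 2) * \<beta>\<^sup>2)"
    unfolding \<delta>_def by (rule min.cobounded1, rule min.cobounded2)
  then have "\<delta> * \<beta> \<le> K / 4" "(2 * K) ^ (DIM('a) - 2) * (\<delta> * \<beta>\<^sup>2) \<le> \<gamma>"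
    using positive \<open>0 < K\<close> by (simp_all add: field_simps)
  then have "v z \<le> (K - \<theta>) * (e \<bullet> z)" if "z \<in> D" for z
    unfolding \<theta>_def \<beta>_def \<gamma>_def by (intro slope_improvement_at \<open>0 < K\<close> \<open>0 < \<delta>\<close> linear that)
  moreover have "(K - \<theta>) * (e \<bullet> z) \<le> max 0 (K - \<theta>) * (e \<bullet> z)" if "z \<in> D" for z
    using half_space[OF that] by (intro mult_right_mono) auto
  moreover have "0 < \<theta>" using \<open>0 < \<delta>\<close> positive by (simp add: \<theta>_def)
  ultimately show ?thesis using \<open>0 < K\<close> by (intro exI[of _ "max 0 (K - \<theta>)"]) force
qed

theorem nonpos:
  assumes "z \<in> D"
  shows "v z \<le> 0"
proof -
  define slopes where "slopes = {K. 0 \<le> K \<and> (\<forall>z\<in>D. v z \<le> K * (e \<bullet> z))}"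
  define K where "K = Inf slopes"
  have slopes: "slopes \<noteq> {}" "bdd_below slopes"
    using linear_bound less_imp_le by (auto simp: slopes_def bdd_below_def)
  have "0 \<le> K" unfolding K_def by (rule cInf_greatest[OF slopes(1)]) (simp add: slopes_def)
  have linear: "v z \<le> K * (e \<bullet> z)" if z_in_D: "z \<in> D" for z
  proof -
    have "v z / (e \<bullet> z) \<le> K" unfolding K_def
      by (rule cInf_greatest[OF slopes(1)])
         (use z_in_D half_space[OF z_in_D] in \<open>auto simp: slopes_def divide_le_eq\<close>)
    then show ?thesis using half_space[OF z_in_D] by (simp add: divide_le_eq)
  qed
  have "K = 0"
  proof (rule ccontr)
    assume "K \<noteq> 0"
    then have "0 < K" using \<open>0 \<le> K\<close> by simp
    from slope_improvement[OF this linear] obtain K' where "K' < K" "K' \<in> slopes" by (auto simp: slopes_def)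
    then show False using cInf_lower[OF _ slopes(2)] by (force simp: K_def)
  qed
  then show ?thesis using linear[OF assms] by simp
qed

end

subsection \<open>Decay at infinity\<close>

locale bounded_half_space_subsolution = half_space_subsolution D v f e
  for D :: "'a::euclidean_space set" and v f e +
  fixes R Q V :: real
  assumes R_pos: "0 < R" and Q_nonneg: "0 \<le> Q" and upper_bound: "\<And>z. z \<in> D \<Longrightarrow> v z \<le> V"
    and superlevel: "\<And>S T. R \<le> S \<Longrightarrow> compact {z \<in> D. S \<le> norm z \<and> norm z \<le> T \<and> 0 \<le> v z}"
    and lower_bound: "\<And>z. z \<in> D \<Longrightarrow> 0 < v z \<Longrightarrow> - (Q / norm z ^ (2 * DIM('a))) \<le> f z"
begin

lemma gain_on_sphere:
  assumes R_le_T: "R \<le> T" and "0 < S" and bound: "\<And>z. z \<in> D \<Longrightarrow> T \<le> norm z \<Longrightarrow> v z \<le> S"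
    and small: "Q < gain_constant DIM('a) * (S ^ (DIM('a) - 1) * T ^ DIM('a))"
    and z_on_sphere: "z \<in> D" "norm z = 160 * T"
  shows "v z \<le> (1 - 1 / 2000) * S"
proof -
  have "0 < T" using R_pos R_le_T by simp
  have scale: "T * norm y = norm (0 + T *\<^sub>R y)" for y :: 'a using \<open>0 < T\<close> by simp
  have "v (0 + T *\<^sub>R ((1 / T) *\<^sub>R z)) / S \<le> 1 - 1 / 2000"
  proof (rule half_space_gain[OF dim norm_e scaled_subsolution[OF \<open>0 < T\<close> \<open>0 < S\<close>]])
    fix r
    have "{y \<in> {y. 0 + T *\<^sub>R y \<in> D}. 1 \<le> norm y \<and> norm y \<le> r \<and> 0 \<le> v (0 + T *\<^sub>R y) / S}
      = {y. 0 + T *\<^sub>R y \<in> D \<and> (T \<le> norm (0 + T *\<^sub>R y) \<and> norm (0 + T *\<^sub>R y) \<le> T * r) \<and> 0 \<le> v (0 + T *\<^sub>R y) / S}"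
      using \<open>0 < T\<close> unfolding scale[symmetric] by auto
    then show "compact {y \<in> {y. 0 + T *\<^sub>R y \<in> D}. 1 \<le> norm y \<and> norm y \<le> r \<and> 0 \<le> v (0 + T *\<^sub>R y) / S}"
      using scaled_superlevel[OF \<open>0 < T\<close> \<open>0 < S\<close>,
          of "\<lambda>z. T \<le> norm z \<and> norm z \<le> T * r" 0] superlevel[OF R_le_T, of "T * r"]
      by simp
  next
    fix y assume y_in_domain: "y \<in> {y. 0 + T *\<^sub>R y \<in> D}"
    then show "0 < e \<bullet> y" using half_space[of "T *\<^sub>R y"] \<open>0 < T\<close> by (simp add: zero_less_mult_iff)
    assume "1 \<le> norm y"
    then have far: "T \<le> norm (T *\<^sub>R y)" using \<open>0 < T\<close> by simp
    then show "v (0 + T *\<^sub>R y) / S \<le> 1" using bound[of "T *\<^sub>R y"] y_in_domain \<open>0 < S\<close> by simp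
    assume "0 < v (0 + T *\<^sub>R y) / S"
    then have "- (Q / norm (T *\<^sub>R y) ^ (2 * DIM('a))) \<le> f (T *\<^sub>R y)"
      using lower_bound[of "T *\<^sub>R y"] y_in_domain \<open>0 < S\<close> by (simp add: zero_less_divide_iff)
    moreover have "Q / norm (T *\<^sub>R y) ^ (2 * DIM('a)) \<le> Q / T ^ (2 * DIM('a))"
      using Q_nonneg \<open>0 < T\<close> far less_le_trans[OF \<open>0 < T\<close> far]
      by (intro divide_left_mono power_mono mult_pos_pos zero_less_power) simp_all
    ultimately have "- (Q / T ^ (2 * DIM('a))) \<le> f (T *\<^sub>R y)" by linarith
    then have "T ^ DIM('a) / S ^ (DIM('a) - 1) * - (Q / T ^ (2 * DIM('a))) \<le> T ^ DIM('a) / S ^ (DIM('a) - 1) * f (T *\<^sub>R y)"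
      using \<open>0 < T\<close> \<open>0 < S\<close> by (intro mult_left_mono) auto
    moreover have "Q / (S ^ (DIM('a) - 1) * T ^ DIM('a)) < gain_constant DIM('a)"
      using small \<open>0 < T\<close> \<open>0 < S\<close> by (simp add: divide_less_eq)
    then have "- gain_constant DIM('a) < T ^ DIM('a) / S ^ (DIM('a) - 1) * - (Q / T ^ (2 * DIM('a)))"
      using \<open>0 < T\<close> by (simp add: mult_2 power_add)
    ultimately show "- gain_constant DIM('a) < T ^ DIM('a) / S ^ (DIM('a) - 1) * f (0 + T *\<^sub>R y)"
      by simp
  qed (use z_on_sphere \<open>0 < T\<close> in auto)
  then show ?thesis using \<open>0 < T\<close> \<open>0 < S\<close> by (simp add: divide_le_eq)
qed

lemma gain_near_infinity:
  assumes "0 < S" and bound: "\<exists>T\<ge>R. \<forall>z\<in>D. T \<le> norm z \<longrightarrow> v z \<le> S"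
  shows "\<exists>T\<ge>R. \<forall>z\<in>D. T \<le> norm z \<longrightarrow> v z \<le> (1 - 1 / 2000) * S"
proof -
  obtain T1 where bound_beyond_T1: "R \<le> T1" "\<And>z. z \<in> D \<Longrightarrow> T1 \<le> norm z \<Longrightarrow> v z \<le> S" using bound by blast
  define k where "k = gain_constant DIM('a) * S ^ (DIM('a) - 1)"
  have k_pos: "0 < k" using \<open>0 < S\<close> by (simp add: k_def gain_constant_def)
  define T2 where "T2 = max (max T1 1) (Q / k + 1)"
  have "v z \<le> (1 - 1 / 2000) * S" if z_far: "z \<in> D" "160 * T2 \<le> norm z" for z
  proof -
    define T where "T = norm z / 160"
    have "T2 \<le> T" using z_far(2) by (simp add: T_def)
    then have T_bounds: "T1 \<le> T" "1 \<le> T" "Q / k + 1 \<le> T" by (auto simp: T2_def)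
    have "Q / k < T" using T_bounds(3) by simp
    also have "T \<le> T ^ DIM('a)" using T_bounds(2) by (intro self_le_power) auto
    finally have "Q < gain_constant DIM('a) * (S ^ (DIM('a) - 1) * T ^ DIM('a))"
      using k_pos by (simp add: k_def divide_less_eq mult_ac)
    then show ?thesis
      using bound_beyond_T1 T_bounds(1) z_far \<open>0 < S\<close> by (intro gain_on_sphere[of T]) (auto simp: T_def)
  qed
  moreover have "T1 \<le> T2" by (simp add: T2_def)
  then have "R \<le> 160 * T2" using bound_beyond_T1(1) R_pos by linarith
  ultimately show ?thesis by blast
qed

theorem le_near_infinity:
  assumes "0 < \<eta>"
  shows "\<exists>T. \<forall>z\<in>D. T \<le> norm z \<longrightarrow> v z \<le> \<eta>"
proof -
  define W where "W = max V 1"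
  have bound: "\<exists>T\<ge>R. \<forall>z\<in>D. T \<le> norm z \<longrightarrow> v z \<le> (1 - 1 / 2000) ^ n * W" for n
  proof (induction n)
    case 0
    show ?case using upper_bound by (force simp: W_def)
  next
    case (Suc n)
    then show ?case using gain_near_infinity[of "(1 - 1 / 2000) ^ n * W"] by (simp add: W_def mult.assoc)
  qed
  have "0 < W" by (simp add: W_def)
  then obtain n where "(1 - 1 / 2000) ^ n < \<eta> / W"
    using real_arch_pow_inv[of "\<eta> / W" "1 - 1 / 2000"] assms by auto
  then have "(1 - 1 / 2000) ^ n * W \<le> \<eta>" using \<open>0 < W\<close> by (simp add: field_simps)
  then show ?thesis using bound[of n] order_trans by blast
qed

end

subsection \<open>The exterior ball condition\<close>

lemma has_derivative_imp_Lipschitz_at: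
  fixes f :: "'a::real_normed_vector \<Rightarrow> 'b::real_normed_vector"
  assumes "(f has_derivative f') (at a)"
  obtains L d where "0 < L" "0 < d" "\<And>x. norm (x - a) < d \<Longrightarrow> norm (f x - f a) \<le> L * norm (x - a)"
proof -
  obtain d where linearization: "0 < d" "\<And>y. norm (y - a) < d \<Longrightarrow> norm (f y - f a - f' (y - a)) \<le> 1 * norm (y - a)"
    using assms unfolding has_derivative_at_alt by (meson zero_less_one)
  obtain K where K_bound: "0 < K" "\<And>h. norm (f' h) \<le> norm h * K"
    using bounded_linear.pos_bounded[OF has_derivative_bounded_linear[OF assms]] by blast
  have "norm (f x - f a) \<le> (K + 1) * norm (x - a)" if "norm (x - a) < d" for x
  proof -
    have "norm (f x - f a) \<le> norm (f x - f a - f' (x - a)) + norm (f' (x - a))"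
      using norm_triangle_ineq[of "f x - f a - f' (x - a)" "f' (x - a)"] by simp
    then show ?thesis using linearization(2)[OF that] K_bound(2)[of "x - a"] by (simp add: algebra_simps)
  qed
  then show thesis using linearization(1) K_bound(1) by (intro that[of "K + 1" d]) auto
qed

lemma Lipschitz_gradient_remainder:
  fixes \<sigma> :: "'a::euclidean_space \<Rightarrow> real"
  assumes \<sigma>_deriv: "\<And>x. x \<in> ball a r \<Longrightarrow> (\<sigma> has_derivative (\<bullet>) (p x)) (at x)"
    and p_Lipschitz: "\<And>x. x \<in> ball a r \<Longrightarrow> norm (p x - p a) \<le> L * norm (x - a)"
    and "0 \<le> L" and x_in_ball: "x \<in> ball a r"
  shows "\<bar>\<sigma> x - \<sigma> a - p a \<bullet> (x - a)\<bar> \<le> L * (norm (x - a))\<^sup>2"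
proof -
  have segment: "closed_segment a x \<subseteq> ball a r"
    using x_in_ball by (intro closed_segment_subset) (auto intro: le_less_trans[OF zero_le_dist])
  have "norm (\<sigma> x - \<sigma> a - (\<bullet>) (p a) (x - a)) \<le> norm (x - a) * (L * norm (x - a))"
  proof (rule differentiable_bound_linearization[where f'="\<lambda>y. (\<bullet>) (p y)" and ?x0.0=a])
    show "a + t *\<^sub>R (x - a) \<in> closed_segment a x" if "t \<in> {0..1}" for t
      using that by (auto simp: in_segment algebra_simps intro!: exI[of _ t])
    show "(\<sigma> has_derivative (\<bullet>) (p y)) (at y within closed_segment a x)" if "y \<in> closed_segment a x" for y
      using \<sigma>_deriv[of y] segment that has_derivative_at_withinI by blast
    show "onorm ((\<bullet>) (p y) - (\<bullet>) (p a)) \<le> L * norm (x - a)" if y_in_segment: "y \<in> closed_segment a x" for y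
    proof (rule onorm_le)
      fix h
      have "norm (((\<bullet>) (p y) - (\<bullet>) (p a)) h) \<le> norm (p y - p a) * norm h"
        using Cauchy_Schwarz_ineq2[of "p y - p a" h] by (simp add: inner_diff_left)
      also have "\<dots> \<le> L * norm (y - a) * norm h"
        using p_Lipschitz[of y] segment y_in_segment by (intro mult_right_mono) auto
      also have "\<dots> \<le> L * norm (x - a) * norm h"
        using segment_bound(1)[OF y_in_segment] \<open>0 \<le> L\<close> by (intro mult_right_mono mult_left_mono) auto
      finally show "norm (((\<bullet>) (p y) - (\<bullet>) (p a)) h) \<le> L * norm (x - a) * norm h" .
    qed
  qed auto
  then show ?thesis by (simp add: power2_eq_square mult_ac)
qed

lemma C2_on_gradient:
  fixes \<sigma> :: "'a::euclidean_space \<Rightarrow> real"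
  assumes "C2_on \<sigma> S" "a \<in> S"
  obtains p p' where "\<And>x. x \<in> S \<Longrightarrow> (\<sigma> has_derivative (\<bullet>) (p x)) (at x)" "(p has_derivative p') (at a)"
proof -
  obtain p where p_gradient: "\<And>x. x \<in> S \<Longrightarrow> (\<sigma> has_derivative (\<lambda>h. p x \<bullet> h)) (at x)"
    and p_C1: "\<And>i. i \<in> Basis \<Longrightarrow> C1_on (\<lambda>x. p x \<bullet> i) S"
    using assms(1) unfolding C2_on_def by blast
  have "\<exists>d. ((\<lambda>x. p x \<bullet> i) has_derivative (\<lambda>h. d \<bullet> h)) (at a)" if "i \<in> Basis" for i
    using p_C1[OF that] assms(2) unfolding C1_on_def by blast
  then obtain d where d_deriv: "\<And>i. i \<in> Basis \<Longrightarrow> ((\<lambda>x. p x \<bullet> i) has_derivative (\<lambda>h. d i \<bullet> h)) (at a)"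
    by metis
  have "(p has_derivative (\<lambda>h. \<Sum>i\<in>Basis. (d i \<bullet> h) *\<^sub>R i)) (at a)"
    by (subst has_derivative_componentwise_within) (simp add: d_deriv)
  then show thesis using p_gradient by (rule that[rotated])
qed

text \<open>For \<open>s > 0\<close> the last condition says that \<open>\<Omega>\<close> avoids, near \<open>a\<close>, the closed ball of
  diameter \<open>1 / s\<close> touching \<open>a\<close> from the direction \<open>- e\<close>.\<close>

lemma exterior_ball:
  fixes \<Omega> :: "'a::euclidean_space set"
  assumes bdry: "compact_C2_boundary \<Omega>" and "open \<Omega>" and a_frontier: "a \<in> frontier \<Omega>"
  obtains e s \<delta> where "norm e = 1" "0 \<le> s" "0 < \<delta>"
    "\<And>x. x \<in> \<Omega> \<Longrightarrow> norm (x - a) < \<delta> \<Longrightarrow> - s * (norm (x - a))\<^sup>2 < e \<bullet> (x - a)"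
proof -
  obtain r \<sigma> D\<sigma> where "0 < r"
    and D\<sigma>_gradient: "\<And>x. x \<in> ball a r \<Longrightarrow> (\<sigma> has_derivative (\<bullet>) (D\<sigma> x)) (at x) \<and> D\<sigma> x \<noteq> 0"
    and \<sigma>_C2: "C2_on \<sigma> (ball a r)" and \<Omega>_eq: "\<Omega> \<inter> ball a r = {x \<in> ball a r. \<sigma> x < 0}"
    using bdry a_frontier unfolding compact_C2_boundary_def by meson
  have a_ball: "a \<in> ball a r" using \<open>0 < r\<close> by simp
  obtain p p' where p_gradient: "\<And>x. x \<in> ball a r \<Longrightarrow> (\<sigma> has_derivative (\<bullet>) (p x)) (at x)"
    and "(p has_derivative p') (at a)"
    using C2_on_gradient[OF \<sigma>_C2 a_ball] by metis
  then obtain L d where p_Lipschitz: "0 < L" "0 < d" "\<And>x. norm (x - a) < d \<Longrightarrow> norm (p x - p a) \<le> L * norm (x - a)"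
    using has_derivative_imp_Lipschitz_at by metis
  have "(\<bullet>) (p a) = (\<bullet>) (D\<sigma> a)"
    using has_derivative_unique[OF p_gradient[OF a_ball]] D\<sigma>_gradient[OF a_ball] by blast
  then have "(p a - D\<sigma> a) \<bullet> (p a - D\<sigma> a) = 0" by (simp add: inner_diff_left fun_eq_iff)
  then have p_a_nonzero: "p a \<noteq> 0" using D\<sigma>_gradient[OF a_ball] by simp
  have "a \<notin> \<Omega>" using a_frontier \<open>open \<Omega>\<close> by (simp add: frontier_def interior_open)
  then have "0 \<le> \<sigma> a" using \<Omega>_eq a_ball by force
  have below: "p a \<bullet> (x - a) < L * (norm (x - a))\<^sup>2" if x_near_a: "x \<in> \<Omega>" "norm (x - a) < min r d" for x
  proof -
    have "x \<in> \<Omega> \<inter> ball a r" using x_near_a by (simp add: dist_norm norm_minus_commute)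
    then have "\<sigma> x < 0" using \<Omega>_eq by blast
    moreover have "\<bar>\<sigma> x - \<sigma> a - p a \<bullet> (x - a)\<bar> \<le> L * (norm (x - a))\<^sup>2"
      by (rule Lipschitz_gradient_remainder[where r="min r d"])
         (use p_gradient p_Lipschitz x_near_a in \<open>auto simp: dist_norm norm_minus_commute\<close>)
    ultimately show ?thesis using \<open>0 \<le> \<sigma> a\<close> by linarith
  qed
  show thesis
  proof (rule that)
    show "norm ((- 1 / norm (p a)) *\<^sub>R p a) = 1" using p_a_nonzero by simp
    show "0 \<le> L / norm (p a)" "0 < min r d" using p_Lipschitz \<open>0 < r\<close> by simp_all
    fix x assume "x \<in> \<Omega>" "norm (x - a) < min r d"
    from below[OF this]
    show "- (L / norm (p a)) * (norm (x - a))\<^sup>2 < (- 1 / norm (p a)) *\<^sub>R p a \<bullet> (x - a)"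
      using p_a_nonzero by (simp add: divide_strict_right_mono)
  qed
qed

subsection \<open>Solutions with an isolated boundary singularity\<close>

lemma norm_inversion_diff: "norm (inversion a t x - t) = 1 / norm (x - a)"
  by (simp add: inversion_def inversion_factor_def power2_eq_square flip: power2_norm_eq_inner)

lemma norm_inversion_ge: "1 / norm (x - a) - norm t \<le> norm (inversion a t x)"
  using norm_triangle_ineq4[of "inversion a t x" t] by (simp add: norm_inversion_diff)

lemma norm_inversion_le: "norm (inversion a t x) \<le> 1 / norm (x - a) + norm t"
  using norm_triangle_ineq[of "inversion a t x - t" t] by (simp add: norm_inversion_diff)

lemma norm_diff_less_if_norm_inversion:
  assumes "x \<noteq> a" "0 < d" "norm t + 1 / d \<le> norm (inversion a t x)"
  shows "norm (x - a) \<le> d"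
proof -
  have "1 / d \<le> 1 / norm (x - a)" using assms(3) norm_inversion_le[of a t x] by linarith
  then show ?thesis using assms(1,2) by (simp add: field_simps)
qed

lemma eventually_norm_inversion:
  fixes a t :: "'a::euclidean_space"
  shows "\<forall>\<^sub>F x in at a. T < norm (inversion a t x)"
proof -
  define d where "d = 1 / (\<bar>T\<bar> + norm t + 1)"
  have "0 < d" by (simp add: d_def add_nonneg_pos)
  have "T < norm (inversion a t x)" if "x \<noteq> a" "dist x a < d" for x
  proof -
    have "1 / d < 1 / norm (x - a)"
      using that \<open>0 < d\<close> by (intro divide_strict_left_mono) (auto simp: dist_norm)
    then show ?thesis using norm_inversion_ge[of x a t] by (simp add: d_def)
  qed
  then show ?thesis using \<open>0 < d\<close> by (auto simp: eventually_at)
qed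

locale punctured_solution =
  fixes \<Omega> :: "(real^'n) set" and a :: "real^'n" and g :: "real \<Rightarrow> real"
    and u :: "real^'n \<Rightarrow> real" and Du :: "real^'n \<Rightarrow> real^'n" and \<Phi> :: "real^'n \<Rightarrow> real"
  assumes dim: "2 \<le> CARD('n)" and open_\<Omega>: "open \<Omega>" and bdry: "compact_C2_boundary \<Omega>"
    and a_frontier: "a \<in> frontier \<Omega>" and g_cont: "continuous_on UNIV g"
    and u_diff: "\<And>x. x \<in> \<Omega> \<Longrightarrow> (u has_derivative (\<bullet>) (Du x)) (at x)"
    and u_cont: "continuous_on (closure \<Omega> - {a}) u" and Du_cont: "continuous_on (closure \<Omega> - {a}) Du"
    and solution: "weak_solution \<Omega> g u Du" and \<Phi>_cont: "continuous_on UNIV \<Phi>"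
    and boundary_values: "\<And>x. x \<in> frontier \<Omega> \<Longrightarrow> x \<noteq> a \<Longrightarrow> u x = \<Phi> x"
begin

lemma a_notin_\<Omega>: "a \<notin> \<Omega>"
  using a_frontier open_\<Omega> by (simp add: frontier_def interior_open)

lemma compact_superlevel_closure:
  assumes "compact K" and K_subset: "K \<subseteq> closure \<Omega> - {a}"
    and boundary: "\<And>x. x \<in> K \<Longrightarrow> x \<in> frontier \<Omega> \<Longrightarrow> \<Phi> x < M"
  shows "compact {x \<in> K. M \<le> u x}" and "{x \<in> K. M \<le> u x} \<subseteq> \<Omega>"
proof -
  have "closed {x \<in> K. M \<le> u x}"
    by (intro continuous_on_closed_Collect_le continuous_on_const compact_imp_closed[OF \<open>compact K\<close>]
        continuous_on_subset[OF u_cont K_subset])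
  from compact_Int_closed[OF \<open>compact K\<close> this] show "compact {x \<in> K. M \<le> u x}"
    by (rule back_subst[of compact]) auto
  have "closure \<Omega> = \<Omega> \<union> frontier \<Omega>"
    using closure_subset[of \<Omega>] open_\<Omega> by (auto simp: frontier_def interior_open)
  then show "{x \<in> K. M \<le> u x} \<subseteq> \<Omega>" using K_subset boundary boundary_values by force
qed

lemma uminus: "punctured_solution \<Omega> a (\<lambda>r. - g (- r)) (\<lambda>x. - u x) (\<lambda>x. - Du x) (\<lambda>x. - \<Phi> x)"
proof
  show "continuous_on UNIV (\<lambda>r. - g (- r))"
    by (intro continuous_intros continuous_on_compose2[OF g_cont]) auto
  show "((\<lambda>x. - u x) has_derivative (\<bullet>) (- Du x)) (at x)" if "x \<in> \<Omega>" for x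
    by (rule has_derivative_eq_rhs[OF has_derivative_minus[OF u_diff[OF that]]]) (simp add: fun_eq_iff)
  show "weak_solution \<Omega> (\<lambda>r. - g (- r)) (\<lambda>x. - u x) (\<lambda>x. - Du x)"
    unfolding weak_solution_def
  proof (intro allI impI)
    fix \<zeta> :: "real^'n \<Rightarrow> real" and D\<zeta> assume "test_fun \<Omega> \<zeta> D\<zeta>"
    then have "(LINT x:\<Omega>|lborel. norm (Du x) ^ (CARD('n) - 2) * (Du x \<bullet> D\<zeta> x) + g (u x) * \<zeta> x) = 0"
      using solution unfolding weak_solution_def by blast
    then have "(LINT x:\<Omega>|lborel. - (norm (Du x) ^ (CARD('n) - 2) * (Du x \<bullet> D\<zeta> x) + g (u x) * \<zeta> x)) = 0"
      unfolding set_lebesgue_integral_def scaleR_minus_right Bochner_Integration.integral_minus by simp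
    then show "(LINT x:\<Omega>|lborel. norm (- Du x) ^ (CARD('n) - 2) * (- Du x \<bullet> D\<zeta> x) + - g (- (- u x)) * \<zeta> x) = 0"
      by (simp add: algebra_simps)
  qed
qed (use dim open_\<Omega> bdry a_frontier boundary_values in \<open>auto intro!: continuous_intros u_cont Du_cont \<Phi>_cont\<close>)

end

text \<open>The image under inversion at \<open>a\<close> is contained, near infinity, in the half-space \<open>e \<bullet> z > 0\<close>.\<close>

locale inverted_solution = punctured_solution \<Omega> a g u Du \<Phi>
  for \<Omega> :: "(real^'n) set" and a g u Du \<Phi> +
  fixes t e :: "real^'n" and R :: real
  assumes norm_e: "norm e = 1" and R_bounds: "0 < R" "2 * norm t < R"
    and half_space: "\<And>x. x \<in> \<Omega> \<Longrightarrow> R \<le> norm (inversion a t x) \<Longrightarrow> 0 < e \<bullet> inversion a t x"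
begin

definition U where "U = inversion a t ` \<Omega>"
definition D where "D = {z \<in> U. R < norm z}"
definition v where "v z = u (inversion t a z)"
definition f where "f z = inversion_factor t z ^ CARD('n) * g (v z)"

lemma homeomorphism_U: "homeomorphism \<Omega> U (inversion a t) (inversion t a)"
  unfolding U_def by (rule homeomorphism_of_subsets[OF homeomorphism_inversion]) (use a_notin_\<Omega> in auto)

lemma open_U: "open U"
proof -
  have "U = - {t} \<inter> inversion t a -` \<Omega>"
  proof (intro equalityI subsetI)
    fix z assume "z \<in> - {t} \<inter> inversion t a -` \<Omega>"
    then show "z \<in> U" unfolding U_def
      by (intro image_eqI[of _ _ "inversion t a z"]) (auto simp: inversion_inversion)
  next
    fix z assume "z \<in> U"
    then obtain x where "x \<in> \<Omega>" "z = inversion a t x" by (auto simp: U_def)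
    moreover from this have "x \<noteq> a" using a_notin_\<Omega> by auto
    ultimately show "z \<in> - {t} \<inter> inversion t a -` \<Omega>"
      by (auto simp: inversion_inversion inversion_eq_iff)
  qed
  then show ?thesis
    using continuous_open_preimage[OF continuous_on_inversion[of t "- {t}" a] _ open_\<Omega>] by auto
qed

lemma u_C1: "has_C1_derivative u (\<lambda>x. (\<bullet>) (Du x)) \<Omega>"
proof (rule has_C1_derivativeI[OF u_diff])
  have "\<Omega> \<subseteq> closure \<Omega> - {a}" using closure_subset a_notin_\<Omega> by auto
  then show "continuous_on \<Omega> (\<lambda>x. Du x \<bullet> h)" for h
    by (intro continuous_intros continuous_on_subset[OF Du_cont])
qed

lemma v_cont: "continuous_on U v"
  unfolding v_def
  using homeomorphism_cont2[OF homeomorphism_U] homeomorphism_image2[OF homeomorphism_U]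
  by (intro continuous_on_compose2[OF has_C1_derivative_imp_continuous_on[OF u_C1]]) auto

lemma half_space_subsolution: "half_space_subsolution D (\<lambda>z. v z - M) f e"
proof
  have "comparison_subsolution U v f"
    unfolding U_def v_def[abs_def] f_def[abs_def]
    using comparison_subsolution_inversion[OF _ weak_solution_imp_comparison_subsolution[OF solution u_C1 g_cont]
        open_\<Omega> a_notin_\<Omega>, of t] dim by (simp add: v_def)
  from comparison_subsolution_affine[OF this _ open_U zero_less_one zero_less_one, of 0 M]
  have "comparison_subsolution U (\<lambda>z. v z - M) f" using dim by simp
  then show "comparison_subsolution D (\<lambda>z. v z - M) f"
    by (rule comparison_subsolution_mono) (auto simp: D_def)
  show "0 < e \<bullet> z" if "z \<in> D" for z using that half_space by (auto simp: D_def U_def)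
  have "open (U \<inter> {z. R < norm z})" by (intro open_Int open_U open_Collect_less continuous_intros)
  then show "open D" by (simp add: D_def Int_def)
  show "continuous_on D (\<lambda>z. v z - M)"
    by (intro continuous_intros continuous_on_subset[OF v_cont]) (auto simp: D_def)
qed (use norm_e dim in auto)

lemma compact_superlevel:
  assumes boundary: "\<And>x. x \<in> frontier \<Omega> \<Longrightarrow> x \<noteq> a \<Longrightarrow> S \<le> norm (inversion a t x) \<Longrightarrow> \<Phi> x < M" and "R \<le> S"
  shows "compact {z \<in> U. S \<le> norm z \<and> norm z \<le> T \<and> M \<le> v z}"
proof -
  define C where "C = {z::real^'n. S \<le> norm z \<and> norm z \<le> T}"
  define K where "K = closure \<Omega> \<inter> inversion t a ` C"
  have "norm t < S" using R_bounds \<open>R \<le> S\<close> norm_ge_zero[of t] by linarith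
  then have "t \<notin> C" by (simp add: C_def)
  have "compact (cball 0 T \<inter> {z::real^'n. S \<le> norm z})"
    by (intro compact_Int_closed compact_cball closed_Collect_le continuous_intros)
  then have "compact C" by (rule back_subst[of compact]) (auto simp: C_def)
  then have "compact K"
    unfolding K_def
    using compact_Int_closed[OF compact_continuous_image[OF continuous_on_inversion[OF \<open>t \<notin> C\<close>]]]
    by (simp add: Int_commute)
  have K_image: "x \<noteq> a" "inversion a t x \<in> C" if x_superlevel: "x \<in> K" for x
  proof -
    obtain z where "z \<in> C" "x = inversion t a z" using x_superlevel by (auto simp: K_def)
    moreover from this have "z \<noteq> t" using \<open>t \<notin> C\<close> by auto
    ultimately show "x \<noteq> a" "inversion a t x \<in> C" by (simp_all add: inversion_inversion inversion_eq_iff)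
  qed
  then have "K \<subseteq> closure \<Omega> - {a}" unfolding K_def by blast
  have in_C: "S \<le> norm z" "norm z \<le> T" if "z \<in> C" for z using that by (simp_all add: C_def)
  have "\<Phi> x < M" if "x \<in> K" "x \<in> frontier \<Omega>" for x
    by (intro boundary that(2) K_image(1) in_C(1) K_image(2)) (rule that(1))+
  note superlevel = compact_superlevel_closure[OF \<open>compact K\<close> \<open>K \<subseteq> closure \<Omega> - {a}\<close> this]
  have "continuous_on {x \<in> K. M \<le> u x} (inversion a t)"
    by (rule continuous_on_inversion) (use K_image(1) in blast)
  then have "compact (inversion a t ` {x \<in> K. M \<le> u x})"
    by (rule compact_continuous_image[OF _ superlevel(1)])
  moreover have "inversion a t ` {x \<in> K. M \<le> u x} = {z \<in> U. S \<le> norm z \<and> norm z \<le> T \<and> M \<le> v z}"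
  proof (intro equalityI subsetI)
    fix z assume "z \<in> inversion a t ` {x \<in> K. M \<le> u x}"
    then obtain x where x_superlevel: "x \<in> K" "M \<le> u x" "z = inversion a t x" by blast
    moreover from x_superlevel have "x \<in> \<Omega>" using superlevel(2) by blast
    ultimately show "z \<in> {z \<in> U. S \<le> norm z \<and> norm z \<le> T \<and> M \<le> v z}"
      using K_image[OF x_superlevel(1)] in_C[of z] by (simp add: U_def v_def inversion_inversion)
  next
    fix z assume z_superlevel: "z \<in> {z \<in> U. S \<le> norm z \<and> norm z \<le> T \<and> M \<le> v z}"
    then have "inversion t a z \<in> {x \<in> K. M \<le> u x}"
      using homeomorphism_image2[OF homeomorphism_U] closure_subset by (auto simp: K_def C_def v_def)
    moreover have "inversion a t (inversion t a z) = z"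
      using z_superlevel homeomorphism_apply2[OF homeomorphism_U] by simp
    ultimately show "z \<in> inversion a t ` {x \<in> K. M \<le> u x}" by force
  qed
  ultimately show ?thesis by simp
qed

lemma inversion_factor_bounds:
  assumes "z \<in> D"
  shows "1 / (4 * (norm z)\<^sup>2) \<le> inversion_factor t z" and "inversion_factor t z \<le> 4 / (norm z)\<^sup>2"
proof -
  have norm_z: "2 * norm t < norm z" "0 < norm z" using assms R_bounds by (auto simp: D_def)
  then have distance_bounds: "norm (z - t) \<le> 2 * norm z" "norm z / 2 \<le> norm (z - t)"
    using norm_triangle_ineq4[of z t] norm_triangle_ineq2[of z t] by linarith+
  then have squares: "(norm (z - t))\<^sup>2 \<le> (2 * norm z)\<^sup>2" "(norm z / 2)\<^sup>2 \<le> (norm (z - t))\<^sup>2"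
    by (intro power_mono; simp)+
  have distance_pos: "0 < (norm (z - t))\<^sup>2" using distance_bounds norm_z by (intro zero_less_power) linarith
  have factor: "inversion_factor t z = 1 / (norm (z - t))\<^sup>2"
    by (simp add: inversion_factor_def power2_norm_eq_inner)
  have "1 / (2 * norm z)\<^sup>2 \<le> 1 / (norm (z - t))\<^sup>2"
    using squares(1) distance_pos norm_z by (intro divide_left_mono mult_pos_pos) auto
  then show "1 / (4 * (norm z)\<^sup>2) \<le> inversion_factor t z" by (simp add: factor power_mult_distrib)
  have "1 / (norm (z - t))\<^sup>2 \<le> 1 / (norm z / 2)\<^sup>2"
    using squares(2) distance_pos norm_z by (intro divide_left_mono mult_pos_pos) auto
  then show "inversion_factor t z \<le> 4 / (norm z)\<^sup>2" by (simp add: factor power_divide)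
qed

lemma bounded_above:
  assumes k_pos: "0 < k" and growth: "\<And>r. r0 \<le> r \<Longrightarrow> k * r ^ (2 * CARD('n) - 1) \<le> g r"
  obtains M where "\<And>z. z \<in> D \<Longrightarrow> v z \<le> M"
proof -
  have "compact (frontier \<Omega>)" using bdry by (simp add: compact_C2_boundary_def)
  then obtain b where \<Phi>_le_b: "\<And>x. x \<in> frontier \<Omega> \<Longrightarrow> \<Phi> x \<le> b"
    using continuous_on_compact_bounded_above[OF _ continuous_on_subset[OF \<Phi>_cont subset_UNIV]] by blast
  let ?sphere = "{z \<in> U. R \<le> norm z \<and> norm z \<le> R \<and> b + 1 \<le> v z}"
  have "compact ?sphere" using \<Phi>_le_b by (intro compact_superlevel) force+
  moreover have "continuous_on ?sphere v" by (rule continuous_on_subset[OF v_cont]) auto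
  ultimately obtain b' where v_le_b': "\<And>z. z \<in> ?sphere \<Longrightarrow> v z \<le> b'"
    using continuous_on_compact_bounded_above[of ?sphere v] by blast
  define M where "M = max (max 0 r0) (max (b + 1) (b' + 1))"
  have M_bounds: "0 \<le> M" "r0 \<le> M" "b < M" "b + 1 \<le> M" "b' < M" by (auto simp: M_def)
  have sphere: "v z < M" if "z \<in> U" "norm z = R" for z using v_le_b'[of z] that M_bounds by force
  interpret half_space_subsolution D "\<lambda>z. v z - M" f e by (rule half_space_subsolution)
  interpret absorbed_half_space_subsolution D "\<lambda>z. v z - M" f e "k / 4 ^ CARD('n)"
  proof
    show "0 < k / 4 ^ CARD('n)" using k_pos by simp
    have "{z \<in> D. norm z \<le> T \<and> 0 \<le> v z - M} = {z \<in> U. R \<le> norm z \<and> norm z \<le> T \<and> M \<le> v z}" for T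
      using sphere by (force simp: D_def)
    moreover have "compact {z \<in> U. R \<le> norm z \<and> norm z \<le> T \<and> M \<le> v z}" for T
      using \<Phi>_le_b M_bounds by (intro compact_superlevel) force+
    ultimately show "compact {z \<in> D. norm z \<le> T \<and> 0 \<le> v z - M}" for T by simp
  next
    fix z assume z_positive: "z \<in> D" "0 < v z - M"
    let ?n = "2 * DIM(real^'n) - 1"
    have "k / 4 ^ CARD('n) * (v z - M) ^ ?n / norm z ^ (2 * DIM(real^'n))
        = (1 / (4 * (norm z)\<^sup>2)) ^ CARD('n) * (k * (v z - M) ^ ?n)"
      by (simp add: power_divide power_mult_distrib flip: power_mult)
    also have "\<dots> \<le> inversion_factor t z ^ CARD('n) * (k * v z ^ ?n)"
      using inversion_factor_bounds(1)[OF z_positive(1)] k_pos z_positive(2) M_bounds(1)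
      by (intro mult_mono power_mono) auto
    also have "\<dots> \<le> f z"
      unfolding f_def using growth[of "v z"] z_positive(2) M_bounds(2) by (intro mult_left_mono) auto
    finally show "k / 4 ^ CARD('n) * (v z - M) ^ ?n / norm z ^ (2 * DIM(real^'n)) \<le> f z" .
  qed
  show thesis using nonpos by (intro that[of M]) force
qed

lemma le_boundary_value_near_infinity:
  assumes v_le_M: "\<And>z. z \<in> D \<Longrightarrow> v z \<le> M" and "0 < d" and \<Phi>_less: "\<And>x. dist x a < d \<Longrightarrow> \<Phi> x < L" and "0 < \<eta>"
  shows "\<exists>T. \<forall>z\<in>D. T \<le> norm z \<longrightarrow> v z - L \<le> \<eta>"
proof -
  obtain Q where g_ge: "\<And>r. r \<in> {L..M} \<Longrightarrow> - g r \<le> Q"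
    using continuous_on_compact_bounded_above[OF compact_Icc
        continuous_on_minus[OF continuous_on_subset[OF g_cont subset_UNIV]]]
    by blast
  define R' where "R' = R + 1 + norm t + 2 / d"
  have R'_bounds: "R < R'" "norm t + 1 / (d / 2) \<le> R'"
    using \<open>0 < d\<close> R_bounds(1) by (simp_all add: R'_def add_pos_nonneg)
  interpret half_space_subsolution D "\<lambda>z. v z - L" f e by (rule half_space_subsolution)
  interpret bounded_half_space_subsolution D "\<lambda>z. v z - L" f e R' "max 0 Q * 4 ^ CARD('n)" "M - L"
  proof
    fix S T assume "R' \<le> S"
    have "\<Phi> x < L" if "x \<noteq> a" "S \<le> norm (inversion a t x)" for x
    proof (rule \<Phi>_less)
      have "norm (x - a) \<le> d / 2"
        using norm_diff_less_if_norm_inversion[of x a "d / 2" t] that \<open>R' \<le> S\<close> R'_bounds(2) \<open>0 < d\<close> by simp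
      then show "dist x a < d" using \<open>0 < d\<close> by (simp add: dist_norm)
    qed
    then have "compact {z \<in> U. S \<le> norm z \<and> norm z \<le> T \<and> L \<le> v z}"
      using R'_bounds(1) \<open>R' \<le> S\<close> by (intro compact_superlevel) auto
    then show "compact {z \<in> D. S \<le> norm z \<and> norm z \<le> T \<and> 0 \<le> v z - L}"
      by (rule back_subst[of compact]) (use R'_bounds(1) \<open>R' \<le> S\<close> in \<open>auto simp: D_def\<close>)
  next
    fix z assume z_positive: "z \<in> D" "0 < v z - L"
    have "- max 0 Q \<le> g (v z)" using g_ge[of "v z"] v_le_M[OF z_positive(1)] z_positive(2) by force
    then have "inversion_factor t z ^ CARD('n) * - max 0 Q \<le> f z"
      unfolding f_def by (intro mult_left_mono) auto
    moreover have "inversion_factor t z ^ CARD('n) * max 0 Q \<le> (4 / (norm z)\<^sup>2) ^ CARD('n) * max 0 Q"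
      using inversion_factor_bounds(2)[OF z_positive(1)] by (intro mult_right_mono power_mono) auto
    moreover have "(4 / (norm z)\<^sup>2) ^ CARD('n) = 4 ^ CARD('n) / norm z ^ (2 * CARD('n))"
      by (simp add: power_divide flip: power_mult)
    ultimately show "- (max 0 Q * 4 ^ CARD('n) / norm z ^ (2 * DIM(real^'n))) \<le> f z"
      by (simp add: mult.commute)
  qed (use R_bounds R'_bounds v_le_M in auto)
  show ?thesis by (rule le_near_infinity[OF \<open>0 < \<eta>\<close>])
qed

lemma eventually_less_boundary_value:
  assumes "0 < k" and "\<And>r. r0 \<le> r \<Longrightarrow> k * r ^ (2 * CARD('n) - 1) \<le> g r" and "\<Phi> a < y"
  shows "\<forall>\<^sub>F x in at a within \<Omega>. u x < y"
proof -
  obtain M where v_le_M: "\<And>z. z \<in> D \<Longrightarrow> v z \<le> M" using bounded_above assms(1,2) by blast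
  obtain L where L_between: "\<Phi> a < L" "L < y" using dense[OF assms(3)] by blast
  have "isCont \<Phi> a" using \<Phi>_cont by (simp add: continuous_on_eq_continuous_at)
  then have "\<forall>\<^sub>F x in nhds a. \<Phi> x < L"
    using L_between(1) by (intro order_tendstoD) (auto simp: isCont_def tendsto_at_iff_tendsto_nhds)
  then obtain d where "0 < d" "\<And>x. dist x a < d \<Longrightarrow> \<Phi> x < L" by (auto simp: eventually_nhds_metric)
  with v_le_M obtain T where v_le_beyond_T: "\<And>z. z \<in> D \<Longrightarrow> T \<le> norm z \<Longrightarrow> v z - L \<le> (y - L) / 2"
    using le_boundary_value_near_infinity[of M d L "(y - L) / 2"] L_between(2) by auto
  have "\<forall>\<^sub>F x in at a within \<Omega>. max T R < norm (inversion a t x)"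
    using eventually_norm_inversion[where T="max T R" and a=a and t=t]
    by (rule filter_leD[OF at_le[OF subset_UNIV]])
  then have "\<forall>\<^sub>F x in at a within \<Omega>. x \<in> \<Omega> \<and> max T R < norm (inversion a t x)"
    by (auto simp: eventually_at_filter elim: eventually_mono)
  then show ?thesis
  proof (rule eventually_mono)
    fix x assume x_near_a: "x \<in> \<Omega> \<and> max T R < norm (inversion a t x)"
    then have "v (inversion a t x) - L \<le> (y - L) / 2" by (intro v_le_beyond_T) (auto simp: D_def U_def)
    then show "u x < y"
      using x_near_a L_between(2) homeomorphism_apply1[OF homeomorphism_U] by (simp add: v_def field_simps)
  qed
qed

end

lemma (in punctured_solution) eventually_less:
  assumes "0 < k" and "\<And>r. r0 \<le> r \<Longrightarrow> k * r ^ (2 * CARD('n) - 1) \<le> g r" and "\<Phi> a < y"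
  shows "\<forall>\<^sub>F x in at a within \<Omega>. u x < y"
proof -
  obtain e s \<delta> where norm_e: "norm e = 1" and "0 \<le> s" "0 < \<delta>"
    and ball: "\<And>x. x \<in> \<Omega> \<Longrightarrow> norm (x - a) < \<delta> \<Longrightarrow> - s * (norm (x - a))\<^sup>2 < e \<bullet> (x - a)"
    using exterior_ball[OF bdry open_\<Omega> a_frontier] by blast
  define t where "t = s *\<^sub>R e"
  define R where "R = 2 * norm t + 2 / \<delta> + 1"
  have R_bounds: "0 < R" "2 * norm t < R" "norm t + 1 / (\<delta> / 2) \<le> R"
    using \<open>0 < \<delta>\<close> by (simp_all add: R_def add_nonneg_pos)
  interpret inverted_solution \<Omega> a g u Du \<Phi> t e R
  proof
    fix x assume x_far: "x \<in> \<Omega>" "R \<le> norm (inversion a t x)"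
    have "x \<noteq> a" using x_far(1) a_notin_\<Omega> by auto
    then have "norm (x - a) \<le> \<delta> / 2"
      using norm_diff_less_if_norm_inversion[of x a "\<delta> / 2" t] x_far(2) R_bounds(3) \<open>0 < \<delta>\<close> by simp
    then have "- s * (norm (x - a))\<^sup>2 < e \<bullet> (x - a)" using ball[OF x_far(1)] \<open>0 < \<delta>\<close> by simp
    moreover have "e \<bullet> inversion a t x = s + (e \<bullet> (x - a)) / (norm (x - a))\<^sup>2"
      using norm_e by (simp add: inversion_def inversion_factor_def t_def inner_add_right norm_eq_1 power2_norm_eq_inner)
    ultimately have "0 < (e \<bullet> inversion a t x) * (norm (x - a))\<^sup>2"
      using \<open>x \<noteq> a\<close> by (simp add: distrib_right)
    then show "0 < e \<bullet> inversion a t x" using \<open>x \<noteq> a\<close> by (simp add: zero_less_mult_iff)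
  qed (use norm_e R_bounds in auto)
  show ?thesis by (rule eventually_less_boundary_value[OF assms])
qed

lemma Liminf_pos_imp_growth:
  assumes "0 < Liminf at_top (\<lambda>r. ereal (g r / r ^ m))"
  obtains k r0 where "0 < k" "\<And>r. r0 \<le> r \<Longrightarrow> k * r ^ m \<le> g r"
proof -
  obtain k where k_between: "0 < ereal k" "ereal k < Liminf at_top (\<lambda>r. ereal (g r / r ^ m))"
    using ereal_dense2[OF assms] by blast
  from less_LiminfD[OF k_between(2)] obtain r1 where k_less_beyond_r1: "\<And>r. r1 \<le> r \<Longrightarrow> k < g r / r ^ m"
    by (auto simp: eventually_at_top_linorder)
  have "k * r ^ m \<le> g r" if "max r1 1 \<le> r" for r
    using k_less_beyond_r1[of r] that by (simp add: pos_less_divide_eq)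
  then show thesis using k_between(1) by (intro that[of k "max r1 1"]) auto
qed

lemma Liminf_at_top_uminus_reflect:
  "Liminf at_top (\<lambda>r. ereal (- g (- r) / r ^ m)) = - Limsup at_bot (\<lambda>r. ereal (g r / \<bar>r\<bar> ^ m))"
proof -
  have "- Limsup at_bot (\<lambda>r. ereal (g r / \<bar>r\<bar> ^ m)) = Liminf at_bot (\<lambda>r. - ereal (g r / \<bar>r\<bar> ^ m))"
    by (rule ereal_Liminf_uminus[symmetric])
  also have "\<dots> = Liminf at_top (\<lambda>r. - ereal (g (- r) / \<bar>- r\<bar> ^ m))"
    by (simp add: at_bot_mirror Liminf_filtermap_eq)
  also have "\<dots> = Liminf at_top (\<lambda>r. ereal (- g (- r) / r ^ m))"
    by (rule Liminf_eq) (auto intro: eventually_mono[OF eventually_ge_at_top[of 0]])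
  finally show ?thesis ..
qed

lemma continuous_on_extend_by_limit:
  fixes u :: "'a::t1_space \<Rightarrow> 'b::topological_space"
  assumes "continuous_on (S - {a}) u" "(u \<longlongrightarrow> l) (at a within S)"
  shows "continuous_on S (u(a := l))"
  unfolding continuous_on_def
proof
  fix x assume "x \<in> S"
  show "(u(a := l) \<longlongrightarrow> (u(a := l)) x) (at x within S)"
  proof (cases "x = a")
    case True
    have "\<forall>\<^sub>F y in at a within S. u y = (u(a := l)) y" by (simp add: eventually_at_filter)
    from Lim_transform_eventually[OF assms(2) this] show ?thesis using True by (simp add: fun_upd_def)
  next
    case False
    then have "(u \<longlongrightarrow> u x) (at x within S - {a})" using assms(1) \<open>x \<in> S\<close> by (simp add: continuous_on_def)
    moreover have "at x within S - {a} = at x within S"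
      using False by (intro at_within_nhd[of x "- {a}"]) auto
    ultimately have "(u \<longlongrightarrow> u x) (at x within S)" by simp
    moreover have "\<forall>\<^sub>F y in nhds x. y \<noteq> a" using t1_space_nhds[of x a] False by simp
    then have "\<forall>\<^sub>F y in at x within S. u y = (u(a := l)) y"
      unfolding eventually_at_filter by (rule eventually_mono) simp
    ultimately show ?thesis using False by (simp add: Lim_transform_eventually)
  qed
qed

lemma (in punctured_solution) tendsto_boundary_value:
  assumes "0 < Liminf at_top (\<lambda>r. ereal (g r / r ^ (2 * CARD('n) - 1)))"
    and "Limsup at_bot (\<lambda>r. ereal (g r / \<bar>r\<bar> ^ (2 * CARD('n) - 1))) < 0"
  shows "(u \<longlongrightarrow> \<Phi> a) (at a within closure \<Omega>)"
proof -
  interpret neg: punctured_solution \<Omega> a "\<lambda>r. - g (- r)" "\<lambda>x. - u x" "\<lambda>x. - Du x" "\<lambda>x. - \<Phi> x"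
    by (rule uminus)
  obtain k r0 where above: "0 < k" "\<And>r. r0 \<le> r \<Longrightarrow> k * r ^ (2 * CARD('n) - 1) \<le> g r"
    using Liminf_pos_imp_growth[OF assms(1)] by blast
  have "0 < Liminf at_top (\<lambda>r. ereal (- g (- r) / r ^ (2 * CARD('n) - 1)))"
    unfolding Liminf_at_top_uminus_reflect using assms(2) by (simp add: ereal_less_uminus_reorder)
  from Liminf_pos_imp_growth[OF this]
  obtain k' r0' where below: "0 < k'" "\<And>r. r0' \<le> r \<Longrightarrow> k' * r ^ (2 * CARD('n) - 1) \<le> - g (- r)"
    by blast
  have "(u \<longlongrightarrow> \<Phi> a) (at a within \<Omega>)"
  proof (rule order_tendstoI)
    show "\<forall>\<^sub>F x in at a within \<Omega>. u x < y" if "\<Phi> a < y" for y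
      by (rule eventually_less[OF above that])
    show "\<forall>\<^sub>F x in at a within \<Omega>. y < u x" if "y < \<Phi> a" for y
      using neg.eventually_less[OF below, where y="- y"] that by simp
  qed
  moreover have "(u \<longlongrightarrow> \<Phi> a) (at a within frontier \<Omega>)"
  proof -
    have "(\<Phi> \<longlongrightarrow> \<Phi> a) (at a within frontier \<Omega>)"
      using continuous_on_subset[OF \<Phi>_cont subset_UNIV] a_frontier by (auto simp: continuous_on_def)
    moreover have "\<forall>\<^sub>F x in at a within frontier \<Omega>. \<Phi> x = u x"
      using boundary_values by (simp add: eventually_at_filter)
    ultimately show ?thesis using tendsto_cong by fast
  qed
  moreover have "closure \<Omega> = \<Omega> \<union> frontier \<Omega>"
    using closure_subset[of \<Omega>] open_\<Omega> by (auto simp: frontier_def interior_open)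
  ultimately show ?thesis by (simp add: Lim_within_Un)
qed

theorem theorem3p1:
  fixes \<Omega> :: "(real^'n) set" and a :: "real^'n" and g :: "real \<Rightarrow> real"
    and u :: "real^'n \<Rightarrow> real" and Du :: "real^'n \<Rightarrow> real^'n"
    and \<Phi> :: "real^'n \<Rightarrow> real"
  assumes N: "CARD('n) \<ge> 2"
    and dom: "open \<Omega>" "connected \<Omega>" "\<Omega> \<noteq> {}"
    and bdry: "compact_C2_boundary \<Omega>"
    and a: "a \<in> frontier \<Omega>"
    and g_cont: "continuous_on UNIV g"
    and g_pos: "Liminf at_top (\<lambda>r. ereal (g r / r ^ (2 * CARD('n) - 1))) > 0"
    and g_neg: "Limsup at_bot (\<lambda>r. ereal (g r / \<bar>r\<bar> ^ (2 * CARD('n) - 1))) < 0"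
    and u_diff: "\<forall>x\<in>\<Omega>. (u has_derivative (\<lambda>h. Du x \<bullet> h)) (at x)"
    and u_C1: "continuous_on (closure \<Omega> - {a}) u" "continuous_on (closure \<Omega> - {a}) Du"
    and sol: "weak_solution \<Omega> g u Du"
    and phi: "C1_on \<Phi> UNIV"
    and bc: "\<forall>x\<in>frontier \<Omega> - {a}. u x = \<Phi> x"
  shows "\<exists>v. continuous_on (closure \<Omega>) v \<and> (\<forall>x\<in>closure \<Omega> - {a}. v x = u x)"
proof -
  have "continuous_on UNIV \<Phi>"
    using phi unfolding C1_on_def
    by (meson UNIV_I continuous_at_imp_continuous_on has_derivative_continuous)
  then interpret punctured_solution \<Omega> a g u Du \<Phi>
    by unfold_locales (use assms in auto)
  have "continuous_on (closure \<Omega>) (u(a := \<Phi> a))"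
    by (rule continuous_on_extend_by_limit[OF u_cont tendsto_boundary_value[OF g_pos g_neg]])
  then show ?thesis by (intro exI[of _ "u(a := \<Phi> a)"]) simp
qed

end
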